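(* Let $\Bbbk$ be a field and let $A$ be a Poisson algebra over $\Bbbk$ with affine Poisson center $\mathcal Z_P=\mathcal Z_P(A)$. Let $\mathcal P$ be a stable property and assume that the $\mathcal P$-discriminant $d=d_{\mathcal P}(A)$ of $A$ exists. (1) Suppose $A$ is an affine domain. If $d$ is effective (respectively, Poisson effective) in $A$, then $A$ is strongly Poisson cancellative. (2) Suppose $A$ is noetherian and $\mathcal Z_P$ is a domain. If $d$ is effective in $\mathcal Z_P$, then $A$ is strongly Poisson cancellative.
   Context: A Poisson algebra over $\Bbbk$ is a commutative $\Bbbk$-algebra $A$ with a $\Bbbk$-bilinear bracket $\{\,,\}$ making $A$ a Lie algebra and such that $\{a,-\}$ is a $\Bbbk$-derivation for every $a\in A$. Affine means finitely generated as a $\Bbbk$-algebra; domain means integral domain. The Poisson center is $\mathcal Z_P(A)=\{z\in A:\{z,a\}=0\ \forall a\in A\}$. $A[t_1,\dots,t_n]=A\otimes\Bbbk[t_1,\dots,t_n]$ carries the bracket extending that of $A$ with all $t_i$ Poisson central; its Poisson center is $\mathcal Z_P(A)[t_1,\dots,t_n]$. $A$ is strongly Poisson cancellative if for every Poisson algebra $B$ over $\Bbbk$ and every $n\ge1$, $A[t_1,\dots,t_n]\cong B[t_1,\dots,t_n]$ as Poisson algebras implies $A\cong B$ as Poisson algebras. Discriminant. A property $\mathcal P$ is a property of Poisson algebras invariant under isomorphism. Put $L_{\mathcal P}(A)=\{\mathfrak m\in\mathrm{MaxSpec}(\mathcal Z_P(A)): A/\mathfrak mA\text{ has property }\mathcal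 P\}$, $D_{\mathcal P}(A)=\mathrm{MaxSpec}(\mathcal Z_P(A))\setminus L_{\mathcal P}(A)$, $I_{\mathcal P}(A)=\bigcap_{\mathfrak m\in D_{\mathcal P}(A)}\mathfrak m\subseteq\mathcal Z_P(A)$. If $I_{\mathcal P}(A)$ is a principal ideal of $\mathcal Z_P(A)$ generated by $d$, then $d=d_{\mathcal P}(A)$ is the $\mathcal P$-discriminant of $A$ and is said to exist. $\mathcal P$ is stable if for every Poisson $\Bbbk$-algebra $C$ with affine Poisson center and every $n\ge1$, $I_{\mathcal P}(C\otimes\Bbbk[t_1,\dots,t_n])=I_{\mathcal P}(C)\otimes\Bbbk[t_1,\dots,t_n]$ as ideals of $\mathcal Z_P(C)\otimes\Bbbk[t_1,\dots,t_n]$. Effectiveness. An $\mathbb N$-filtration $F$ on an algebra $C$ is an ascending exhaustive chain of subspaces $F_iC$, $i\ge0$, with $F_iC\cdot F_jC\subseteq F_{i+j}C$; it is a Poisson filtration if also $\{F_iC,F_jC\}\subseteq F_{i+j}C$. The degree of a nonzero element is the least $i$ with the element in $F_i$. Let $C$ be an affine commutative (respectively, Poisson) domain generated as an algebra by $Y=\bigoplus_{i=1}^n\Bbbk x_i$. An element $0\ne f\in C$ is effective (respectively, Poisson effective) in $C$ if: (1) there is an $\mathbb N$-filtration (respectively, Poisson $\mathbb N$-filtration) $F$ on $C$ such that $\mathrm{gr}_F(C)$ is a domain, with associated degree $\deg_C$; and (2) for every $\mathbb N$-filtered commutative algebra (respectively, $\mathbb N$-filtered Poisson algebra) $T$ with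 $\mathrm{gr}\,T$ an $\mathbb N$-graded domain (respectively, Poisson domain), with associated degree $\deg_T$, and every subset $\{y_1,\dots,y_n\}\subset T$ that (a) is linearly independent in $T/\Bbbk 1_T$ and (b) satisfies $\deg_T y_i\ge\deg_C x_i$ for all $i$ and $\deg_T y_{i_0}>\deg_C x_{i_0}$ for some $i_0$, there is a polynomial presentation $f=f(x_1,\dots,x_n)$ of $f$ such that either $f(y_1,\dots,y_n)=0$ or $\deg_T f(y_1,\dots,y_n)>\deg_C f$.
   Formalization: In "effective", the generators x_1,…,x_n are required to be linearly independent modulo k·1, not only in C; if 1 lay in their span every nonzero element would be effective and (1) would fail for Danielewski surfaces with zero bracket and d=1. *)

theory Defs
  imports "HOL-Algebra.Indexed_Polynomials" "HOL-Algebra.Module"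
begin

text \<open>
  Universe convention. HOL cannot quantify over types inside a formula, so the clauses
  ``for every Poisson algebra B'', ``for every Poisson algebra C'' and ``for every filtered
  algebra T'' below range over the algebras whose carrier lies in one type \<open>'a\<close>, the one
  carrying the algebra under discussion. The main theorem takes \<open>'a\<close> to be an arbitrary infinite
  type, so that \<open>'a\<close> contains a copy of every polynomial extension, subalgebra and quotient of an
  algebra it carries. Algebras on different types are covered by passing to, say,
  \<open>'a + 'b + nat\<close>.
\<close>

section \<open>Poisson algebras\<close>

record ('k, 'a) palg = "('k, 'a) module" +
  pbracket :: "'a \<Rightarrow> 'a \<Rightarrow> 'a"  (\<open>\<lbrace>_, _\<rbrace>\<index>\<close>)

locale poisson_algebra = algebra K A
  for K (structure) and A :: "('k, 'a, 'z) palg_scheme" (structure) +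
  assumes bracket_closed:
      "\<lbrakk>a \<in> carrier A; b \<in> carrier A\<rbrakk> \<Longrightarrow> \<lbrace>a, b\<rbrace>\<^bsub>A\<^esub> \<in> carrier A"
    and bracket_add_left:
      "\<lbrakk>a \<in> carrier A; b \<in> carrier A; c \<in> carrier A\<rbrakk> \<Longrightarrow>
        \<lbrace>a \<oplus>\<^bsub>A\<^esub> b, c\<rbrace>\<^bsub>A\<^esub> = \<lbrace>a, c\<rbrace>\<^bsub>A\<^esub> \<oplus>\<^bsub>A\<^esub> \<lbrace>b, c\<rbrace>\<^bsub>A\<^esub>"
    and bracket_add_right:
      "\<lbrakk>a \<in> carrier A; b \<in> carrier A; c \<in> carrier A\<rbrakk> \<Longrightarrow>
        \<lbrace>a, b \<oplus>\<^bsub>A\<^esub> c\<rbrace>\<^bsub>A\<^esub> = \<lbrace>a, b\<rbrace>\<^bsub>A\<^esub> \<oplus>\<^bsub>A\<^esub> \<lbrace>a, c\<rbrace>\<^bsub>A\<^esub>"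
    and bracket_smult_left:
      "\<lbrakk>k \<in> carrier K; a \<in> carrier A; b \<in> carrier A\<rbrakk> \<Longrightarrow>
        \<lbrace>k \<odot>\<^bsub>A\<^esub> a, b\<rbrace>\<^bsub>A\<^esub> = k \<odot>\<^bsub>A\<^esub> \<lbrace>a, b\<rbrace>\<^bsub>A\<^esub>"
    and bracket_smult_right:
      "\<lbrakk>k \<in> carrier K; a \<in> carrier A; b \<in> carrier A\<rbrakk> \<Longrightarrow>
        \<lbrace>a, k \<odot>\<^bsub>A\<^esub> b\<rbrace>\<^bsub>A\<^esub> = k \<odot>\<^bsub>A\<^esub> \<lbrace>a, b\<rbrace>\<^bsub>A\<^esub>"
    and bracket_self:
      "a \<in> carrier A \<Longrightarrow> \<lbrace>a, a\<rbrace>\<^bsub>A\<^esub> = \<zero>\<^bsub>A\<^esub>"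
    and bracket_jacobi:
      "\<lbrakk>a \<in> carrier A; b \<in> carrier A; c \<in> carrier A\<rbrakk> \<Longrightarrow>
        \<lbrace>a, \<lbrace>b, c\<rbrace>\<^bsub>A\<^esub>\<rbrace>\<^bsub>A\<^esub> \<oplus>\<^bsub>A\<^esub> \<lbrace>b, \<lbrace>c, a\<rbrace>\<^bsub>A\<^esub>\<rbrace>\<^bsub>A\<^esub> \<oplus>\<^bsub>A\<^esub> \<lbrace>c, \<lbrace>a, b\<rbrace>\<^bsub>A\<^esub>\<rbrace>\<^bsub>A\<^esub> = \<zero>\<^bsub>A\<^esub>"
    and bracket_leibniz:
      "\<lbrakk>a \<in> carrier A; b \<in> carrier A; c \<in> carrier A\<rbrakk> \<Longrightarrow>
        \<lbrace>a, b \<otimes>\<^bsub>A\<^esub> c\<rbrace>\<^bsub>A\<^esub> = \<lbrace>a, b\<rbrace>\<^bsub>A\<^esub> \<otimes>\<^bsub>A\<^esub> c \<oplus>\<^bsub>A\<^esub> b \<otimes>\<^bsub>A\<^esub> \<lbrace>a, c\<rbrace>\<^bsub>A\<^esub>"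

definition poisson_iso ::
    "('k, 'r) ring_scheme \<Rightarrow> ('k, 'a, 'y) palg_scheme \<Rightarrow> ('k, 'b, 'z) palg_scheme \<Rightarrow> ('a \<Rightarrow> 'b) set"
  where "poisson_iso K A B =
    {h \<in> ring_iso A B.
      (\<forall>k\<in>carrier K. \<forall>a\<in>carrier A. h (k \<odot>\<^bsub>A\<^esub> a) = k \<odot>\<^bsub>B\<^esub> h a) \<and>
      (\<forall>a\<in>carrier A. \<forall>b\<in>carrier A. h \<lbrace>a, b\<rbrace>\<^bsub>A\<^esub> = \<lbrace>h a, h b\<rbrace>\<^bsub>B\<^esub>)}"

definition poisson_isomorphic ::
    "('k, 'r) ring_scheme \<Rightarrow> ('k, 'a, 'y) palg_scheme \<Rightarrow> ('k, 'b, 'z) palg_scheme \<Rightarrow> bool"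
  where "poisson_isomorphic K A B \<longleftrightarrow> poisson_iso K A B \<noteq> {}"

definition poisson_center :: "('k, 'a, 'z) palg_scheme \<Rightarrow> ('k, 'a, 'z) palg_scheme"
  where "poisson_center A =
    A\<lparr>carrier := {z \<in> carrier A. \<forall>a\<in>carrier A. \<lbrace>z, a\<rbrace>\<^bsub>A\<^esub> = \<zero>\<^bsub>A\<^esub>}\<rparr>"

text \<open>The operations on cosets follow \<^const>\<open>rcoset_mult\<close>.\<close>
definition poisson_quot :: "('k, 'a, 'z) palg_scheme \<Rightarrow> 'a set \<Rightarrow> ('k, 'a set) palg"
  where "poisson_quot A I =
    \<lparr>carrier = carrier (A Quot I), monoid.mult = monoid.mult (A Quot I), one = one (A Quot I),
     zero = ring.zero (A Quot I), add = add (A Quot I),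
     smult = (\<lambda>k U. \<Union>a\<in>U. I +>\<^bsub>A\<^esub> (k \<odot>\<^bsub>A\<^esub> a)),
     pbracket = (\<lambda>U V. \<Union>a\<in>U. \<Union>b\<in>V. I +>\<^bsub>A\<^esub> \<lbrace>a, b\<rbrace>\<^bsub>A\<^esub>)\<rparr>"

text \<open>
  The polynomial extension \<open>A[t\<^sub>1, \<dots>, t\<^sub>n]\<close>: a polynomial maps each monomial, a multiset of
  variable indices, to its coefficient. The bracket is the \<open>k[t\<^sub>1, \<dots>, t\<^sub>n]\<close>-bilinear extension
  of that of \<open>A\<close>.
\<close>
definition poly_ext :: "('k, 'a, 'z) palg_scheme \<Rightarrow> nat \<Rightarrow> ('k, nat multiset \<Rightarrow> 'a) palg"
  where "poly_ext A n =
    \<lparr>carrier = ring.indexed_pset A {..<n} (carrier A),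
     monoid.mult = (\<lambda>f g m. \<Oplus>\<^bsub>A\<^esub>l\<in>{l. l \<subseteq># m}. f l \<otimes>\<^bsub>A\<^esub> g (m - l)),
     one = ring.indexed_const A \<one>\<^bsub>A\<^esub>,
     zero = ring.indexed_const A \<zero>\<^bsub>A\<^esub>,
     add = ring.indexed_padd A,
     smult = (\<lambda>k f m. k \<odot>\<^bsub>A\<^esub> f m),
     pbracket = (\<lambda>f g m. \<Oplus>\<^bsub>A\<^esub>l\<in>{l. l \<subseteq># m}. \<lbrace>f l, g (m - l)\<rbrace>\<^bsub>A\<^esub>)\<rparr>"

definition strongly_poisson_cancellative ::
    "('k, 'r) ring_scheme \<Rightarrow> ('k, 'a) palg \<Rightarrow> bool"
  where "strongly_poisson_cancellative K A \<longleftrightarrow>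
    (\<forall>(B :: ('k, 'a) palg) n. poisson_algebra K B \<longrightarrow> 1 \<le> n \<longrightarrow>
      poisson_isomorphic K (poly_ext A n) (poly_ext B n) \<longrightarrow> poisson_isomorphic K A B)"

section \<open>Affine algebras\<close>

definition generates_algebra ::
    "('k, 'r) ring_scheme \<Rightarrow> ('k, 'a, 'z) module_scheme \<Rightarrow> 'a set \<Rightarrow> bool"
  where "generates_algebra K A S \<longleftrightarrow> S \<subseteq> carrier A \<and>
    (\<forall>H. subring H A \<longrightarrow> submodule H K A \<longrightarrow> S \<subseteq> H \<longrightarrow> H = carrier A)"

definition affine_algebra :: "('k, 'r) ring_scheme \<Rightarrow> ('k, 'a, 'z) module_scheme \<Rightarrow> bool"
  where "affine_algebra K A \<longleftrightarrow> (\<exists>S. finite S \<and> generates_algebra K A S)"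

section \<open>Discriminants\<close>

definition poisson_property ::
    "('k, 'r) ring_scheme \<Rightarrow> (('k, 'a) palg \<Rightarrow> bool) \<Rightarrow> bool"
  where "poisson_property K P \<longleftrightarrow>
    (\<forall>A B. poisson_algebra K A \<longrightarrow> poisson_algebra K B \<longrightarrow>
      poisson_isomorphic K A B \<longrightarrow> P A \<longrightarrow> P B)"

text \<open>
  A property is a predicate on the Poisson algebras carried by one type. An algebra on another
  type (such as a quotient, whose elements are cosets) has the property if an isomorphic copy does.
\<close>
definition has_property ::
    "('k, 'r) ring_scheme \<Rightarrow> (('k, 'a) palg \<Rightarrow> bool) \<Rightarrow> ('k, 'b, 'z) palg_scheme \<Rightarrow> bool"
  where "has_property K P Q \<longleftrightarrow>
    (\<exists>B. poisson_algebra K B \<and> poisson_isomorphic K Q B \<and> P B)"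

definition max_spec :: "('a, 'z) ring_scheme \<Rightarrow> 'a set set"
  where "max_spec R = {m. maximalideal m R}"

definition L_locus ::
    "('k, 'r) ring_scheme \<Rightarrow> (('k, 'a) palg \<Rightarrow> bool) \<Rightarrow> ('k, 'b, 'z) palg_scheme \<Rightarrow> 'b set set"
  where "L_locus K P A =
    {m \<in> max_spec (poisson_center A). has_property K P (poisson_quot A (Idl\<^bsub>A\<^esub> m))}"

definition D_locus ::
    "('k, 'r) ring_scheme \<Rightarrow> (('k, 'a) palg \<Rightarrow> bool) \<Rightarrow> ('k, 'b, 'z) palg_scheme \<Rightarrow> 'b set set"
  where "D_locus K P A = max_spec (poisson_center A) - L_locus K P A"

text \<open>The intersection is taken inside the center: it is the whole center if the locus is empty.\<close>
definition disc_ideal ::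
    "('k, 'r) ring_scheme \<Rightarrow> (('k, 'a) palg \<Rightarrow> bool) \<Rightarrow> ('k, 'b, 'z) palg_scheme \<Rightarrow> 'b set"
  where "disc_ideal K P A = carrier (poisson_center A) \<inter> \<Inter>(D_locus K P A)"

definition is_discriminant ::
    "('k, 'r) ring_scheme \<Rightarrow> (('k, 'a) palg \<Rightarrow> bool) \<Rightarrow> ('k, 'b, 'z) palg_scheme \<Rightarrow> 'b \<Rightarrow> bool"
  where "is_discriminant K P A d \<longleftrightarrow>
    d \<in> carrier (poisson_center A) \<and> disc_ideal K P A = PIdl\<^bsub>poisson_center A\<^esub> d"

text \<open>
  \<open>I \<otimes> k[t\<^sub>1, \<dots>, t\<^sub>n]\<close> is the set of polynomials all of whose coefficients lie in \<open>I\<close>.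
\<close>
definition stable_property ::
    "('k, 'r) ring_scheme \<Rightarrow> (('k, 'a) palg \<Rightarrow> bool) \<Rightarrow> bool"
  where "stable_property K P \<longleftrightarrow>
    (\<forall>(C :: ('k, 'a) palg) n.
      poisson_algebra K C \<longrightarrow> affine_algebra K (poisson_center C) \<longrightarrow> 1 \<le> n \<longrightarrow>
      disc_ideal K P (poly_ext C n) = ring.indexed_pset C {..<n} (disc_ideal K P C))"

section \<open>Filtrations\<close>

definition filtration ::
    "('k, 'r) ring_scheme \<Rightarrow> ('k, 'a, 'z) module_scheme \<Rightarrow> (nat \<Rightarrow> 'a set) \<Rightarrow> bool"
  where "filtration K C F \<longleftrightarrow>
    (\<forall>i. submodule (F i) K C) \<and> (\<forall>i. F i \<subseteq> F (Suc i)) \<and> (\<Union>i. F i) = carrier C \<and>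
    (\<forall>i j. \<forall>a\<in>F i. \<forall>b\<in>F j. a \<otimes>\<^bsub>C\<^esub> b \<in> F (i + j))"

definition poisson_filtration ::
    "('k, 'r) ring_scheme \<Rightarrow> ('k, 'a, 'z) palg_scheme \<Rightarrow> (nat \<Rightarrow> 'a set) \<Rightarrow> bool"
  where "poisson_filtration K C F \<longleftrightarrow> filtration K C F \<and>
    (\<forall>i j. \<forall>a\<in>F i. \<forall>b\<in>F j. \<lbrace>a, b\<rbrace>\<^bsub>C\<^esub> \<in> F (i + j))"

definition filt_deg :: "(nat \<Rightarrow> 'a set) \<Rightarrow> 'a \<Rightarrow> nat"
  where "filt_deg F a = (LEAST i. a \<in> F i)"

definition filt_below :: "('a, 'z) ring_scheme \<Rightarrow> (nat \<Rightarrow> 'a set) \<Rightarrow> nat \<Rightarrow> 'a set"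
  where "filt_below C F i = (case i of 0 \<Rightarrow> {\<zero>\<^bsub>C\<^esub>} | Suc j \<Rightarrow> F j)"

text \<open>
  \<open>gr\<^sub>F C = \<Oplus>\<^sub>i F\<^sub>i / F\<^sub>i\<^sub>-\<^sub>1\<close> with \<open>F\<^sub>-\<^sub>1 = 0\<close>: finitely supported families of cosets. The component
  in degree \<open>i\<close> of a product is the coset of \<open>\<Sum>\<^sub>j x\<^sub>j y\<^sub>i\<^sub>-\<^sub>j\<close> for any choice of representatives.
\<close>
definition gr :: "('a, 'z) ring_scheme \<Rightarrow> (nat \<Rightarrow> 'a set) \<Rightarrow> (nat \<Rightarrow> 'a set) ring"
  where "gr C F =
    \<lparr>carrier = {U. (\<forall>i. \<exists>x\<in>F i. U i = filt_below C F i +>\<^bsub>C\<^esub> x) \<and>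
        finite {i. U i \<noteq> filt_below C F i}},
     monoid.mult = (\<lambda>U V i. \<Union>{filt_below C F i +>\<^bsub>C\<^esub> (\<Oplus>\<^bsub>C\<^esub>j\<in>{..i}. x j \<otimes>\<^bsub>C\<^esub> y (i - j)) | x y.
        (\<forall>j. x j \<in> U j) \<and> (\<forall>j. y j \<in> V j)}),
     one = (\<lambda>i. filt_below C F i +>\<^bsub>C\<^esub> (if i = 0 then \<one>\<^bsub>C\<^esub> else \<zero>\<^bsub>C\<^esub>)),
     zero = filt_below C F,
     add = (\<lambda>U V i. U i <+>\<^bsub>C\<^esub> V i)\<rparr>"

section \<open>Effectiveness\<close>

text \<open>Linear independence of \<open>y\<^sub>0, \<dots>, y\<^sub>n\<^sub>-\<^sub>1\<close> in \<open>T / k1\<close>.\<close>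
definition lin_indep_mod_one ::
    "('k, 'r) ring_scheme \<Rightarrow> ('k, 'a, 'z) module_scheme \<Rightarrow> nat \<Rightarrow> (nat \<Rightarrow> 'a) \<Rightarrow> bool"
  where "lin_indep_mod_one K T n y \<longleftrightarrow>
    (\<forall>c. c \<in> {..<n} \<rightarrow> carrier K \<longrightarrow>
      (\<exists>a\<in>carrier K. (\<Oplus>\<^bsub>T\<^esub>i\<in>{..<n}. c i \<odot>\<^bsub>T\<^esub> y i) = a \<odot>\<^bsub>T\<^esub> \<one>\<^bsub>T\<^esub>) \<longrightarrow>
      (\<forall>i<n. c i = \<zero>\<^bsub>K\<^esub>))"

text \<open>Evaluation of a polynomial with coefficients in \<open>K\<close> at elements of the algebra \<open>T\<close>.\<close>
definition poly_eval ::
    "('k, 'r) ring_scheme \<Rightarrow> ('k, 'a, 'z) module_scheme \<Rightarrow> (nat multiset \<Rightarrow> 'k) \<Rightarrow> (nat \<Rightarrow> 'a) \<Rightarrow> 'a"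
  where "poly_eval K T p y =
    (\<Oplus>\<^bsub>T\<^esub>m\<in>{m. p m \<noteq> \<zero>\<^bsub>K\<^esub>}. p m \<odot>\<^bsub>T\<^esub> (\<Otimes>\<^bsub>T\<^esub>i\<in>set_mset m. y i [^]\<^bsub>T\<^esub> count m i))"

text \<open>
  The generators are independent modulo \<open>k1\<close>, just as the test families are. If \<open>1\<close> were
  allowed in their span, every nonzero element would be effective: for \<open>x\<^sub>0 = 1\<close> one may add
  \<open>(x\<^sub>0 - 1) g\<close> with \<open>g\<close> of arbitrarily large degree to any presentation.
\<close>
definition generating_family ::
    "('k, 'r) ring_scheme \<Rightarrow> ('k, 'a, 'z) module_scheme \<Rightarrow> nat \<Rightarrow> (nat \<Rightarrow> 'a) \<Rightarrow> bool"
  where "generating_family K C n x \<longleftrightarrow>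
    x \<in> {..<n} \<rightarrow> carrier C \<and> lin_indep_mod_one K C n x \<and> generates_algebra K C (x ` {..<n})"

definition effective_against ::
    "('k, 'r) ring_scheme \<Rightarrow> ('k, 'a, 'y) module_scheme \<Rightarrow> nat \<Rightarrow> (nat \<Rightarrow> 'a) \<Rightarrow> (nat \<Rightarrow> 'a set) \<Rightarrow>
      'a \<Rightarrow> ('k, 'b, 'z) module_scheme \<Rightarrow> (nat \<Rightarrow> 'b set) \<Rightarrow> bool"
  where "effective_against K C n x F f T G \<longleftrightarrow>
    (\<forall>y. y \<in> {..<n} \<rightarrow> carrier T \<longrightarrow> lin_indep_mod_one K T n y \<longrightarrow>
      (\<forall>i<n. filt_deg F (x i) \<le> filt_deg G (y i)) \<longrightarrow>
      (\<exists>i<n. filt_deg F (x i) < filt_deg G (y i)) \<longrightarrow>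
      (\<exists>p\<in>ring.indexed_pset K {..<n} (carrier K).
        poly_eval K C p x = f \<and>
        (poly_eval K T p y = \<zero>\<^bsub>T\<^esub> \<or> filt_deg F f < filt_deg G (poly_eval K T p y))))"

definition effective ::
    "('k, 'r) ring_scheme \<Rightarrow> ('k, 'a, 'z) module_scheme \<Rightarrow> 'a \<Rightarrow> bool"
  where "effective K C f \<longleftrightarrow> f \<in> carrier C \<and> f \<noteq> \<zero>\<^bsub>C\<^esub> \<and>
    (\<exists>n x F. generating_family K C n x \<and> filtration K C F \<and> domain (gr C F) \<and>
      (\<forall>(T :: ('k, 'a) module) G.
        algebra K T \<longrightarrow> filtration K T G \<longrightarrow> domain (gr T G) \<longrightarrow>
        effective_against K C n x F f T G))"

text \<open>
  The associated graded ring of a Poisson filtration carries an induced Poisson bracket, so for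
  it to be a Poisson domain means that it is a domain.
\<close>
definition poisson_effective ::
    "('k, 'r) ring_scheme \<Rightarrow> ('k, 'a, 'z) palg_scheme \<Rightarrow> 'a \<Rightarrow> bool"
  where "poisson_effective K C f \<longleftrightarrow> f \<in> carrier C \<and> f \<noteq> \<zero>\<^bsub>C\<^esub> \<and>
    (\<exists>n x F. generating_family K C n x \<and> poisson_filtration K C F \<and> domain (gr C F) \<and>
      (\<forall>(T :: ('k, 'a) palg) G.
        poisson_algebra K T \<longrightarrow> poisson_filtration K T G \<longrightarrow> domain (gr T G) \<longrightarrow>
        effective_against K C n x F f T G))"

end

theory Submission
  imports Defs "HOL-Algebra.UnivPoly" "HOL-Library.Multiset_Order"
begin

text \<open>
  Fix a Poisson isomorphism between \<open>A[t\<^sub>1, \<dots>, t\<^sub>n]\<close> and \<open>B[s\<^sub>1, \<dots>, s\<^sub>n]\<close> and treat it as an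
  identification. The discriminant pins down a constant that both sides share, effectiveness of
  this constant forces the two coefficient rings to be nested, and a count of monomials forces
  them to be equal.

  The discriminant ideal is an isomorphism invariant (\<open>disc_ideal_iso\<close>), and by stability it is
  extended from the coefficients on both sides. So a nonzero coefficient of \<open>d\<close> in \<open>B\<close> lies in
  the ideal generated by \<open>d\<close>. The total degree is additive over a domain, so a divisor of
  a nonzero constant is constant, and \<open>d\<close> lies in \<open>B\<close> (\<open>discriminant_constant\<close>).

  Let \<open>x\<^sub>1, \<dots>, x\<^sub>N\<close> be the generators from the definition of effectiveness. Send one variable
  \<open>s\<^sub>j\<close> to a new variable \<open>u\<close> and fix \<open>B\<close> and the other \<open>s\<^sub>i\<close>. Extend the filtration of \<open>A\<close> to
  \<open>A[t\<^sub>1, \<dots>, t\<^sub>n]\<close> and then to \<open>B[s\<^sub>1, \<dots>, s\<^sub>n][u]\<close>, where \<open>u\<close> gets a weight above all degrees of the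
  \<open>x\<^sub>i\<close>. A generator in which \<open>s\<^sub>j\<close> does not occur is fixed and keeps its degree; the degree of
  every other one goes up. As \<open>d\<close> is in \<open>B\<close>, it is fixed as well, and effectiveness excludes
  that the degree of any generator goes up. This holds for every \<open>j\<close>, so \<open>A\<close> is contained in \<open>B\<close>
  (\<open>effective_image_of_constants\<close>). That the extended filtration again has a domain as its
  associated graded ring is seen from leading terms in a monomial order
  (\<open>ext_filtration_strict\<close>).

  If \<open>A\<close> is contained in \<open>B\<close> and \<open>b\<close> in \<open>B\<close> is nonzero with zero constant term in
  \<open>A[t\<^sub>1, \<dots>, t\<^sub>n]\<close>, then \<open>b, s\<^sub>1, \<dots>, s\<^sub>n\<close> are algebraically independent over \<open>A\<close>. But there are
  more monomials in these \<open>n + 1\<close> elements than monomials in \<open>t\<^sub>1, \<dots>, t\<^sub>n\<close> that they can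
  involve. Hence \<open>A = B\<close> (\<open>constants_surjective\<close>), which is part (1).

  In part (2) all this is applied to the Poisson centers, which are the coefficient rings of the
  centers of the two polynomial extensions, and gives that they coincide. Then every \<open>t\<^sub>i\<close> is
  a polynomial in the \<open>s\<^sub>j\<close> with coefficients in the common center, so that setting all \<open>s\<^sub>j\<close> to
  zero maps \<open>A\<close> onto \<open>B\<close> (\<open>constant_terms_surjective\<close>). By symmetry \<open>B\<close> maps onto \<open>A\<close>, and the
  composition is a surjective endomorphism of the noetherian ring \<open>A\<close>, hence injective.
\<close>

section \<open>Polynomials as finitely supported families of coefficients\<close>

definition pmonom :: "('a, 'z) ring_scheme \<Rightarrow> 'a \<Rightarrow> 'c multiset \<Rightarrow> 'c multiset \<Rightarrow> 'a"
  where "pmonom A a e = (\<lambda>m. if m = e then a else \<zero>\<^bsub>A\<^esub>)"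

lemma (in abelian_monoid) finite_support_induct:
  assumes fin: "finite {m. f m \<noteq> \<zero>}" and f: "\<And>m. f m \<in> S" "\<And>m. f m \<noteq> \<zero> \<Longrightarrow> m \<in> E"
    and S: "S \<subseteq> carrier G" "\<zero> \<in> S"
    and zero: "P (\<lambda>_. \<zero>)"
    and mono: "\<And>a e. a \<in> S \<Longrightarrow> e \<in> E \<Longrightarrow> P (pmonom G a e)"
    and add: "\<And>g h. P g \<Longrightarrow> P h \<Longrightarrow> P (\<lambda>m. g m \<oplus> h m)"
  shows "P f"
proof -
  have "\<lbrakk>{m. f m \<noteq> \<zero>} \<subseteq> F; \<And>m. f m \<in> S; \<And>m. f m \<noteq> \<zero> \<Longrightarrow> m \<in> E\<rbrakk> \<Longrightarrow> P f"
    if "finite F" for F f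
    using that
  proof (induction F arbitrary: f rule: finite_induct)
    case empty
    then have "f = (\<lambda>_. \<zero>)" by auto
    then show ?case using zero by simp
  next
    case (insert e F)
    show ?case
    proof (cases "f e = \<zero>")
      case True
      then show ?thesis by (intro insert.IH) (use insert.prems in auto)
    next
      case False
      have "P (f(e := \<zero>))"
        by (rule insert.IH) (use insert.prems S(2) in \<open>auto split: if_splits\<close>)
      moreover have "P (pmonom G (f e) e)" using insert.prems False by (intro mono) auto
      ultimately have "P (\<lambda>m. (f(e := \<zero>)) m \<oplus> pmonom G (f e) e m)" by (rule add)
      also have "(\<lambda>m. (f(e := \<zero>)) m \<oplus> pmonom G (f e) e m) = f"
      proof
        fix m
        have "f m \<in> carrier G" using insert.prems S by blast
        then show "(f(e := \<zero>)) m \<oplus> pmonom G (f e) e m = f m" by (auto simp: pmonom_def)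
      qed
      finally show ?thesis .
    qed
  qed
  from this[OF fin order_refl f] show ?thesis by simp
qed

text \<open>
  The inductively generated set of polynomials in closed form. The coefficients may come from any
  additive submonoid, since the extension of the discriminant ideal is formed with coefficients
  in an ideal.
\<close>
lemma (in ring) indexed_pset_eq:
  fixes I :: "'c set"
  assumes S: "S \<subseteq> carrier R" "\<zero> \<in> S" "\<And>a b. a \<in> S \<Longrightarrow> b \<in> S \<Longrightarrow> a \<oplus> b \<in> S"
  shows "indexed_pset I S =
    {f. (\<forall>m. f m \<in> S) \<and> finite {m. f m \<noteq> \<zero>} \<and> (\<forall>m. f m \<noteq> \<zero> \<longrightarrow> set_mset m \<subseteq> I)}" (is "_ = ?X")
proof (intro equalityI subsetI)
  fix f assume "f \<in> indexed_pset I S"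
  then show "f \<in> ?X"
  proof induction
    case (indexed_const k)
    have "{m. indexed_const k m \<noteq> \<zero>} \<subseteq> {{#}}" by (auto simp: indexed_const_def)
    then have "finite {m. indexed_const k m \<noteq> \<zero>}" by (rule finite_subset) simp
    then show ?case using S indexed_const by (auto simp: indexed_const_def)
  next
    case (indexed_padd P Q)
    have "{m. indexed_padd P Q m \<noteq> \<zero>} \<subseteq> {m. P m \<noteq> \<zero>} \<union> {m. Q m \<noteq> \<zero>}"
      by (auto simp: indexed_padd_def)
    then have "finite {m. indexed_padd P Q m \<noteq> \<zero>}"
      by (rule finite_subset) (use indexed_padd in auto)
    moreover have "set_mset m \<subseteq> I" if "P m \<oplus> Q m \<noteq> \<zero>" for m
    proof -
      have "P m \<noteq> \<zero> \<or> Q m \<noteq> \<zero>" using that by auto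
      then show ?thesis using indexed_padd.IH by blast
    qed
    ultimately show ?case using S(3) indexed_padd.IH by (auto simp: indexed_padd_def)
  next
    case (indexed_pmult P i)
    have "{m. indexed_pmult P i m \<noteq> \<zero>} \<subseteq> add_mset i ` {m. P m \<noteq> \<zero>}"
    proof
      fix m assume "m \<in> {m. indexed_pmult P i m \<noteq> \<zero>}"
      then have "i \<in># m" "P (m - {#i#}) \<noteq> \<zero>" by (auto simp: indexed_pmult_def split: if_splits)
      then have "m = add_mset i (m - {#i#})" by simp
      then show "m \<in> add_mset i ` {m. P m \<noteq> \<zero>}" using \<open>P (m - {#i#}) \<noteq> \<zero>\<close> by blast
    qed
    then have "finite {m. indexed_pmult P i m \<noteq> \<zero>}"
      by (rule finite_subset) (use indexed_pmult in auto)
    moreover have "set_mset m \<subseteq> I" if "indexed_pmult P i m \<noteq> \<zero>" for m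
    proof -
      have m: "i \<in># m" "P (m - {#i#}) \<noteq> \<zero>" using that by (auto simp: indexed_pmult_def split: if_splits)
      then have "set_mset (m - {#i#}) \<subseteq> I" using indexed_pmult.IH by blast
      moreover have "m = add_mset i (m - {#i#})" using m(1) by simp
      ultimately show ?thesis using indexed_pmult.hyps(2)
        by (metis insert_subset set_mset_add_mset_insert)
    qed
    moreover have "indexed_pmult P i m \<in> S" for m
      using indexed_pmult.IH S(2) by (auto simp: indexed_pmult_def)
    ultimately show ?case by blast
  qed
next
  fix f assume f: "f \<in> ?X"
  have mono: "pmonom R a e \<in> indexed_pset I S" if "a \<in> S" "set_mset e \<subseteq> I" for a e
    using that(2)
  proof (induction e)
    case empty
    have "pmonom R a ({#} :: 'c multiset) = indexed_const a" by (auto simp: pmonom_def indexed_const_def)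
    then show ?case using indexed_pset.indexed_const[OF \<open>a \<in> S\<close>] by simp
  next
    case (add i e)
    have "pmonom R a (add_mset i e) = indexed_pmult (pmonom R a e) i"
      by (auto simp: pmonom_def indexed_pmult_def fun_eq_iff)
    then show ?case using indexed_pset.indexed_pmult[of "pmonom R a e" I S i] add by simp
  qed
  show "f \<in> indexed_pset I S"
  proof (rule finite_support_induct[of f S "{m. set_mset m \<subseteq> I}"])
    have "indexed_const \<zero> \<in> indexed_pset I S" using S(2) by (rule indexed_pset.indexed_const)
    then show "(\<lambda>_. \<zero>) \<in> indexed_pset I S" by (simp add: indexed_zero_def)
    show "(\<lambda>m. g m \<oplus> h m) \<in> indexed_pset I S"
      if "g \<in> indexed_pset I S" "h \<in> indexed_pset I S" for g h
      using indexed_pset.indexed_padd[OF that] by (simp add: indexed_padd_def)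
  qed (use f S mono in auto)
qed

section \<open>Convolution of a biadditive operation\<close>

text \<open>
  Both the product and the bracket of a polynomial extension are of this form, so that their
  common properties are proved once for an arbitrary biadditive operation.
\<close>
definition pconv :: "('a, 'z) ring_scheme \<Rightarrow> ('a \<Rightarrow> 'a \<Rightarrow> 'a) \<Rightarrow>
    ('c multiset \<Rightarrow> 'a) \<Rightarrow> ('c multiset \<Rightarrow> 'a) \<Rightarrow> 'c multiset \<Rightarrow> 'a"
  where "pconv A opr f g = (\<lambda>m. \<Oplus>\<^bsub>A\<^esub>l\<in>{l. l \<subseteq># m}. opr (f l) (g (m - l)))"

locale biadditive = abelian_group A for A (structure) +
  fixes opr :: "'a \<Rightarrow> 'a \<Rightarrow> 'a"
  assumes opr_closed [simp, intro]: "a \<in> carrier A \<Longrightarrow> b \<in> carrier A \<Longrightarrow> opr a b \<in> carrier A"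
    and opr_add_left: "\<lbrakk>a \<in> carrier A; b \<in> carrier A; c \<in> carrier A\<rbrakk> \<Longrightarrow> opr (a \<oplus> b) c = opr a c \<oplus> opr b c"
    and opr_add_right: "\<lbrakk>a \<in> carrier A; b \<in> carrier A; c \<in> carrier A\<rbrakk> \<Longrightarrow> opr a (b \<oplus> c) = opr a b \<oplus> opr a c"
begin

lemma opr_zero_left [simp]: "a \<in> carrier A \<Longrightarrow> opr \<zero> a = \<zero>"
  using opr_add_left[of \<zero> \<zero> a] by (metis add.l_cancel_one' l_zero opr_closed zero_closed)

lemma opr_zero_right [simp]: "a \<in> carrier A \<Longrightarrow> opr a \<zero> = \<zero>"
  using opr_add_right[of a \<zero> \<zero>] by (metis add.l_cancel_one' l_zero opr_closed zero_closed)

lemma pconv_closed [intro]: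
  assumes "\<And>m. f m \<in> carrier A" "\<And>m. g m \<in> carrier A"
  shows "pconv A opr f g m \<in> carrier A"
  unfolding pconv_def using assms by (intro finsum_closed) auto

lemma pconv_add_left:
  assumes "\<And>m. f m \<in> carrier A" "\<And>m. g m \<in> carrier A" "\<And>m. h m \<in> carrier A"
  shows "pconv A opr (\<lambda>m. f m \<oplus> g m) h = (\<lambda>m. pconv A opr f h m \<oplus> pconv A opr g h m)"
proof
  fix m
  show "pconv A opr (\<lambda>m. f m \<oplus> g m) h m = pconv A opr f h m \<oplus> pconv A opr g h m"
    unfolding pconv_def using assms by (subst finsum_addf[symmetric]) (auto simp: opr_add_left)
qed

lemma pconv_add_right:
  assumes "\<And>m. f m \<in> carrier A" "\<And>m. g m \<in> carrier A" "\<And>m. h m \<in> carrier A"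
  shows "pconv A opr h (\<lambda>m. f m \<oplus> g m) = (\<lambda>m. pconv A opr h f m \<oplus> pconv A opr h g m)"
proof
  fix m
  show "pconv A opr h (\<lambda>m. f m \<oplus> g m) m = pconv A opr h f m \<oplus> pconv A opr h g m"
    unfolding pconv_def using assms by (subst finsum_addf[symmetric]) (auto simp: opr_add_right)
qed

lemma finite_submultisets [simp]: "finite {l. l \<subseteq># (m :: 'c multiset)}"
proof (induction m)
  case (add x m)
  have "{l. l \<subseteq># add_mset x m} \<subseteq> {l. l \<subseteq># m} \<union> add_mset x ` {l. l \<subseteq># m}"
  proof
    fix l assume l: "l \<in> {l. l \<subseteq># add_mset x m}"
    show "l \<in> {l. l \<subseteq># m} \<union> add_mset x ` {l. l \<subseteq># m}"
    proof (cases "x \<in># l")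
      case True
      then obtain l' where "l = add_mset x l'" by (metis insert_DiffM)
      then show ?thesis using l by auto
    next
      case False
      then show ?thesis using l
        by (metis UnI1 add_mset_remove_trivial diff_single_trivial mem_Collect_eq subset_eq_diff_conv
            union_mset_add_mset_right add.right_neutral)
    qed
  qed
  then show ?case by (rule finite_subset) (use add in auto)
qed simp

lemma pconv_monom:
  assumes "a \<in> carrier A" "b \<in> carrier A"
  shows "pconv A opr (pmonom A a e) (pmonom A b e') = pmonom A (opr a b) (e + e')"
proof
  fix m
  show "pconv A opr (pmonom A a e) (pmonom A b e') m = pmonom A (opr a b) (e + e') m"
  proof (cases "m = e + e'")
    case True
    have "pconv A opr (pmonom A a e) (pmonom A b e') m
      = (\<Oplus>l\<in>{l. l \<subseteq># m}. if e = l then opr a b else \<zero>)"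
      unfolding pconv_def
      by (rule add.finprod_cong') (use assms True in \<open>auto simp: pmonom_def\<close>)
    also have "\<dots> = opr a b"
      using add.finprod_singleton[of e "{l. l \<subseteq># m}" "\<lambda>_. opr a b"] True assms by auto
    finally show ?thesis using True by (simp add: pmonom_def)
  next
    case False
    have "pconv A opr (pmonom A a e) (pmonom A b e') m = (\<Oplus>l\<in>{l. l \<subseteq># m}. \<zero>)"
      unfolding pconv_def
    proof (rule add.finprod_cong')
      fix l assume "l \<in> {l. l \<subseteq># m}"
      then have "l \<noteq> e \<or> m - l \<noteq> e'" using False by auto
      then show "opr (pmonom A a e l) (pmonom A b e' (m - l)) = \<zero>"
        using assms by (auto simp: pmonom_def)
    qed auto
    then show ?thesis using False by (simp add: pmonom_def)
  qed
qed

lemma pconv_support: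
  assumes "\<And>m. f m \<in> carrier A" "\<And>m. g m \<in> carrier A" "pconv A opr f g m \<noteq> \<zero>"
  shows "\<exists>l l'. m = l + l' \<and> f l \<noteq> \<zero> \<and> g l' \<noteq> \<zero>"
proof (rule ccontr)
  assume neg: "\<not> ?thesis"
  have "pconv A opr f g m = (\<Oplus>l\<in>{l. l \<subseteq># m}. \<zero>)"
    unfolding pconv_def
  proof (rule add.finprod_cong')
    fix l assume "l \<in> {l. l \<subseteq># m}"
    then have "m = l + (m - l)" by simp
    then have "f l = \<zero> \<or> g (m - l) = \<zero>" using neg by blast
    then show "opr (f l) (g (m - l)) = \<zero>" using assms(1,2) by auto
  qed auto
  then show False using assms(3) by simp
qed

lemma finite_pconv_support:
  assumes "\<And>m. f m \<in> carrier A" "\<And>m. g m \<in> carrier A" "finite {m. f m \<noteq> \<zero>}" "finite {m. g m \<noteq> \<zero>}"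
  shows "finite {m. pconv A opr f g m \<noteq> \<zero>}"
proof (rule finite_subset)
  show "{m. pconv A opr f g m \<noteq> \<zero>} \<subseteq> (\<lambda>(l, l'). l + l') ` ({m. f m \<noteq> \<zero>} \<times> {m. g m \<noteq> \<zero>})"
    using pconv_support[OF assms(1,2)] by force
qed (use assms in auto)

end

section \<open>Polynomial extensions of Poisson algebras\<close>

sublocale poisson_algebra \<subseteq> mul: biadditive A "monoid.mult A"
  by unfold_locales (auto simp: l_distr r_distr)

sublocale poisson_algebra \<subseteq> brk: biadditive A "pbracket A"
  by unfold_locales (auto simp: bracket_closed bracket_add_left bracket_add_right)

context poisson_algebra begin

lemma bracket_swap:
  assumes "a \<in> carrier A" "b \<in> carrier A"
  shows "\<lbrace>a, b\<rbrace>\<^bsub>A\<^esub> = \<ominus>\<^bsub>A\<^esub> \<lbrace>b, a\<rbrace>\<^bsub>A\<^esub>"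
proof -
  have "\<lbrace>a \<oplus>\<^bsub>A\<^esub> b, a \<oplus>\<^bsub>A\<^esub> b\<rbrace>\<^bsub>A\<^esub> = \<zero>\<^bsub>A\<^esub>" using assms by (simp add: bracket_self)
  then have "\<lbrace>a, b\<rbrace>\<^bsub>A\<^esub> \<oplus>\<^bsub>A\<^esub> \<lbrace>b, a\<rbrace>\<^bsub>A\<^esub> = \<zero>\<^bsub>A\<^esub>"
    using assms bracket_self[of a] bracket_self[of b]
    by (simp add: bracket_add_left bracket_add_right bracket_closed a_comm)
  then show ?thesis using assms by (simp add: bracket_closed minus_equality)
qed

lemma carrier_poly_ext:
  "carrier (poly_ext A n) = {f. (\<forall>m. f m \<in> carrier A) \<and> finite {m. f m \<noteq> \<zero>\<^bsub>A\<^esub>} \<and>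
    (\<forall>m. f m \<noteq> \<zero>\<^bsub>A\<^esub> \<longrightarrow> set_mset m \<subseteq> {..<n})}"
  unfolding poly_ext_def by (simp add: indexed_pset_eq)

lemma poly_ext_simps [simp]:
  "\<zero>\<^bsub>poly_ext A n\<^esub> = (\<lambda>_. \<zero>\<^bsub>A\<^esub>)"
  "\<one>\<^bsub>poly_ext A n\<^esub> = pmonom A \<one>\<^bsub>A\<^esub> {#}"
  "f \<oplus>\<^bsub>poly_ext A n\<^esub> g = (\<lambda>m. f m \<oplus>\<^bsub>A\<^esub> g m)"
  "f \<otimes>\<^bsub>poly_ext A n\<^esub> g = pconv A (monoid.mult A) f g"
  "k \<odot>\<^bsub>poly_ext A n\<^esub> f = (\<lambda>m. k \<odot>\<^bsub>A\<^esub> f m)"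
  "\<lbrace>f, g\<rbrace>\<^bsub>poly_ext A n\<^esub> = pconv A (pbracket A) f g"
  by (simp_all add: poly_ext_def indexed_const_def indexed_padd_def pconv_def pmonom_def)

lemma poly_coeff_closed: "f \<in> carrier (poly_ext A n) \<Longrightarrow> f m \<in> carrier A"
  by (simp add: carrier_poly_ext)

lemma poly_finite_support: "f \<in> carrier (poly_ext A n) \<Longrightarrow> finite {m. f m \<noteq> \<zero>\<^bsub>A\<^esub>}"
  by (simp add: carrier_poly_ext)

lemma poly_support: "f \<in> carrier (poly_ext A n) \<Longrightarrow> f m \<noteq> \<zero>\<^bsub>A\<^esub> \<Longrightarrow> set_mset m \<subseteq> {..<n}"
  by (simp add: carrier_poly_ext)

lemma pmonom_in_poly [simp, intro]:
  assumes "a \<in> carrier A" "set_mset e \<subseteq> {..<n}"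
  shows "pmonom A a e \<in> carrier (poly_ext A n)"
proof -
  have "finite {m. pmonom A a e m \<noteq> \<zero>\<^bsub>A\<^esub>}"
    by (rule finite_subset[of _ "{e}"]) (auto simp: pmonom_def)
  then show ?thesis using assms by (auto simp: carrier_poly_ext pmonom_def)
qed

lemma zero_in_poly [simp, intro]: "(\<lambda>_. \<zero>\<^bsub>A\<^esub>) \<in> carrier (poly_ext A n)"
  by (simp add: carrier_poly_ext)

lemma add_in_poly [simp, intro]:
  assumes "f \<in> carrier (poly_ext A n)" "g \<in> carrier (poly_ext A n)"
  shows "(\<lambda>m. f m \<oplus>\<^bsub>A\<^esub> g m) \<in> carrier (poly_ext A n)"
proof -
  have sub: "f m \<noteq> \<zero>\<^bsub>A\<^esub> \<or> g m \<noteq> \<zero>\<^bsub>A\<^esub>" if "f m \<oplus>\<^bsub>A\<^esub> g m \<noteq> \<zero>\<^bsub>A\<^esub>" for m using that by auto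
  have "finite {m. f m \<oplus>\<^bsub>A\<^esub> g m \<noteq> \<zero>\<^bsub>A\<^esub>}"
    by (rule finite_subset[of _ "{m. f m \<noteq> \<zero>\<^bsub>A\<^esub>} \<union> {m. g m \<noteq> \<zero>\<^bsub>A\<^esub>}"])
      (use sub assms in \<open>auto simp: poly_finite_support\<close>)
  moreover have "set_mset m \<subseteq> {..<n}" if "f m \<oplus>\<^bsub>A\<^esub> g m \<noteq> \<zero>\<^bsub>A\<^esub>" for m
    using sub[OF that] poly_support[OF assms(1)] poly_support[OF assms(2)] by blast
  ultimately show ?thesis using assms by (simp add: carrier_poly_ext)
qed

lemma smult_in_poly [simp, intro]:
  assumes "k \<in> carrier K" "f \<in> carrier (poly_ext A n)"
  shows "(\<lambda>m. k \<odot>\<^bsub>A\<^esub> f m) \<in> carrier (poly_ext A n)"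
proof -
  have sub: "f m \<noteq> \<zero>\<^bsub>A\<^esub>" if "k \<odot>\<^bsub>A\<^esub> f m \<noteq> \<zero>\<^bsub>A\<^esub>" for m using that poly_coeff_closed[OF assms(2)] assms by auto
  have "finite {m. k \<odot>\<^bsub>A\<^esub> f m \<noteq> \<zero>\<^bsub>A\<^esub>}"
    by (rule finite_subset[OF _ poly_finite_support[OF assms(2)]]) (use sub in auto)
  then show ?thesis using assms sub poly_support[OF assms(2)] by (simp add: carrier_poly_ext)
qed

lemma uminus_in_poly [simp, intro]:
  assumes "f \<in> carrier (poly_ext A n)"
  shows "(\<lambda>m. \<ominus>\<^bsub>A\<^esub> f m) \<in> carrier (poly_ext A n)"
proof -
  have sub: "f m \<noteq> \<zero>\<^bsub>A\<^esub>" if "\<ominus>\<^bsub>A\<^esub> f m \<noteq> \<zero>\<^bsub>A\<^esub>" for m using that poly_coeff_closed[OF assms] assms by auto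
  have "finite {m. \<ominus>\<^bsub>A\<^esub> f m \<noteq> \<zero>\<^bsub>A\<^esub>}"
    by (rule finite_subset[OF _ poly_finite_support[OF assms]]) (use sub in auto)
  then show ?thesis using assms sub poly_support[OF assms] by (simp add: carrier_poly_ext)
qed

lemma pconv_in_poly:
  assumes "biadditive A opr" "f \<in> carrier (poly_ext A n)" "g \<in> carrier (poly_ext A n)"
  shows "pconv A opr f g \<in> carrier (poly_ext A n)"
proof -
  interpret biadditive A opr by fact
  have "set_mset m \<subseteq> {..<n}" if m: "pconv A opr f g m \<noteq> \<zero>\<^bsub>A\<^esub>" for m
  proof -
    obtain l l' where "m = l + l'" "f l \<noteq> \<zero>\<^bsub>A\<^esub>" "g l' \<noteq> \<zero>\<^bsub>A\<^esub>"
      using pconv_support[of f g m] m poly_coeff_closed[OF assms(2)] poly_coeff_closed[OF assms(3)] by blast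
    then show ?thesis using poly_support[OF assms(2)] poly_support[OF assms(3)] by simp
  qed
  moreover have "pconv A opr f g m \<in> carrier A" for m
    using assms by (intro pconv_closed poly_coeff_closed)
  moreover have "finite {m. pconv A opr f g m \<noteq> \<zero>\<^bsub>A\<^esub>}"
    using assms by (intro finite_pconv_support poly_coeff_closed poly_finite_support)
  ultimately show ?thesis by (simp add: carrier_poly_ext)
qed

lemmas mult_in_poly [simp, intro] = pconv_in_poly[OF mul.biadditive_axioms]
lemmas bracket_in_poly [simp, intro] = pconv_in_poly[OF brk.biadditive_axioms]

lemma poly_abelian_group: "abelian_group (poly_ext A n)"
proof (rule abelian_groupI)
  fix f assume f: "f \<in> carrier (poly_ext A n)"
  show "\<exists>g\<in>carrier (poly_ext A n). g \<oplus>\<^bsub>poly_ext A n\<^esub> f = \<zero>\<^bsub>poly_ext A n\<^esub>"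
    using f poly_coeff_closed[OF f] by (intro bexI[of _ "\<lambda>m. \<ominus>\<^bsub>A\<^esub> f m"]) (simp_all add: l_neg)
next
  fix f g h assume "f \<in> carrier (poly_ext A n)" "g \<in> carrier (poly_ext A n)" "h \<in> carrier (poly_ext A n)"
  then have "f m \<in> carrier A" "g m \<in> carrier A" "h m \<in> carrier A" for m
    by (auto intro: poly_coeff_closed)
  then show "(f \<oplus>\<^bsub>poly_ext A n\<^esub> g) \<oplus>\<^bsub>poly_ext A n\<^esub> h = f \<oplus>\<^bsub>poly_ext A n\<^esub> (g \<oplus>\<^bsub>poly_ext A n\<^esub> h)"
    "f \<oplus>\<^bsub>poly_ext A n\<^esub> g = g \<oplus>\<^bsub>poly_ext A n\<^esub> f"
    "\<zero>\<^bsub>poly_ext A n\<^esub> \<oplus>\<^bsub>poly_ext A n\<^esub> f = f"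
    by (simp_all add: a_assoc) (simp add: a_comm)
qed simp_all

lemma poly_induct [consumes 1, case_names zero monom add]:
  assumes "f \<in> carrier (poly_ext A n)"
    and "P (\<lambda>_. \<zero>\<^bsub>A\<^esub>)"
    and "\<And>a e. a \<in> carrier A \<Longrightarrow> set_mset e \<subseteq> {..<n} \<Longrightarrow> P (pmonom A a e)"
    and "\<And>f g. \<lbrakk>f \<in> carrier (poly_ext A n); g \<in> carrier (poly_ext A n); P f; P g\<rbrakk>
      \<Longrightarrow> P (\<lambda>m. f m \<oplus>\<^bsub>A\<^esub> g m)"
  shows "P f"
proof -
  have "f \<in> carrier (poly_ext A n) \<and> P f"
  proof (rule finite_support_induct[of f "carrier A" "{e. set_mset e \<subseteq> {..<n}}"])
    show "finite {m. f m \<noteq> \<zero>\<^bsub>A\<^esub>}" using assms(1) by (rule poly_finite_support)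
    show "f m \<in> carrier A" for m using assms(1) by (rule poly_coeff_closed)
    show "m \<in> {e. set_mset e \<subseteq> {..<n}}" if "f m \<noteq> \<zero>\<^bsub>A\<^esub>" for m
      using poly_support[OF assms(1) that] by blast
  qed (use assms in auto)
  then show ?thesis by simp
qed

text \<open>
  Every polynomial is a sum of monomials, so additive maps that agree on monomials are equal.
  The versions for two and three arguments reduce the laws of a polynomial extension to
  computations with monomials, and no sum over pairs or triples of exponents ever has to be
  rearranged.
\<close>
lemma additive_maps_eqI:
  assumes f: "f \<in> carrier (poly_ext A n)" and G: "abelian_group G"
    and F: "\<And>f. f \<in> carrier (poly_ext A n) \<Longrightarrow> F f \<in> carrier G"
      "\<And>f. f \<in> carrier (poly_ext A n) \<Longrightarrow> F' f \<in> carrier G"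
    and add: "\<And>f g. \<lbrakk>f \<in> carrier (poly_ext A n); g \<in> carrier (poly_ext A n)\<rbrakk>
        \<Longrightarrow> F (\<lambda>m. f m \<oplus>\<^bsub>A\<^esub> g m) = F f \<oplus>\<^bsub>G\<^esub> F g"
      "\<And>f g. \<lbrakk>f \<in> carrier (poly_ext A n); g \<in> carrier (poly_ext A n)\<rbrakk>
        \<Longrightarrow> F' (\<lambda>m. f m \<oplus>\<^bsub>A\<^esub> g m) = F' f \<oplus>\<^bsub>G\<^esub> F' g"
    and mono: "\<And>a e. a \<in> carrier A \<Longrightarrow> set_mset e \<subseteq> {..<n} \<Longrightarrow> F (pmonom A a e) = F' (pmonom A a e)"
  shows "F f = F' f"
  using f
proof (induction rule: poly_induct)
  case zero
  interpret G: abelian_group G by fact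
  let ?z = "\<lambda>_ :: nat multiset. \<zero>\<^bsub>A\<^esub>"
  have "F ?z = \<zero>\<^bsub>G\<^esub>" using add(1)[of ?z ?z] F(1)[of ?z] by simp
  moreover have "F' ?z = \<zero>\<^bsub>G\<^esub>" using add(2)[of ?z ?z] F(2)[of ?z] by simp
  ultimately show ?case by simp
qed (simp_all add: mono add)

lemma biadditive_maps_eqI:
  assumes "f \<in> carrier (poly_ext A n)" "g \<in> carrier (poly_ext A n)" and G: "abelian_group G"
    and "\<And>f g. \<lbrakk>f \<in> carrier (poly_ext A n); g \<in> carrier (poly_ext A n)\<rbrakk> \<Longrightarrow> F f g \<in> carrier G"
      "\<And>f g. \<lbrakk>f \<in> carrier (poly_ext A n); g \<in> carrier (poly_ext A n)\<rbrakk> \<Longrightarrow> F' f g \<in> carrier G"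
    and "\<And>f g h. \<lbrakk>f \<in> carrier (poly_ext A n); g \<in> carrier (poly_ext A n); h \<in> carrier (poly_ext A n)\<rbrakk>
        \<Longrightarrow> F (\<lambda>m. f m \<oplus>\<^bsub>A\<^esub> g m) h = F f h \<oplus>\<^bsub>G\<^esub> F g h"
      "\<And>f g h. \<lbrakk>f \<in> carrier (poly_ext A n); g \<in> carrier (poly_ext A n); h \<in> carrier (poly_ext A n)\<rbrakk>
        \<Longrightarrow> F' (\<lambda>m. f m \<oplus>\<^bsub>A\<^esub> g m) h = F' f h \<oplus>\<^bsub>G\<^esub> F' g h"
      "\<And>f g h. \<lbrakk>f \<in> carrier (poly_ext A n); g \<in> carrier (poly_ext A n); h \<in> carrier (poly_ext A n)\<rbrakk>
        \<Longrightarrow> F h (\<lambda>m. f m \<oplus>\<^bsub>A\<^esub> g m) = F h f \<oplus>\<^bsub>G\<^esub> F h g"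
      "\<And>f g h. \<lbrakk>f \<in> carrier (poly_ext A n); g \<in> carrier (poly_ext A n); h \<in> carrier (poly_ext A n)\<rbrakk>
        \<Longrightarrow> F' h (\<lambda>m. f m \<oplus>\<^bsub>A\<^esub> g m) = F' h f \<oplus>\<^bsub>G\<^esub> F' h g"
    and "\<And>a e b e'. \<lbrakk>a \<in> carrier A; b \<in> carrier A; set_mset e \<subseteq> {..<n}; set_mset e' \<subseteq> {..<n}\<rbrakk>
        \<Longrightarrow> F (pmonom A a e) (pmonom A b e') = F' (pmonom A a e) (pmonom A b e')"
  shows "F f g = F' f g"
proof (rule additive_maps_eqI[OF assms(1) G, where F = "\<lambda>f. F f g" and F' = "\<lambda>f. F' f g"])
  fix a e assume "a \<in> carrier A" "set_mset e \<subseteq> {..<n}"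
  then show "F (pmonom A a e) g = F' (pmonom A a e) g"
    by (intro additive_maps_eqI[OF assms(2) G, where F = "F (pmonom A a e)" and F' = "F' (pmonom A a e)"])
      (use assms in auto)
qed (use assms in auto)

lemma triadditive_maps_eqI:
  assumes fgh: "f \<in> carrier (poly_ext A n)" "g \<in> carrier (poly_ext A n)" "h \<in> carrier (poly_ext A n)"
    and G: "abelian_group G"
    and closed: "\<And>f g h. \<lbrakk>f \<in> carrier (poly_ext A n); g \<in> carrier (poly_ext A n); h \<in> carrier (poly_ext A n)\<rbrakk>
        \<Longrightarrow> F f g h \<in> carrier G"
      "\<And>f g h. \<lbrakk>f \<in> carrier (poly_ext A n); g \<in> carrier (poly_ext A n); h \<in> carrier (poly_ext A n)\<rbrakk>
        \<Longrightarrow> F' f g h \<in> carrier G"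
    and add: "\<And>f g h k. \<lbrakk>f \<in> carrier (poly_ext A n); g \<in> carrier (poly_ext A n); h \<in> carrier (poly_ext A n);
          k \<in> carrier (poly_ext A n)\<rbrakk> \<Longrightarrow>
        F (\<lambda>m. f m \<oplus>\<^bsub>A\<^esub> g m) h k = F f h k \<oplus>\<^bsub>G\<^esub> F g h k \<and>
        F h (\<lambda>m. f m \<oplus>\<^bsub>A\<^esub> g m) k = F h f k \<oplus>\<^bsub>G\<^esub> F h g k \<and>
        F h k (\<lambda>m. f m \<oplus>\<^bsub>A\<^esub> g m) = F h k f \<oplus>\<^bsub>G\<^esub> F h k g"
      "\<And>f g h k. \<lbrakk>f \<in> carrier (poly_ext A n); g \<in> carrier (poly_ext A n); h \<in> carrier (poly_ext A n);
          k \<in> carrier (poly_ext A n)\<rbrakk> \<Longrightarrow>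
        F' (\<lambda>m. f m \<oplus>\<^bsub>A\<^esub> g m) h k = F' f h k \<oplus>\<^bsub>G\<^esub> F' g h k \<and>
        F' h (\<lambda>m. f m \<oplus>\<^bsub>A\<^esub> g m) k = F' h f k \<oplus>\<^bsub>G\<^esub> F' h g k \<and>
        F' h k (\<lambda>m. f m \<oplus>\<^bsub>A\<^esub> g m) = F' h k f \<oplus>\<^bsub>G\<^esub> F' h k g"
    and mono: "\<And>a e b e' c e''. \<lbrakk>a \<in> carrier A; b \<in> carrier A; c \<in> carrier A;
          set_mset e \<subseteq> {..<n}; set_mset e' \<subseteq> {..<n}; set_mset e'' \<subseteq> {..<n}\<rbrakk>
        \<Longrightarrow> F (pmonom A a e) (pmonom A b e') (pmonom A c e'') = F' (pmonom A a e) (pmonom A b e') (pmonom A c e'')"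
  shows "F f g h = F' f g h"
proof (rule additive_maps_eqI[OF fgh(1) G, where F = "\<lambda>f. F f g h" and F' = "\<lambda>f. F' f g h"])
  fix a e assume ae: "a \<in> carrier A" "set_mset e \<subseteq> {..<n}"
  show "F (pmonom A a e) g h = F' (pmonom A a e) g h"
    by (rule biadditive_maps_eqI[OF fgh(2,3) G, where F = "F (pmonom A a e)" and F' = "F' (pmonom A a e)"])
      (use ae closed add mono in auto)
qed (use fgh closed add in auto)

text \<open>
  All laws are multiadditive, hence can be checked on monomials, where they are laws of \<open>A\<close>. Only
  \<open>\<lbrace>f, f\<rbrace> = 0\<close> is quadratic; it follows from antisymmetry by induction on \<open>f\<close>.
\<close>
theorem poly_ext_poisson: "poisson_algebra K (poly_ext A n)"
proof -
  let ?P = "poly_ext A n"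
  interpret P: abelian_group ?P by (rule poly_abelian_group)
  let ?m = "pconv A (monoid.mult A)" and ?b = "pconv A (pbracket A)"
  note mono_simps = mul.pconv_monom brk.pconv_monom
  have add_simps:
    "?m (\<lambda>m. f m \<oplus>\<^bsub>A\<^esub> g m) h = (\<lambda>m. ?m f h m \<oplus>\<^bsub>A\<^esub> ?m g h m)"
    "?m h (\<lambda>m. f m \<oplus>\<^bsub>A\<^esub> g m) = (\<lambda>m. ?m h f m \<oplus>\<^bsub>A\<^esub> ?m h g m)"
    "?b (\<lambda>m. f m \<oplus>\<^bsub>A\<^esub> g m) h = (\<lambda>m. ?b f h m \<oplus>\<^bsub>A\<^esub> ?b g h m)"
    "?b h (\<lambda>m. f m \<oplus>\<^bsub>A\<^esub> g m) = (\<lambda>m. ?b h f m \<oplus>\<^bsub>A\<^esub> ?b h g m)"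
    if "f \<in> carrier ?P" "g \<in> carrier ?P" "h \<in> carrier ?P" for f g h
    using that by (auto intro!: mul.pconv_add_left mul.pconv_add_right brk.pconv_add_left
      brk.pconv_add_right poly_coeff_closed)
  have closed: "?m f g m \<in> carrier A" "?b f g m \<in> carrier A"
    if "f \<in> carrier ?P" "g \<in> carrier ?P" for f g m
    using that by (auto intro!: mul.pconv_closed brk.pconv_closed poly_coeff_closed)
  have pmonom_add: "(\<lambda>m. pmonom A a e m \<oplus>\<^bsub>A\<^esub> pmonom A b e m) = pmonom A (a \<oplus>\<^bsub>A\<^esub> b) e"
    if "a \<in> carrier A" "b \<in> carrier A" for a b and e :: "nat multiset"
    using that by (auto simp: pmonom_def)
  have assoc: "?m (?m f g) h = ?m f (?m g h)"
    if "f \<in> carrier ?P" "g \<in> carrier ?P" "h \<in> carrier ?P" for f g h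
    by (rule triadditive_maps_eqI[OF that P.abelian_group_axioms,
          where F = "\<lambda>f g h. ?m (?m f g) h" and F' = "\<lambda>f g h. ?m f (?m g h)"])
      (simp_all add: add_simps mono_simps closed m_assoc ac_simps)
  have comm: "?m f g = ?m g f"
    if "f \<in> carrier ?P" "g \<in> carrier ?P" for f g
    by (rule biadditive_maps_eqI[OF that P.abelian_group_axioms,
          where F = "\<lambda>f g. ?m f g" and F' = "\<lambda>f g. ?m g f"])
      (simp_all add: add_simps mono_simps closed m_comm add.commute)
  have one: "?m (pmonom A \<one>\<^bsub>A\<^esub> {#}) f = f" if "f \<in> carrier ?P" for f
    by (rule additive_maps_eqI[OF that P.abelian_group_axioms,
          where F = "?m (pmonom A \<one>\<^bsub>A\<^esub> {#})" and F' = "\<lambda>f. f"])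
      (simp_all add: add_simps mono_simps closed)
  have anti: "(\<lambda>m. ?b f g m \<oplus>\<^bsub>A\<^esub> ?b g f m) = (\<lambda>_. \<zero>\<^bsub>A\<^esub>)"
    if "f \<in> carrier ?P" "g \<in> carrier ?P" for f g
  proof (rule biadditive_maps_eqI[OF that P.abelian_group_axioms,
          where F = "\<lambda>f g m. ?b f g m \<oplus>\<^bsub>A\<^esub> ?b g f m" and F' = "\<lambda>f g. (\<lambda>_. \<zero>\<^bsub>A\<^esub>)"])
    fix a e b and e' :: "nat multiset"
    assume ab: "a \<in> carrier A" "b \<in> carrier A" "set_mset e \<subseteq> {..<n}" "set_mset e' \<subseteq> {..<n}"
    then have "\<lbrace>a, b\<rbrace>\<^bsub>A\<^esub> \<oplus>\<^bsub>A\<^esub> \<lbrace>b, a\<rbrace>\<^bsub>A\<^esub> = \<zero>\<^bsub>A\<^esub>"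
      using bracket_swap[of a b] bracket_closed[of b a] by (simp add: l_neg)
    then show "(\<lambda>m. ?b (pmonom A a e) (pmonom A b e') m \<oplus>\<^bsub>A\<^esub> ?b (pmonom A b e') (pmonom A a e) m)
        = (\<lambda>_. \<zero>\<^bsub>A\<^esub>)"
      using ab by (simp add: mono_simps add.commute[of e' e] pmonom_add) (simp add: pmonom_def)
  qed (simp_all add: add_simps closed a_ac)
  have self: "?b f f = (\<lambda>_. \<zero>\<^bsub>A\<^esub>)" if "f \<in> carrier ?P" for f
    using that
  proof (induction rule: poly_induct)
    case zero
    show ?case by (simp add: pconv_def)
  next
    case (monom a e)
    then show ?case by (simp add: mono_simps bracket_self) (simp add: pmonom_def)
  next
    case (add f g)
    then show ?case using fun_cong[OF anti[of f g]] by (simp add: add_simps closed a_ac)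
  qed
  have jacobi: "(\<lambda>m. ?b f (?b g h) m \<oplus>\<^bsub>A\<^esub> ?b g (?b h f) m \<oplus>\<^bsub>A\<^esub> ?b h (?b f g) m) = (\<lambda>_. \<zero>\<^bsub>A\<^esub>)"
    if "f \<in> carrier ?P" "g \<in> carrier ?P" "h \<in> carrier ?P" for f g h
  proof (rule triadditive_maps_eqI[OF that P.abelian_group_axioms,
        where F = "\<lambda>f g h m. ?b f (?b g h) m \<oplus>\<^bsub>A\<^esub> ?b g (?b h f) m \<oplus>\<^bsub>A\<^esub> ?b h (?b f g) m"
          and F' = "\<lambda>f g h. (\<lambda>_. \<zero>\<^bsub>A\<^esub>)"])
    fix a e b e' c and e'' :: "nat multiset"
    assume "a \<in> carrier A" "b \<in> carrier A" "c \<in> carrier A"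
      "set_mset e \<subseteq> {..<n}" "set_mset e' \<subseteq> {..<n}" "set_mset e'' \<subseteq> {..<n}"
    moreover have "e' + (e'' + e) = e + (e' + e'')" "e'' + (e + e') = e + (e' + e'')"
      by (simp_all add: ac_simps)
    ultimately show "(\<lambda>m. ?b (pmonom A a e) (?b (pmonom A b e') (pmonom A c e'')) m \<oplus>\<^bsub>A\<^esub>
          ?b (pmonom A b e') (?b (pmonom A c e'') (pmonom A a e)) m \<oplus>\<^bsub>A\<^esub>
          ?b (pmonom A c e'') (?b (pmonom A a e) (pmonom A b e')) m) = (\<lambda>_. \<zero>\<^bsub>A\<^esub>)"
      using bracket_jacobi[of a b c]
      by (simp add: mono_simps bracket_closed) (simp add: pmonom_def fun_eq_iff)
  qed (simp_all add: add_simps closed a_ac)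
  have leibniz: "?b f (?m g h) = (\<lambda>m. ?m (?b f g) h m \<oplus>\<^bsub>A\<^esub> ?m g (?b f h) m)"
    if "f \<in> carrier ?P" "g \<in> carrier ?P" "h \<in> carrier ?P" for f g h
  proof (rule triadditive_maps_eqI[OF that P.abelian_group_axioms,
        where F = "\<lambda>f g h. ?b f (?m g h)" and F' = "\<lambda>f g h m. ?m (?b f g) h m \<oplus>\<^bsub>A\<^esub> ?m g (?b f h) m"])
    fix a e b e' c and e'' :: "nat multiset"
    assume "a \<in> carrier A" "b \<in> carrier A" "c \<in> carrier A"
      "set_mset e \<subseteq> {..<n}" "set_mset e' \<subseteq> {..<n}" "set_mset e'' \<subseteq> {..<n}"
    then show "?b (pmonom A a e) (?m (pmonom A b e') (pmonom A c e'')) =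
        (\<lambda>m. ?m (?b (pmonom A a e) (pmonom A b e')) (pmonom A c e'') m \<oplus>\<^bsub>A\<^esub>
          ?m (pmonom A b e') (?b (pmonom A a e) (pmonom A c e'')) m)"
      using bracket_leibniz[of a b c]
      by (simp add: mono_simps bracket_closed add.assoc add.left_commute[of e' e] pmonom_add)
  qed (simp_all add: add_simps closed a_ac)
  have smult_l: "pconv A opr (\<lambda>m. k \<odot>\<^bsub>A\<^esub> f m) g = (\<lambda>m. k \<odot>\<^bsub>A\<^esub> pconv A opr f g m)"
    if "biadditive A opr" "k \<in> carrier K" "f \<in> carrier ?P" "g \<in> carrier ?P"
      "\<And>a b. a \<in> carrier A \<Longrightarrow> b \<in> carrier A \<Longrightarrow> opr (k \<odot>\<^bsub>A\<^esub> a) b = k \<odot>\<^bsub>A\<^esub> opr a b" for opr k f g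
  proof
    interpret biadditive A opr by fact
    fix m
    show "pconv A opr (\<lambda>m. k \<odot>\<^bsub>A\<^esub> f m) g m = k \<odot>\<^bsub>A\<^esub> pconv A opr f g m"
      unfolding pconv_def using that by (subst finsum_smult_ldistr) (auto intro!: add.finprod_cong' simp: poly_coeff_closed[OF that(3)] poly_coeff_closed[OF that(4)])
  qed
  have smult_r: "pconv A opr f (\<lambda>m. k \<odot>\<^bsub>A\<^esub> g m) = (\<lambda>m. k \<odot>\<^bsub>A\<^esub> pconv A opr f g m)"
    if "biadditive A opr" "k \<in> carrier K" "f \<in> carrier ?P" "g \<in> carrier ?P"
      "\<And>a b. a \<in> carrier A \<Longrightarrow> b \<in> carrier A \<Longrightarrow> opr a (k \<odot>\<^bsub>A\<^esub> b) = k \<odot>\<^bsub>A\<^esub> opr a b" for opr k f g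
  proof
    interpret biadditive A opr by fact
    fix m
    show "pconv A opr f (\<lambda>m. k \<odot>\<^bsub>A\<^esub> g m) m = k \<odot>\<^bsub>A\<^esub> pconv A opr f g m"
      unfolding pconv_def using that by (subst finsum_smult_ldistr) (auto intro!: add.finprod_cong' simp: poly_coeff_closed[OF that(3)] poly_coeff_closed[OF that(4)])
  qed
  have ring: "cring ?P"
  proof (rule cringI)
    show "comm_monoid ?P"
      by (rule comm_monoidI, simp_all add: assoc one mult_in_poly, simp add: comm)
  qed (simp_all add: P.abelian_group_axioms add_simps)
  have coeff: "f m \<in> carrier A" if "f \<in> carrier ?P" for f m
    using that by (rule poly_coeff_closed)
  have "algebra K ?P"
  proof (rule algebraI)
    fix a b f assume "a \<in> carrier K" "b \<in> carrier K" "f \<in> carrier ?P"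
    then show "(a \<oplus>\<^bsub>K\<^esub> b) \<odot>\<^bsub>?P\<^esub> f = a \<odot>\<^bsub>?P\<^esub> f \<oplus>\<^bsub>?P\<^esub> b \<odot>\<^bsub>?P\<^esub> f"
      "(a \<otimes>\<^bsub>K\<^esub> b) \<odot>\<^bsub>?P\<^esub> f = a \<odot>\<^bsub>?P\<^esub> (b \<odot>\<^bsub>?P\<^esub> f)"
      using coeff[of f] by (simp_all add: smult_l_distr smult_assoc1)
  next
    fix a f g assume "a \<in> carrier K" "f \<in> carrier ?P" "g \<in> carrier ?P"
    then show "a \<odot>\<^bsub>?P\<^esub> (f \<oplus>\<^bsub>?P\<^esub> g) = a \<odot>\<^bsub>?P\<^esub> f \<oplus>\<^bsub>?P\<^esub> a \<odot>\<^bsub>?P\<^esub> g"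
      "(a \<odot>\<^bsub>?P\<^esub> f) \<otimes>\<^bsub>?P\<^esub> g = a \<odot>\<^bsub>?P\<^esub> (f \<otimes>\<^bsub>?P\<^esub> g)"
      using coeff[of f] coeff[of g]
      by (simp_all add: smult_r_distr smult_l[OF mul.biadditive_axioms] smult_assoc2)
  next
    fix f assume "f \<in> carrier ?P"
    then show "\<one>\<^bsub>K\<^esub> \<odot>\<^bsub>?P\<^esub> f = f" using coeff[of f] by simp
  qed (simp_all add: R_cring ring)
  then show ?thesis
    by (rule poisson_algebra.intro, unfold_locales)
      (simp_all add: add_simps self jacobi leibniz bracket_smult_left bracket_smult_right
        smult_l[OF brk.biadditive_axioms] smult_r[OF brk.biadditive_axioms])
qed

lemma const_ring_hom: "(\<lambda>a. pmonom A a {#}) \<in> ring_hom A (poly_ext A n)"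
proof (rule ring_hom_memI)
  fix a b assume "a \<in> carrier A" "b \<in> carrier A"
  then show "pmonom A (a \<otimes>\<^bsub>A\<^esub> b) {#} = pmonom A a {#} \<otimes>\<^bsub>poly_ext A n\<^esub> pmonom A b {#}"
    "pmonom A (a \<oplus>\<^bsub>A\<^esub> b) {#} = pmonom A a {#} \<oplus>\<^bsub>poly_ext A n\<^esub> pmonom A b {#}"
    by (simp_all add: mul.pconv_monom) (auto simp: pmonom_def)
qed simp_all

lemma const_smult:
  "k \<in> carrier K \<Longrightarrow> pmonom A (k \<odot>\<^bsub>A\<^esub> a) {#} = k \<odot>\<^bsub>poly_ext A n\<^esub> pmonom A a {#}"
  by (auto simp: pmonom_def)

lemma const_inj: "pmonom A a {#} = pmonom A b {#} \<longleftrightarrow> a = b"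
  by (auto simp: pmonom_def fun_eq_iff)

lemma poly_finsum:
  assumes "finite I" "F \<in> I \<rightarrow> carrier (poly_ext A n)"
  shows "(\<Oplus>\<^bsub>poly_ext A n\<^esub>i\<in>I. F i) = (\<lambda>m. \<Oplus>\<^bsub>A\<^esub>i\<in>I. F i m)"
  using assms
proof (induction I rule: finite_induct)
  interpret P: poisson_algebra K "poly_ext A n" by (rule poly_ext_poisson)
  case empty
  then show ?case by simp
next
  interpret P: poisson_algebra K "poly_ext A n" by (rule poly_ext_poisson)
  case (insert i I)
  then have F: "F i \<in> carrier (poly_ext A n)" "F \<in> I \<rightarrow> carrier (poly_ext A n)" by auto
  have "(\<Oplus>\<^bsub>poly_ext A n\<^esub>i\<in>insert i I. F i) = F i \<oplus>\<^bsub>poly_ext A n\<^esub> (\<Oplus>\<^bsub>poly_ext A n\<^esub>i\<in>I. F i)"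
    by (rule P.M.finsum_insert[OF insert.hyps F(2,1)])
  also have "\<dots> = (\<lambda>m. F i m \<oplus>\<^bsub>A\<^esub> (\<Oplus>\<^bsub>A\<^esub>i\<in>I. F i m))"
    unfolding insert.IH[OF F(2)] by simp
  also have "\<dots> = (\<lambda>m. \<Oplus>\<^bsub>A\<^esub>i\<in>insert i I. F i m)"
  proof
    fix m
    have "(\<lambda>i. F i m) \<in> I \<rightarrow> carrier A" using F(2) by (auto intro: poly_coeff_closed)
    then show "F i m \<oplus>\<^bsub>A\<^esub> (\<Oplus>\<^bsub>A\<^esub>i\<in>I. F i m) = (\<Oplus>\<^bsub>A\<^esub>i\<in>insert i I. F i m)"
      using M.finsum_insert[OF insert.hyps, of "\<lambda>i. F i m"] poly_coeff_closed[OF F(1)] by simp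
  qed
  finally show ?case .
qed

lemma pconv_const_left:
  assumes "biadditive A opr" "a \<in> carrier A" "\<And>m. f m \<in> carrier A"
  shows "pconv A opr (pmonom A a {#}) f m = opr a (f m)"
proof -
  interpret biadditive A opr by fact
  have "pconv A opr (pmonom A a {#}) f m = (\<Oplus>\<^bsub>A\<^esub>l\<in>{l. l \<subseteq># m}. if {#} = l then opr a (f (m - l)) else \<zero>\<^bsub>A\<^esub>)"
    unfolding pconv_def by (rule add.finprod_cong') (use assms in \<open>auto simp: pmonom_def\<close>)
  also have "\<dots> = opr a (f (m - {#}))"
    using add.finprod_singleton[of "{#}" "{l. l \<subseteq># m}" "\<lambda>l. opr a (f (m - l))"] assms by auto
  finally show ?thesis by simp
qed

lemma pconv_const_right:
  assumes "biadditive A opr" "a \<in> carrier A" "\<And>m. f m \<in> carrier A"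
  shows "pconv A opr f (pmonom A a {#}) m = opr (f m) a"
proof -
  interpret biadditive A opr by fact
  have "pconv A opr f (pmonom A a {#}) m = (\<Oplus>\<^bsub>A\<^esub>l\<in>{l. l \<subseteq># m}. if m = l then opr (f l) a else \<zero>\<^bsub>A\<^esub>)"
    unfolding pconv_def
  proof (rule add.finprod_cong')
    fix l assume l: "l \<in> {l. l \<subseteq># m}"
    have "m - l = {#} \<longleftrightarrow> m = l"
      using l by (metis Diff_eq_empty_iff_mset mem_Collect_eq subset_mset.antisym subset_mset.order_refl)
    then show "opr (f l) (pmonom A a {#} (m - l)) = (if m = l then opr (f l) a else \<zero>\<^bsub>A\<^esub>)"
      using assms by (auto simp: pmonom_def)
  qed (use assms in auto)
  also have "\<dots> = opr (f m) a"
    using add.finprod_singleton[of m "{l. l \<subseteq># m}" "\<lambda>l. opr (f l) a"] assms by auto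
  finally show ?thesis by simp
qed

lemma pconv_at_empty:
  assumes "biadditive A opr" "f {#} \<in> carrier A" "g {#} \<in> carrier A"
  shows "pconv A opr f g {#} = opr (f {#}) (g {#})"
proof -
  interpret biadditive A opr by fact
  have "{l :: 'd multiset. l \<subseteq># {#}} = {{#}}" by auto
  then show ?thesis using assms(2,3) by (simp add: pconv_def)
qed

lemma const_term_ring_hom: "(\<lambda>f. f {#}) \<in> ring_hom (poly_ext A n) A"
  by (rule ring_hom_memI)
    (simp_all add: poly_coeff_closed pconv_at_empty[OF mul.biadditive_axioms], simp add: pmonom_def)

end

section \<open>Filtrations whose associated graded ring is a domain\<close>

lemma (in abelian_group) finsum_in_additive_subgroup:
  assumes "additive_subgroup H G" "f \<in> S \<rightarrow> H"
  shows "finsum G f S \<in> H"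
proof -
  interpret additive_subgroup H G by fact
  show ?thesis
    using assms(2)
  proof (induction S rule: infinite_finite_induct)
    case (insert x S)
    then have "f x \<in> carrier G" "f \<in> S \<rightarrow> carrier G" using a_subset by auto
    then show ?case using insert by (auto simp: finsum_insert)
  qed auto
qed

text \<open>
  The common core of the two leading term arguments below: one summand outside of a subgroup cannot
  be cancelled by summands inside it.
\<close>
lemma (in abelian_group) finsum_dominant_term:
  assumes H: "additive_subgroup H G" and S: "finite S" "s \<in> S" "f \<in> S \<rightarrow> carrier G"
    and "\<And>t. t \<in> S \<Longrightarrow> t \<noteq> s \<Longrightarrow> f t \<in> H" "f s \<notin> H"
  shows "finsum G f S \<notin> H"
proof
  interpret additive_subgroup H G by fact
  let ?r = "finsum G f (S - {s})"
  assume sum: "finsum G f S \<in> H"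
  have r: "?r \<in> H" using assms by (intro finsum_in_additive_subgroup) auto
  have s: "f s \<in> carrier G" using S by auto
  have "finsum G f S = finsum G f (insert s (S - {s}))" using S by (simp add: insert_absorb)
  also have "\<dots> = f s \<oplus> ?r" using S s by (intro finsum_insert) auto
  finally have "f s = finsum G f S \<oplus> \<ominus> ?r"
    using s r a_subset by (simp add: a_assoc r_neg subset_iff)
  then show False using sum r \<open>f s \<notin> H\<close> by auto
qed

text \<open>
  Leading terms have nonzero product. This says that the associated graded ring has no zero
  divisors, without mentioning cosets; here \<^const>\<open>filt_below\<close> in degree zero is the zero ideal.
\<close>
definition strict_filtration :: "('a, 'z) ring_scheme \<Rightarrow> (nat \<Rightarrow> 'a set) \<Rightarrow> bool"
  where "strict_filtration C F \<longleftrightarrow> (\<forall>i j. \<forall>a\<in>F i - filt_below C F i. \<forall>b\<in>F j - filt_below C F j.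
    a \<otimes>\<^bsub>C\<^esub> b \<notin> filt_below C F (i + j))"

lemma UP_ops:
  assumes "x \<in> up C" "y \<in> up C"
  shows "x \<oplus>\<^bsub>UP C\<^esub> y = (\<lambda>i. x i \<oplus>\<^bsub>C\<^esub> y i)"
    and "x \<otimes>\<^bsub>UP C\<^esub> y = (\<lambda>i. \<Oplus>\<^bsub>C\<^esub>j\<in>{..i}. x j \<otimes>\<^bsub>C\<^esub> y (i - j))"
  using assms by (simp_all add: UP_def)

lemma UP_zero: "\<zero>\<^bsub>UP C\<^esub> = (\<lambda>i. \<zero>\<^bsub>C\<^esub>)"
  by (simp add: UP_def)

locale filtered_algebra = algebra K C for K (structure) and C (structure) +
  fixes F assumes filt: "filtration K C F"
begin

abbreviation "below \<equiv> filt_below C F"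

lemma F_submodule: "submodule (F i) K C" using filt by (simp add: filtration_def)
lemma F_additive: "additive_subgroup (F i) C"
  using F_submodule[of i] by (simp add: submodule_def additive_subgroup_def)
lemma F_sub: "a \<in> F i \<Longrightarrow> a \<in> carrier C" using filt by (auto simp: filtration_def)
lemma F_zero [simp]: "\<zero>\<^bsub>C\<^esub> \<in> F i" by (rule additive_subgroup.zero_closed[OF F_additive])
lemma F_add: "a \<in> F i \<Longrightarrow> b \<in> F i \<Longrightarrow> a \<oplus>\<^bsub>C\<^esub> b \<in> F i"
  by (rule additive_subgroup.a_closed[OF F_additive])
lemma F_smult: "k \<in> carrier K \<Longrightarrow> a \<in> F i \<Longrightarrow> k \<odot>\<^bsub>C\<^esub> a \<in> F i"
  by (rule submodule.smult_closed[OF F_submodule])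
lemma F_mult: "a \<in> F i \<Longrightarrow> b \<in> F j \<Longrightarrow> a \<otimes>\<^bsub>C\<^esub> b \<in> F (i + j)"
  using filt by (auto simp: filtration_def)
lemma F_mono: "i \<le> j \<Longrightarrow> F i \<subseteq> F j"
  by (rule lift_Suc_mono_le[of F]) (use filt in \<open>simp_all add: filtration_def\<close>)
lemma F_exhaustive: "a \<in> carrier C \<Longrightarrow> \<exists>i. a \<in> F i" using filt by (auto simp: filtration_def)

lemma below_additive: "additive_subgroup (below i) C"
proof (cases i)
  case 0
  have "subgroup {\<one>\<^bsub>add_monoid C\<^esub>} (add_monoid C)"
    by (rule group.triv_subgroup) (rule M.a_group)
  then show ?thesis using 0 by (simp add: filt_below_def additive_subgroup_def)
qed (simp add: filt_below_def F_additive)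

lemma below_zero [simp]: "\<zero>\<^bsub>C\<^esub> \<in> below i" by (rule additive_subgroup.zero_closed[OF below_additive])
lemma below_F: "below i \<subseteq> F i" using F_mono[of "i - 1" i] by (cases i) (auto simp: filt_below_def)
lemma F_below: "i < j \<Longrightarrow> F i \<subseteq> below j"
  using F_mono by (cases j) (auto simp: filt_below_def)

lemma below_mult_left: "a \<in> below i \<Longrightarrow> b \<in> F j \<Longrightarrow> a \<otimes>\<^bsub>C\<^esub> b \<in> below (i + j)"
proof (cases i)
  case 0
  then show "a \<otimes>\<^bsub>C\<^esub> b \<in> below (i + j)" if "a \<in> below i" "b \<in> F j"
    using that F_sub[of b j] below_zero by (simp add: filt_below_def[of C F 0])
next
  case (Suc k)
  then show "a \<otimes>\<^bsub>C\<^esub> b \<in> below (i + j)" if "a \<in> below i" "b \<in> F j"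
    using that F_mult[of a k b j] by (simp add: filt_below_def)
qed

lemma below_mult_right: "a \<in> F i \<Longrightarrow> b \<in> below j \<Longrightarrow> a \<otimes>\<^bsub>C\<^esub> b \<in> below (i + j)"
  using below_mult_left[of b j a i] F_sub below_F by (metis add.commute m_comm subsetD)

lemma below_coset_eq:
  assumes "a \<in> carrier C" "b \<in> carrier C"
  shows "below i +>\<^bsub>C\<^esub> a = below i +>\<^bsub>C\<^esub> b \<longleftrightarrow> a \<ominus>\<^bsub>C\<^esub> b \<in> below i"
proof -
  interpret H: abelian_subgroup "below i" C
    by (rule abelian_subgroupI3[OF below_additive M.abelian_group_axioms])
  have iff: "a \<in> below i +>\<^bsub>C\<^esub> b \<longleftrightarrow> a \<ominus>\<^bsub>C\<^esub> b \<in> below i"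
    unfolding a_minus_def by (rule H.a_rcos_module[OF assms(2,1)])
  show ?thesis
  proof
    assume "below i +>\<^bsub>C\<^esub> a = below i +>\<^bsub>C\<^esub> b"
    then have "a \<in> below i +>\<^bsub>C\<^esub> b" using H.a_rcos_self[OF assms(1)] by (simp only:)
    then show "a \<ominus>\<^bsub>C\<^esub> b \<in> below i" unfolding iff .
  next
    assume "a \<ominus>\<^bsub>C\<^esub> b \<in> below i"
    then have "a \<in> below i +>\<^bsub>C\<^esub> b" unfolding iff .
    then show "below i +>\<^bsub>C\<^esub> a = below i +>\<^bsub>C\<^esub> b"
      by (rule M.a_repr_independence[OF _ assms(2) H.a_subgroup, symmetric])
  qed
qed

lemma below_coset_zero:
  assumes "a \<in> carrier C"
  shows "below i +>\<^bsub>C\<^esub> a = below i \<longleftrightarrow> a \<in> below i"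
proof -
  have "below i +>\<^bsub>C\<^esub> \<zero>\<^bsub>C\<^esub> = below i"
    using additive_subgroup.a_subset[OF below_additive] by (rule M.a_coset_add_zero)
  then show ?thesis using below_coset_eq[OF assms M.zero_closed, of i] assms by (simp add: a_minus_def)
qed

lemma filt_deg_mem: "a \<in> carrier C \<Longrightarrow> a \<in> F (filt_deg F a)"
  unfolding filt_deg_def using F_exhaustive by (metis LeastI_ex)

lemma filt_deg_le_iff: "a \<in> carrier C \<Longrightarrow> filt_deg F a \<le> i \<longleftrightarrow> a \<in> F i"
  using filt_deg_mem F_mono unfolding filt_deg_def by (metis Least_le subsetD)

lemma filt_deg_below: "a \<in> carrier C \<Longrightarrow> a \<noteq> \<zero>\<^bsub>C\<^esub> \<Longrightarrow> a \<notin> below (filt_deg F a)"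
  using filt_deg_le_iff[of a "filt_deg F a - 1"] by (cases "filt_deg F a") (auto simp: filt_below_def)

lemma strict_filtration_integral:
  assumes "strict_filtration C F" "a \<in> carrier C" "b \<in> carrier C" "a \<noteq> \<zero>\<^bsub>C\<^esub>" "b \<noteq> \<zero>\<^bsub>C\<^esub>"
  shows "a \<otimes>\<^bsub>C\<^esub> b \<noteq> \<zero>\<^bsub>C\<^esub>"
  using assms filt_deg_mem filt_deg_below unfolding strict_filtration_def
  by (metis DiffI below_zero)

definition gr_class :: "(nat \<Rightarrow> 'c) \<Rightarrow> nat \<Rightarrow> 'c set"
  where "gr_class x = (\<lambda>i. below i +>\<^bsub>C\<^esub> x i)"

lemma mem_gr_class:
  assumes "x i \<in> F i"
  shows "y \<in> gr_class x i \<longleftrightarrow> y \<in> F i \<and> y \<ominus>\<^bsub>C\<^esub> x i \<in> below i"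
proof -
  interpret H: abelian_subgroup "below i" C
    by (rule abelian_subgroupI3[OF below_additive M.abelian_group_axioms])
  have "y \<in> F i" if y: "y \<in> gr_class x i"
  proof -
    obtain h where "h \<in> below i" "y = h \<oplus>\<^bsub>C\<^esub> x i"
      using y by (auto simp: gr_class_def a_r_coset_def')
    then show ?thesis using F_add[of h i "x i"] assms below_F[of i] by blast
  qed
  moreover have "y \<in> gr_class x i \<longleftrightarrow> y \<ominus>\<^bsub>C\<^esub> x i \<in> below i" if "y \<in> F i"
    unfolding gr_class_def a_minus_def by (rule H.a_rcos_module[OF F_sub[OF assms] F_sub[OF that]])
  ultimately show ?thesis by blast
qed

text \<open>
  Changing a representative by an element of lower degree changes each product by an element of
  lower degree, so the union in the definition of the product consists of a single coset.
\<close>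
lemma gr_mult:
  assumes x: "\<And>i. x i \<in> F i" and y: "\<And>i. y i \<in> F i"
  shows "gr_class x \<otimes>\<^bsub>gr C F\<^esub> gr_class y = gr_class (\<lambda>i. \<Oplus>\<^bsub>C\<^esub>j\<in>{..i}. x j \<otimes>\<^bsub>C\<^esub> y (i - j))"
proof
  fix i :: nat
  let ?c = "\<lambda>x y. \<Oplus>\<^bsub>C\<^esub>j\<in>{..i}. x j \<otimes>\<^bsub>C\<^esub> y (i - j)"
  have "below i +>\<^bsub>C\<^esub> ?c x' y' = below i +>\<^bsub>C\<^esub> ?c x y"
    if x': "\<And>j. x' j \<in> gr_class x j" and y': "\<And>j. y' j \<in> gr_class y j" for x' y'
  proof -
    have x'F: "x' j \<in> F j" "x' j \<ominus>\<^bsub>C\<^esub> x j \<in> below j" for j using x' mem_gr_class x by auto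
    have y'F: "y' j \<in> F j" "y' j \<ominus>\<^bsub>C\<^esub> y j \<in> below j" for j using y' mem_gr_class y by auto
    note carr [simp] = F_sub[OF x] F_sub[OF y] F_sub[OF x'F(1)] F_sub[OF y'F(1)]
    have "x' j \<otimes>\<^bsub>C\<^esub> y' (i - j) \<ominus>\<^bsub>C\<^esub> x j \<otimes>\<^bsub>C\<^esub> y (i - j) \<in> below i" if "j \<le> i" for j
    proof -
      have "x' j \<otimes>\<^bsub>C\<^esub> y' (i - j) \<ominus>\<^bsub>C\<^esub> x j \<otimes>\<^bsub>C\<^esub> y (i - j) =
        (x' j \<ominus>\<^bsub>C\<^esub> x j) \<otimes>\<^bsub>C\<^esub> y' (i - j) \<oplus>\<^bsub>C\<^esub> x j \<otimes>\<^bsub>C\<^esub> (y' (i - j) \<ominus>\<^bsub>C\<^esub> y (i - j))"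
        using carr by algebra
      moreover have "(x' j \<ominus>\<^bsub>C\<^esub> x j) \<otimes>\<^bsub>C\<^esub> y' (i - j) \<in> below (j + (i - j))"
        by (rule below_mult_left[OF x'F(2) y'F(1)])
      moreover have "x j \<otimes>\<^bsub>C\<^esub> (y' (i - j) \<ominus>\<^bsub>C\<^esub> y (i - j)) \<in> below (j + (i - j))"
        by (rule below_mult_right[OF x y'F(2)])
      ultimately show ?thesis using that additive_subgroup.a_closed[OF below_additive] by simp
    qed
    then have "(\<Oplus>\<^bsub>C\<^esub>j\<in>{..i}. x' j \<otimes>\<^bsub>C\<^esub> y' (i - j) \<ominus>\<^bsub>C\<^esub> x j \<otimes>\<^bsub>C\<^esub> y (i - j)) \<in> below i"
      by (intro M.finsum_in_additive_subgroup[OF below_additive]) auto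
    moreover have "?c x' y' \<ominus>\<^bsub>C\<^esub> ?c x y = (\<Oplus>\<^bsub>C\<^esub>j\<in>{..i}. x' j \<otimes>\<^bsub>C\<^esub> y' (i - j) \<ominus>\<^bsub>C\<^esub> x j \<otimes>\<^bsub>C\<^esub> y (i - j))"
      (is "_ = ?d")
    proof -
      have c: "?d \<in> carrier C" "?c x y \<in> carrier C" by (rule M.finsum_closed, simp)+
      have "?d \<oplus>\<^bsub>C\<^esub> ?c x y =
        (\<Oplus>\<^bsub>C\<^esub>j\<in>{..i}. (x' j \<otimes>\<^bsub>C\<^esub> y' (i - j) \<ominus>\<^bsub>C\<^esub> x j \<otimes>\<^bsub>C\<^esub> y (i - j)) \<oplus>\<^bsub>C\<^esub> x j \<otimes>\<^bsub>C\<^esub> y (i - j))"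
        by (rule M.finsum_addf[symmetric]) simp_all
      also have "\<dots> = ?c x' y'"
        by (rule M.finsum_cong') (simp_all add: a_minus_def a_assoc l_neg)
      finally have "?c x' y' = ?d \<oplus>\<^bsub>C\<^esub> ?c x y" by (rule sym)
      moreover have "a \<ominus>\<^bsub>C\<^esub> b = d" if "a = d \<oplus>\<^bsub>C\<^esub> b" "b \<in> carrier C" "d \<in> carrier C" for a b d
        using that by (simp add: a_minus_def a_assoc r_neg)
      ultimately show ?thesis using c by blast
    qed
    ultimately have "?c x' y' \<ominus>\<^bsub>C\<^esub> ?c x y \<in> below i" by (simp only:)
    moreover have "?c x' y' \<in> carrier C" "?c x y \<in> carrier C" by (rule M.finsum_closed, simp)+
    ultimately show ?thesis using below_coset_eq by blast
  qed
  moreover have "x j \<in> gr_class x j" "y j \<in> gr_class y j" for j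
    using x y F_sub[OF x] F_sub[OF y] by (simp_all add: mem_gr_class a_minus_def r_neg)
  ultimately have "{below i +>\<^bsub>C\<^esub> ?c x' y' | x' y'. (\<forall>j. x' j \<in> gr_class x j) \<and> (\<forall>j. y' j \<in> gr_class y j)}
      = {below i +>\<^bsub>C\<^esub> ?c x y}"
    by blast
  then show "(gr_class x \<otimes>\<^bsub>gr C F\<^esub> gr_class y) i = gr_class (\<lambda>i. \<Oplus>\<^bsub>C\<^esub>j\<in>{..i}. x j \<otimes>\<^bsub>C\<^esub> y (i - j)) i"
    by (simp add: gr_def gr_class_def)
qed

lemma convolution_in_filtration:
  assumes "\<And>i. x i \<in> F i" "\<And>i. y i \<in> F i"
  shows "(\<Oplus>\<^bsub>C\<^esub>j\<in>{..i}. x j \<otimes>\<^bsub>C\<^esub> y (i - j)) \<in> F i"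
proof (rule M.finsum_in_additive_subgroup[OF F_additive], rule)
  fix j assume "j \<in> {..i}"
  then show "x j \<otimes>\<^bsub>C\<^esub> y (i - j) \<in> F i" using F_mult[OF assms, of j "i - j"] by simp
qed

lemma gr_carrier_iff:
  "U \<in> carrier (gr C F) \<longleftrightarrow>
    (\<exists>x. U = gr_class x \<and> (\<forall>i. x i \<in> F i) \<and> finite {i. x i \<noteq> \<zero>\<^bsub>C\<^esub>})"
proof
  assume U: "U \<in> carrier (gr C F)"
  then have "\<forall>i. \<exists>x\<in>F i. U i = below i +>\<^bsub>C\<^esub> x" and fin: "finite {i. U i \<noteq> below i}"
    by (auto simp: gr_def)
  then obtain x where x: "\<And>i. x i \<in> F i" "\<And>i. U i = below i +>\<^bsub>C\<^esub> x i" by metis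
  let ?x = "\<lambda>i. if U i = below i then \<zero>\<^bsub>C\<^esub> else x i"
  have "below i +>\<^bsub>C\<^esub> \<zero>\<^bsub>C\<^esub> = below i" for i using below_coset_zero[of "\<zero>\<^bsub>C\<^esub>" i] by simp
  then have "gr_class ?x i = U i" for i using x(2)[of i] by (simp add: gr_class_def)
  then have "U = gr_class ?x" by blast
  moreover have "{i. ?x i \<noteq> \<zero>\<^bsub>C\<^esub>} \<subseteq> {i. U i \<noteq> below i}" by auto
  then have "finite {i. ?x i \<noteq> \<zero>\<^bsub>C\<^esub>}" by (rule finite_subset[OF _ fin])
  moreover have "\<forall>i. ?x i \<in> F i" using x(1) by simp
  ultimately show "\<exists>x. U = gr_class x \<and> (\<forall>i. x i \<in> F i) \<and> finite {i. x i \<noteq> \<zero>\<^bsub>C\<^esub>}" by blast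
next
  assume "\<exists>x. U = gr_class x \<and> (\<forall>i. x i \<in> F i) \<and> finite {i. x i \<noteq> \<zero>\<^bsub>C\<^esub>}"
  then obtain x where x: "U = gr_class x" "\<And>i. x i \<in> F i" "finite {i. x i \<noteq> \<zero>\<^bsub>C\<^esub>}" by blast
  have "{i. U i \<noteq> below i} \<subseteq> {i. x i \<noteq> \<zero>\<^bsub>C\<^esub>}"
    using x(1) below_coset_zero[of "\<zero>\<^bsub>C\<^esub>"] by (auto simp: gr_class_def)
  then show "U \<in> carrier (gr C F)"
    using x finite_subset by (auto simp: gr_def gr_class_def)
qed

lemma gr_zero: "\<zero>\<^bsub>gr C F\<^esub> = gr_class (\<lambda>_. \<zero>\<^bsub>C\<^esub>)"
  using below_coset_zero[of "\<zero>\<^bsub>C\<^esub>"] by (auto simp: gr_def gr_class_def)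

lemma gr_class_eq_zero_iff: "(\<And>i. x i \<in> F i) \<Longrightarrow> gr_class x = \<zero>\<^bsub>gr C F\<^esub> \<longleftrightarrow> (\<forall>i. x i \<in> below i)"
  using below_coset_zero[OF F_sub, of "x i" i i for i] by (simp add: gr_def gr_class_def fun_eq_iff)

lemma one_in_F0:
  assumes "domain (gr C F)"
  shows "\<one>\<^bsub>C\<^esub> \<in> F 0"
proof -
  interpret G: "domain" "gr C F" by fact
  have "\<one>\<^bsub>gr C F\<^esub> \<in> carrier (gr C F)" by simp
  then have "\<forall>i. \<exists>x\<in>F i. below i +>\<^bsub>C\<^esub> (if i = 0 then \<one>\<^bsub>C\<^esub> else \<zero>\<^bsub>C\<^esub>) = below i +>\<^bsub>C\<^esub> x"
    by (simp add: gr_def)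
  from this[rule_format, of 0] obtain x where "x \<in> F 0" "below 0 +>\<^bsub>C\<^esub> \<one>\<^bsub>C\<^esub> = below 0 +>\<^bsub>C\<^esub> x"
    by auto
  then have "\<one>\<^bsub>C\<^esub> = x" using \<open>x \<in> F 0\<close> F_sub[of x 0] by (auto simp: filt_below_def a_r_coset_def')
  then show ?thesis using \<open>x \<in> F 0\<close> by simp
qed

text \<open>
  Two elements violating strictness give homogeneous zero divisors.
\<close>
lemma strict_filtration_of_gr_domain:
  assumes "domain (gr C F)"
  shows "strict_filtration C F"
  unfolding strict_filtration_def
proof (intro allI ballI notI)
  interpret G: "domain" "gr C F" by fact
  fix i j a b assume ab: "a \<in> F i - below i" "b \<in> F j - below j" "a \<otimes>\<^bsub>C\<^esub> b \<in> below (i + j)"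
  let ?x = "\<lambda>k. if k = i then a else \<zero>\<^bsub>C\<^esub>" and ?y = "\<lambda>k. if k = j then b else \<zero>\<^bsub>C\<^esub>"
  have F: "?x k \<in> F k" "?y k \<in> F k" for k using ab by auto
  have carr: "a \<in> carrier C" "b \<in> carrier C" using ab F_sub[of a i] F_sub[of b j] by simp_all
  have "finite {k. ?x k \<noteq> \<zero>\<^bsub>C\<^esub>}" by (rule finite_subset[of _ "{i}"]) auto
  moreover have "finite {k. ?y k \<noteq> \<zero>\<^bsub>C\<^esub>}" by (rule finite_subset[of _ "{j}"]) auto
  ultimately have "gr_class ?x \<in> carrier (gr C F)" "gr_class ?y \<in> carrier (gr C F)"
    unfolding gr_carrier_iff using F by blast+
  moreover have "gr_class ?x \<noteq> \<zero>\<^bsub>gr C F\<^esub>" "gr_class ?y \<noteq> \<zero>\<^bsub>gr C F\<^esub>"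
    using ab F by (auto simp: gr_class_eq_zero_iff)
  moreover have "gr_class ?x \<otimes>\<^bsub>gr C F\<^esub> gr_class ?y = \<zero>\<^bsub>gr C F\<^esub>"
  proof -
    have "(\<Oplus>\<^bsub>C\<^esub>l\<in>{..k}. ?x l \<otimes>\<^bsub>C\<^esub> ?y (k - l)) \<in> below k" for k
    proof (rule M.finsum_in_additive_subgroup[OF below_additive], rule)
      fix l assume "l \<in> {..k}"
      then show "?x l \<otimes>\<^bsub>C\<^esub> ?y (k - l) \<in> below k" using ab carr by auto
    qed
    then show ?thesis using F convolution_in_filtration[of ?x ?y] by (subst gr_mult) (auto simp: gr_class_eq_zero_iff)
  qed
  ultimately show False using G.integral by blast
qed

text \<open>
  The associated graded ring is the image of the Rees ring, the subring of the univariate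
  polynomials whose coefficient in degree \<open>i\<close> lies in \<open>F i\<close>, and inherits its laws.
\<close>
lemma gr_cring:
  assumes one: "\<one>\<^bsub>C\<^esub> \<in> F 0"
  shows "cring (gr C F)"
proof -
  have "UP_cring C" by (rule UP_cring.intro) (rule M_cring)
  then interpret U: cring "UP C" by (rule UP_cring.UP_cring)
  define Rees where "Rees = {x. (\<forall>i. x i \<in> F i) \<and> finite {i. x i \<noteq> \<zero>\<^bsub>C\<^esub>}}"
  have "\<exists>n. bound \<zero>\<^bsub>C\<^esub> n x" if fx: "finite {i. x i \<noteq> \<zero>\<^bsub>C\<^esub>}" for x
  proof -
    obtain N where "\<forall>i\<in>{i. x i \<noteq> \<zero>\<^bsub>C\<^esub>}. i < N" using finite_nat_set_iff_bounded[THEN iffD1, OF fx] by (elim exE)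
    then have "bound \<zero>\<^bsub>C\<^esub> N x" by (intro bound.intro) (metis less_asym mem_Collect_eq)
    then show ?thesis by blast
  qed
  then have Rees_up: "Rees \<subseteq> up C" by (auto simp: Rees_def up_def intro: F_sub)
  have fin: "finite {i. x i \<noteq> \<zero>\<^bsub>C\<^esub>}" if "x \<in> up C" for x
  proof -
    obtain N where "bound \<zero>\<^bsub>C\<^esub> N x" using \<open>x \<in> up C\<close> by (auto simp: up_def)
    then have "{i. x i \<noteq> \<zero>\<^bsub>C\<^esub>} \<subseteq> {..N}" using bound_below[of "\<zero>\<^bsub>C\<^esub>" N x] by auto
    then show ?thesis by (rule finite_subset) simp
  qed
  have Rees_iff: "x \<in> Rees \<longleftrightarrow> x \<in> up C \<and> (\<forall>i. x i \<in> F i)" for x using Rees_up fin by (auto simp: Rees_def)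
  have car: "carrier (UP C) = up C" by (simp add: UP_def)
  note add = UP_ops(1) and mult = UP_ops(2)
  have one': "\<one>\<^bsub>UP C\<^esub> = (\<lambda>i. if i = 0 then \<one>\<^bsub>C\<^esub> else \<zero>\<^bsub>C\<^esub>)" by (simp add: UP_def)
  have "subring Rees (UP C)"
  proof (rule U.subringI)
    show "Rees \<subseteq> carrier (UP C)" using Rees_up car by simp
    show "\<one>\<^bsub>UP C\<^esub> \<in> Rees" using one U.one_closed car by (auto simp: Rees_iff one')
    fix x y assume x: "x \<in> Rees" and y: "y \<in> Rees"
    have xU: "x \<in> up C" and yU: "y \<in> up C" using x y Rees_up by auto
    show "x \<otimes>\<^bsub>UP C\<^esub> y \<in> Rees"
      using U.m_closed[of x y] xU yU car convolution_in_filtration x y by (auto simp: Rees_iff mult)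
    show "x \<oplus>\<^bsub>UP C\<^esub> y \<in> Rees"
      using U.a_closed[of x y] xU yU car F_add x y by (auto simp: Rees_iff add)
    have m: "\<ominus>\<^bsub>UP C\<^esub> x \<in> up C" using U.a_inv_closed[of x] xU car by simp
    have "(\<ominus>\<^bsub>UP C\<^esub> x) i = \<ominus>\<^bsub>C\<^esub> x i" for i
    proof -
      have "x \<oplus>\<^bsub>UP C\<^esub> (\<ominus>\<^bsub>UP C\<^esub> x) = \<zero>\<^bsub>UP C\<^esub>" using U.r_neg[of x] xU car by simp
      then have "x i \<oplus>\<^bsub>C\<^esub> (\<ominus>\<^bsub>UP C\<^esub> x) i = \<zero>\<^bsub>C\<^esub>"
        unfolding add[OF xU m] UP_zero by (rule fun_cong)
      moreover have "x i \<in> carrier C" "(\<ominus>\<^bsub>UP C\<^esub> x) i \<in> carrier C"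
        using xU m unfolding up_def by blast+
      ultimately show ?thesis using M.minus_equality[of "(\<ominus>\<^bsub>UP C\<^esub> x) i" "x i"] by (metis a_comm)
    qed
    then show "\<ominus>\<^bsub>UP C\<^esub> x \<in> Rees"
      using m x additive_subgroup.a_inv_closed[OF F_additive] by (auto simp: Rees_iff)
  qed
  then have R: "cring (UP C\<lparr>carrier := Rees\<rparr>)"
    using U.subring_is_ring U.subcringI' U.subcring_iff Rees_up car by (metis subcring_def)
  interpret Rees: cring "UP C\<lparr>carrier := Rees\<rparr>" by (rule R)
  have hom: "gr_class \<in> ring_hom (UP C\<lparr>carrier := Rees\<rparr>) (gr C F)"
  proof (rule ring_hom_memI; simp)
    fix x assume "x \<in> Rees"
    then show "gr_class x \<in> carrier (gr C F)" unfolding gr_carrier_iff Rees_def by blast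
  next
    fix x y assume xy: "x \<in> Rees" "y \<in> Rees"
    then have U: "x \<in> up C" "y \<in> up C" and F: "\<And>i. x i \<in> F i" "\<And>i. y i \<in> F i" using Rees_up Rees_iff by auto
    show "gr_class (x \<otimes>\<^bsub>UP C\<^esub> y) = gr_class x \<otimes>\<^bsub>gr C F\<^esub> gr_class y"
      using U F by (simp add: mult gr_mult)
    show "gr_class (x \<oplus>\<^bsub>UP C\<^esub> y) = gr_class x \<oplus>\<^bsub>gr C F\<^esub> gr_class y"
    proof
      fix i
      have "(below i +>\<^bsub>C\<^esub> x i) <+>\<^bsub>C\<^esub> (below i +>\<^bsub>C\<^esub> y i) = below i +>\<^bsub>C\<^esub> (x i \<oplus>\<^bsub>C\<^esub> y i)"
        by (rule abelian_subgroup.a_rcos_sum[OF abelian_subgroupI3[OF below_additive M.abelian_group_axioms]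
              F_sub[OF F(1)] F_sub[OF F(2)]])
      then show "gr_class (x \<oplus>\<^bsub>UP C\<^esub> y) i = (gr_class x \<oplus>\<^bsub>gr C F\<^esub> gr_class y) i"
        using U by (simp add: add gr_class_def gr_def)
    qed
  next
    show "gr_class \<one>\<^bsub>UP C\<^esub> = \<one>\<^bsub>gr C F\<^esub>" by (auto simp: one' gr_class_def gr_def)
  qed
  have img: "gr_class ` Rees = carrier (gr C F)"
    unfolding set_eq_iff gr_carrier_iff Rees_def by blast
  have zero: "gr_class \<zero>\<^bsub>UP C\<^esub> = \<zero>\<^bsub>gr C F\<^esub>" unfolding gr_zero UP_zero ..
  have "ring (gr C F)"
    using Rees.ring_hom_imp_img_ring[OF hom] img zero by simp
  then show ?thesis
  proof (rule cring.intro)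
    show "comm_monoid (gr C F)"
    proof (rule monoid.monoid_comm_monoidI)
      show "monoid (gr C F)" using \<open>ring (gr C F)\<close> by (rule ring.is_monoid)
      fix u v assume "u \<in> carrier (gr C F)" "v \<in> carrier (gr C F)"
      then obtain x y where "x \<in> Rees" "y \<in> Rees" "u = gr_class x" "v = gr_class y" using img by blast
      then show "u \<otimes>\<^bsub>gr C F\<^esub> v = v \<otimes>\<^bsub>gr C F\<^esub> u"
        using ring_hom_mult[OF hom, of x y] ring_hom_mult[OF hom, of y x] Rees.m_comm[of x y] by simp
    qed
  qed
qed

text \<open>
  The product of the top degree components of two nonzero elements is nonzero, and it is
  the component of the product in the sum of the degrees.
\<close>
lemma gr_domain_of_strict_filtration:
  assumes one: "\<one>\<^bsub>C\<^esub> \<in> F 0" "\<one>\<^bsub>C\<^esub> \<noteq> \<zero>\<^bsub>C\<^esub>" and strict: "strict_filtration C F"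
  shows "domain (gr C F)"
proof -
  interpret G: cring "gr C F" using one(1) by (rule gr_cring)
  show ?thesis
  proof (rule domainI[OF G.cring_axioms])
    have "\<one>\<^bsub>gr C F\<^esub> 0 \<noteq> below 0"
      using one by (simp add: gr_def below_coset_zero) (simp add: filt_below_def)
    moreover have "\<zero>\<^bsub>gr C F\<^esub> 0 = below 0" by (simp add: gr_def)
    ultimately show "\<one>\<^bsub>gr C F\<^esub> \<noteq> \<zero>\<^bsub>gr C F\<^esub>" by metis
    fix u v assume uv: "u \<otimes>\<^bsub>gr C F\<^esub> v = \<zero>\<^bsub>gr C F\<^esub>" "u \<in> carrier (gr C F)" "v \<in> carrier (gr C F)"
    then obtain x y where x: "u = gr_class x" "\<And>i. x i \<in> F i" "finite {i. x i \<noteq> \<zero>\<^bsub>C\<^esub>}"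
      and y: "v = gr_class y" "\<And>i. y i \<in> F i" "finite {i. y i \<noteq> \<zero>\<^bsub>C\<^esub>}"
      unfolding gr_carrier_iff by blast
    show "u = \<zero>\<^bsub>gr C F\<^esub> \<or> v = \<zero>\<^bsub>gr C F\<^esub>"
    proof (rule ccontr)
      assume neg: "\<not> ?thesis"
      let ?S = "{i. x i \<notin> below i}" and ?T = "{i. y i \<notin> below i}"
      have fin: "finite ?S" "finite ?T"
        by (rule finite_subset[OF _ x(3)], force) (rule finite_subset[OF _ y(3)], force)
      have ne: "?S \<noteq> {}" "?T \<noteq> {}" using neg x y by (auto simp: gr_class_eq_zero_iff)
      define i j where "i = Max ?S" and "j = Max ?T"
      have i: "x i \<notin> below i" "\<And>k. k > i \<Longrightarrow> x k \<in> below k"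
        using Max_in[OF fin(1) ne(1)] Max_ge[OF fin(1)] by (auto simp: i_def not_le[symmetric])
      have j: "y j \<notin> below j" "\<And>k. k > j \<Longrightarrow> y k \<in> below k"
        using Max_in[OF fin(2) ne(2)] Max_ge[OF fin(2)] by (auto simp: j_def not_le[symmetric])
      have "(\<Oplus>\<^bsub>C\<^esub>l\<in>{..i+j}. x l \<otimes>\<^bsub>C\<^esub> y (i + j - l)) \<notin> below (i + j)"
      proof (rule M.finsum_dominant_term[OF below_additive, where s = i])
        show "(\<lambda>l. x l \<otimes>\<^bsub>C\<^esub> y (i + j - l)) \<in> {..i + j} \<rightarrow> carrier C" using F_sub[OF x(2)] F_sub[OF y(2)] by simp
        show "x i \<otimes>\<^bsub>C\<^esub> y (i + j - i) \<notin> below (i + j)"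
          using strict x y i j unfolding strict_filtration_def by auto
        fix l assume l: "l \<in> {..i + j}" "l \<noteq> i"
        show "x l \<otimes>\<^bsub>C\<^esub> y (i + j - l) \<in> below (i + j)"
        proof (cases "l > i")
          case True
          then show ?thesis using below_mult_left[OF i(2) y(2), of l "i + j - l"] l by simp
        next
          case False
          then have "i + j - l > j" using l by auto
          then show ?thesis using below_mult_right[OF x(2) j(2), of "i + j - l" l] l by simp
        qed
      qed auto
      moreover have "gr_class (\<lambda>i. \<Oplus>\<^bsub>C\<^esub>l\<in>{..i}. x l \<otimes>\<^bsub>C\<^esub> y (i - l)) = \<zero>\<^bsub>gr C F\<^esub>"
        using uv(1) gr_mult[OF x(2) y(2)] unfolding x(1) y(1) by (simp only:)
      then have "\<forall>k. (\<Oplus>\<^bsub>C\<^esub>l\<in>{..k}. x l \<otimes>\<^bsub>C\<^esub> y (k - l)) \<in> below k"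
        by (rule gr_class_eq_zero_iff[THEN iffD1, rotated]) (rule convolution_in_filtration[OF x(2) y(2)])
      ultimately show False by blast
    qed
  qed
qed

end

section \<open>Extending filtrations to polynomial extensions\<close>

text \<open>
  The filtration of a polynomial extension in which every variable has weight \<open>w\<close>.
\<close>
definition ext_filtration ::
    "('k, 'a, 'z) palg_scheme \<Rightarrow> nat \<Rightarrow> nat \<Rightarrow> (nat \<Rightarrow> 'a set) \<Rightarrow> nat \<Rightarrow> (nat multiset \<Rightarrow> 'a) set"
  where "ext_filtration A n w F k = {f \<in> carrier (poly_ext A n).
    \<forall>m. f m \<noteq> \<zero>\<^bsub>A\<^esub> \<longrightarrow> w * size m \<le> k \<and> f m \<in> F (k - w * size m)}"

locale filtered_poisson = poisson_algebra K A + filtered_algebra K A F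
  for K (structure) and A (structure) and F

lemma filtered_poissonI:
  assumes "poisson_algebra K A" "filtration K A F"
  shows "filtered_poisson K A F"
  using assms by (intro filtered_poisson.intro filtered_algebra.intro filtered_algebra_axioms.intro)
    (auto simp: poisson_algebra_def)

context filtered_poisson begin

lemma ext_filtrationI:
  assumes "f \<in> carrier (poly_ext A n)"
    and "\<And>m. f m \<noteq> \<zero>\<^bsub>A\<^esub> \<Longrightarrow> w * size m \<le> k \<and> f m \<in> F (k - w * size m)"
  shows "f \<in> ext_filtration A n w F k"
  using assms by (simp add: ext_filtration_def)

lemma ext_filtration_carrier: "f \<in> ext_filtration A n w F k \<Longrightarrow> f \<in> carrier (poly_ext A n)"
  by (simp add: ext_filtration_def)

lemma ext_filtrationD:
  "f \<in> ext_filtration A n w F k \<Longrightarrow> f m \<noteq> \<zero>\<^bsub>A\<^esub> \<Longrightarrow> w * size m \<le> k \<and> f m \<in> F (k - w * size m)"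
  by (simp add: ext_filtration_def)

text \<open>
  A coefficient of weight exactly \<open>k\<close> must vanish on the left, and so it does on the right because
  \<^const>\<open>filt_below\<close> is zero in degree zero.
\<close>
lemma below_ext_filtration:
  "filt_below (poly_ext A n) (ext_filtration A n w F) k = {f \<in> carrier (poly_ext A n).
    \<forall>m. f m \<noteq> \<zero>\<^bsub>A\<^esub> \<longrightarrow> w * size m \<le> k \<and> f m \<in> below (k - w * size m)}"
proof (cases k)
  case 0
  have "f = (\<lambda>_. \<zero>\<^bsub>A\<^esub>)" if "\<forall>m. f m \<noteq> \<zero>\<^bsub>A\<^esub> \<longrightarrow> f m \<in> below 0" for f :: "nat multiset \<Rightarrow> _"
    using that by (auto simp: filt_below_def)
  then show ?thesis using 0 by (auto simp: filt_below_def[of "poly_ext A n"])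
next
  case (Suc j)
  have "w * size m \<le> j \<and> a \<in> F (j - w * size m) \<longleftrightarrow>
      w * size m \<le> Suc j \<and> a \<in> below (Suc j - w * size m)" if "a \<noteq> \<zero>\<^bsub>A\<^esub>" for a and m :: "nat multiset"
  proof (cases "w * size m \<le> j")
    case True
    then show ?thesis by (simp add: filt_below_def Suc_diff_le)
  next
    case False
    then show ?thesis using that by (auto simp: filt_below_def split: nat.splits)
  qed
  then show ?thesis using Suc by (auto simp: filt_below_def[of "poly_ext A n"] ext_filtration_def)
qed

lemma pconv_ext_filtration:
  assumes opr: "biadditive A opr"
    "\<And>i j a b. a \<in> F i \<Longrightarrow> b \<in> F j \<Longrightarrow> opr a b \<in> F (i + j)"
    and f: "f \<in> ext_filtration A n w F i" and g: "g \<in> ext_filtration A n w F j"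
  shows "pconv A opr f g \<in> ext_filtration A n w F (i + j)"
proof (rule ext_filtrationI)
  interpret biadditive A opr by fact
  note fc = ext_filtration_carrier[OF f] and gc = ext_filtration_carrier[OF g]
  show "pconv A opr f g \<in> carrier (poly_ext A n)" by (rule pconv_in_poly[OF opr(1) fc gc])
  fix m assume "pconv A opr f g m \<noteq> \<zero>\<^bsub>A\<^esub>"
  then obtain l l' where l: "m = l + l'" "f l \<noteq> \<zero>\<^bsub>A\<^esub>" "g l' \<noteq> \<zero>\<^bsub>A\<^esub>"
    using pconv_support[of f g m] poly_coeff_closed[OF fc] poly_coeff_closed[OF gc] by blast
  then have "w * size m \<le> i + j"
    using ext_filtrationD[OF f, of l] ext_filtrationD[OF g, of l'] by (simp add: algebra_simps)
  moreover have "pconv A opr f g m \<in> F (i + j - w * size m)"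
    unfolding pconv_def
  proof (rule M.finsum_in_additive_subgroup[OF F_additive], rule)
    fix l assume l: "l \<in> {l. l \<subseteq># m}"
    show "opr (f l) (g (m - l)) \<in> F (i + j - w * size m)"
    proof (cases "f l = \<zero>\<^bsub>A\<^esub> \<or> g (m - l) = \<zero>\<^bsub>A\<^esub>")
      case True
      then show ?thesis using poly_coeff_closed[OF fc, of l] poly_coeff_closed[OF gc, of "m - l"] by auto
    next
      case False
      then have fl: "w * size l \<le> i" "f l \<in> F (i - w * size l)"
        and gl: "w * size (m - l) \<le> j" "g (m - l) \<in> F (j - w * size (m - l))"
        using ext_filtrationD[OF f, of l] ext_filtrationD[OF g, of "m - l"] by auto
      have "size m = size l + size (m - l)" using l by (metis mem_Collect_eq size_union subset_mset.add_diff_inverse)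
      then have "(i - w * size l) + (j - w * size (m - l)) = i + j - w * size m"
        using fl gl by (simp add: algebra_simps)
      then show ?thesis using opr(2)[OF fl(2) gl(2)] by simp
    qed
  qed
  ultimately show "w * size m \<le> i + j \<and> pconv A opr f g m \<in> F (i + j - w * size m)" by simp
qed

lemma ext_filtration_submodule: "submodule (ext_filtration A n w F k) K (poly_ext A n)"
proof -
  interpret P: poisson_algebra K "poly_ext A n" by (rule poly_ext_poisson)
  show ?thesis
  proof (rule P.submoduleI)
    show "ext_filtration A n w F k \<subseteq> carrier (poly_ext A n)" by (auto simp: ext_filtration_def)
    show "\<zero>\<^bsub>poly_ext A n\<^esub> \<in> ext_filtration A n w F k" by (simp add: ext_filtration_def)
    have smult: "a \<odot>\<^bsub>poly_ext A n\<^esub> f \<in> ext_filtration A n w F k"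
      if "a \<in> carrier K" "f \<in> ext_filtration A n w F k" for a f
    proof (rule ext_filtrationI)
      show "a \<odot>\<^bsub>poly_ext A n\<^esub> f \<in> carrier (poly_ext A n)"
        using that(1) ext_filtration_carrier[OF that(2)] by (rule P.smult_closed)
      fix m assume "(a \<odot>\<^bsub>poly_ext A n\<^esub> f) m \<noteq> \<zero>\<^bsub>A\<^esub>"
      then have "f m \<noteq> \<zero>\<^bsub>A\<^esub>" using that(1) by auto
      then show "w * size m \<le> k \<and> (a \<odot>\<^bsub>poly_ext A n\<^esub> f) m \<in> F (k - w * size m)"
        using ext_filtrationD[OF that(2)] F_smult[OF that(1)] by auto
    qed
    then show "\<And>a f. a \<in> carrier K \<Longrightarrow> f \<in> ext_filtration A n w F k \<Longrightarrow>
      a \<odot>\<^bsub>poly_ext A n\<^esub> f \<in> ext_filtration A n w F k" .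
    fix f assume f: "f \<in> ext_filtration A n w F k"
    have "\<ominus>\<^bsub>poly_ext A n\<^esub> f = (\<ominus>\<^bsub>K\<^esub> \<one>\<^bsub>K\<^esub>) \<odot>\<^bsub>poly_ext A n\<^esub> f"
      using ext_filtration_carrier[OF f] P.smult_l_minus[of "\<one>\<^bsub>K\<^esub>" f]
      by (simp del: poly_ext_simps)
    then show "\<ominus>\<^bsub>poly_ext A n\<^esub> f \<in> ext_filtration A n w F k" using smult[OF _ f] by simp
    fix g assume g: "g \<in> ext_filtration A n w F k"
    show "f \<oplus>\<^bsub>poly_ext A n\<^esub> g \<in> ext_filtration A n w F k"
    proof (rule ext_filtrationI)
      show "f \<oplus>\<^bsub>poly_ext A n\<^esub> g \<in> carrier (poly_ext A n)"
        using ext_filtration_carrier[OF f] ext_filtration_carrier[OF g] by (rule P.M.a_closed)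
      fix m assume m: "(f \<oplus>\<^bsub>poly_ext A n\<^esub> g) m \<noteq> \<zero>\<^bsub>A\<^esub>"
      consider "f m = \<zero>\<^bsub>A\<^esub>" "g m \<noteq> \<zero>\<^bsub>A\<^esub>" | "f m \<noteq> \<zero>\<^bsub>A\<^esub>" "g m = \<zero>\<^bsub>A\<^esub>" | "f m \<noteq> \<zero>\<^bsub>A\<^esub>" "g m \<noteq> \<zero>\<^bsub>A\<^esub>"
        using m by (cases "f m = \<zero>\<^bsub>A\<^esub>"; cases "g m = \<zero>\<^bsub>A\<^esub>") auto
      then show "w * size m \<le> k \<and> (f \<oplus>\<^bsub>poly_ext A n\<^esub> g) m \<in> F (k - w * size m)"
        by cases (use ext_filtrationD[OF f, of m] ext_filtrationD[OF g, of m] F_sub F_add in auto)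
    qed
  qed
qed

lemma ext_filtration_filtration: "filtration K (poly_ext A n) (ext_filtration A n w F)"
  unfolding filtration_def
proof (intro conjI allI ballI)
  show "submodule (ext_filtration A n w F i) K (poly_ext A n)" for i by (rule ext_filtration_submodule)
  show "ext_filtration A n w F i \<subseteq> ext_filtration A n w F (Suc i)" for i
  proof
    fix f assume f: "f \<in> ext_filtration A n w F i"
    show "f \<in> ext_filtration A n w F (Suc i)"
    proof (rule ext_filtrationI[OF ext_filtration_carrier[OF f]])
      fix m assume "f m \<noteq> \<zero>\<^bsub>A\<^esub>"
      then have "w * size m \<le> i" "f m \<in> F (i - w * size m)" using ext_filtrationD[OF f] by auto
      then show "w * size m \<le> Suc i \<and> f m \<in> F (Suc i - w * size m)"
        using F_mono[OF diff_le_mono[of i "Suc i" "w * size m"]] by auto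
    qed
  qed
  show "(\<Union>i. ext_filtration A n w F i) = carrier (poly_ext A n)"
  proof
    show "carrier (poly_ext A n) \<subseteq> (\<Union>i. ext_filtration A n w F i)"
    proof
      fix f assume f: "f \<in> carrier (poly_ext A n)"
      let ?k = "\<Sum>m | f m \<noteq> \<zero>\<^bsub>A\<^esub>. w * size m + filt_deg F (f m)"
      have "f \<in> ext_filtration A n w F ?k"
      proof (rule ext_filtrationI[OF f])
        fix m assume "f m \<noteq> \<zero>\<^bsub>A\<^esub>"
        then have "w * size m + filt_deg F (f m) \<le> ?k"
          by (intro member_le_sum[where f = "\<lambda>m. w * size m + filt_deg F (f m)"])
            (auto simp: poly_finite_support[OF f])
        then have "w * size m \<le> ?k" "filt_deg F (f m) \<le> ?k - w * size m" by linarith+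
        then show "w * size m \<le> ?k \<and> f m \<in> F (?k - w * size m)"
          using filt_deg_le_iff[OF poly_coeff_closed[OF f]] by blast
      qed
      then show "f \<in> (\<Union>i. ext_filtration A n w F i)" by blast
    qed
  qed (auto simp: ext_filtration_def)
  show "f \<otimes>\<^bsub>poly_ext A n\<^esub> g \<in> ext_filtration A n w F (i + j)"
    if "f \<in> ext_filtration A n w F i" "g \<in> ext_filtration A n w F j" for i j f g
    using pconv_ext_filtration[OF mul.biadditive_axioms F_mult that] by simp
qed

lemma ext_filtration_poisson:
  assumes "poisson_filtration K A F"
  shows "poisson_filtration K (poly_ext A n) (ext_filtration A n w F)"
  unfolding poisson_filtration_def
proof (intro conjI allI ballI)
  show "filtration K (poly_ext A n) (ext_filtration A n w F)" by (rule ext_filtration_filtration)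
  have brk: "\<lbrace>a, b\<rbrace>\<^bsub>A\<^esub> \<in> F (i + j)" if "a \<in> F i" "b \<in> F j" for i j a b
    using assms that by (simp add: poisson_filtration_def)
  show "\<lbrace>f, g\<rbrace>\<^bsub>poly_ext A n\<^esub> \<in> ext_filtration A n w F (i + j)"
    if "f \<in> ext_filtration A n w F i" "g \<in> ext_filtration A n w F j" for i j f g
    using pconv_ext_filtration[OF brk.biadditive_axioms brk that] by simp
qed

lemma ext_filtration_leading_term:
  assumes f: "f \<in> ext_filtration A n w F i" "f \<notin> filt_below (poly_ext A n) (ext_filtration A n w F) i"
  obtains M where "w * size M \<le> i" "f M \<in> F (i - w * size M)" "f M \<notin> below (i - w * size M)"
    "\<And>l. l > M \<Longrightarrow> f l \<noteq> \<zero>\<^bsub>A\<^esub> \<Longrightarrow> f l \<in> below (i - w * size l)"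
proof -
  note fc = ext_filtration_carrier[OF f(1)]
  define S where "S = {m. f m \<noteq> \<zero>\<^bsub>A\<^esub> \<and> f m \<notin> below (i - w * size m)}"
  have "finite S" unfolding S_def by (rule finite_subset[OF _ poly_finite_support[OF fc]]) auto
  have "S \<noteq> {}"
  proof
    assume "S = {}"
    then have "\<forall>m. f m \<noteq> \<zero>\<^bsub>A\<^esub> \<longrightarrow> w * size m \<le> i \<and> f m \<in> below (i - w * size m)"
      using ext_filtrationD[OF f(1)] by (auto simp: S_def)
    then show False using f(2) fc unfolding below_ext_filtration by simp
  qed
  have M: "Max S \<in> S" "\<And>l. l > Max S \<Longrightarrow> l \<notin> S"
    using Max_in[OF \<open>finite S\<close> \<open>S \<noteq> {}\<close>] Max_ge[OF \<open>finite S\<close>] by (simp, meson not_less)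
  show ?thesis
    by (rule that[of "Max S"]) (use M ext_filtrationD[OF f(1)] in \<open>auto simp: S_def\<close>)
qed

text \<open>
  The product of the leading terms for the multiset order on monomials cannot be cancelled.
\<close>
lemma ext_filtration_strict:
  assumes strict: "strict_filtration A F"
  shows "strict_filtration (poly_ext A n) (ext_filtration A n w F)"
  unfolding strict_filtration_def
proof (intro allI ballI notI)
  let ?G = "ext_filtration A n w F"
  fix i j f g
  assume "f \<in> ?G i - filt_below (poly_ext A n) ?G i" and "g \<in> ?G j - filt_below (poly_ext A n) ?G j"
    and fg: "f \<otimes>\<^bsub>poly_ext A n\<^esub> g \<in> filt_below (poly_ext A n) ?G (i + j)"
  then have f: "f \<in> ?G i" "f \<notin> filt_below (poly_ext A n) ?G i"
    and g: "g \<in> ?G j" "g \<notin> filt_below (poly_ext A n) ?G j" by auto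
  obtain M where M: "w * size M \<le> i" "f M \<in> F (i - w * size M)" "f M \<notin> below (i - w * size M)"
    "\<And>l. l > M \<Longrightarrow> f l \<noteq> \<zero>\<^bsub>A\<^esub> \<Longrightarrow> f l \<in> below (i - w * size l)"
    using ext_filtration_leading_term[OF f] by metis
  obtain N where N: "w * size N \<le> j" "g N \<in> F (j - w * size N)" "g N \<notin> below (j - w * size N)"
    "\<And>l. l > N \<Longrightarrow> g l \<noteq> \<zero>\<^bsub>A\<^esub> \<Longrightarrow> g l \<in> below (j - w * size l)"
    using ext_filtration_leading_term[OF g] by metis
  note fc = poly_coeff_closed[OF ext_filtration_carrier[OF f(1)]]
    and gc = poly_coeff_closed[OF ext_filtration_carrier[OF g(1)]]
  let ?k = "i + j - w * size (M + N)"
  have k: "(i - w * size l) + (j - w * size l') = ?k"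
    if "l + l' = M + N" "w * size l \<le> i" "w * size l' \<le> j" for l l'
  proof -
    have "size l + size l' = size (M + N)" using that(1) by (metis size_union)
    then have "w * size l + w * size l' = w * size (M + N)" by (metis distrib_left)
    then show ?thesis using that by linarith
  qed
  \<comment> \<open>The exponents \<open>M\<close> and \<open>N\<close> are the largest ones with a coefficient of top degree, so any
    other pair with the same sum has a factor of lower degree.\<close>
  have "pconv A (monoid.mult A) f g (M + N) \<notin> below ?k"
    unfolding pconv_def
  proof (rule M.finsum_dominant_term[OF below_additive, where s = M])
    show "(\<lambda>l. f l \<otimes>\<^bsub>A\<^esub> g (M + N - l)) \<in> {l. l \<subseteq># M + N} \<rightarrow> carrier A" using fc gc by simp
    have "f M \<otimes>\<^bsub>A\<^esub> g N \<notin> below ((i - w * size M) + (j - w * size N))"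
      using strict M(2,3) N(2,3) unfolding strict_filtration_def by blast
    then show "f M \<otimes>\<^bsub>A\<^esub> g (M + N - M) \<notin> below ?k" using k[of M N] M(1) N(1) by simp
    fix l assume "l \<in> {l. l \<subseteq># M + N}" and ne: "l \<noteq> M"
    then obtain l' where l': "M + N = l + l'" by (metis mem_Collect_eq subset_mset.le_iff_add)
    have eq: "M + N - l = l'" using l' by simp
    show "f l \<otimes>\<^bsub>A\<^esub> g (M + N - l) \<in> below ?k"
    proof (cases "f l = \<zero>\<^bsub>A\<^esub> \<or> g l' = \<zero>\<^bsub>A\<^esub>")
      case True
      then show ?thesis using fc[of l] gc[of l'] eq by auto
    next
      case False
      then have fl: "w * size l \<le> i" "f l \<in> F (i - w * size l)"
        and gl: "w * size l' \<le> j" "g l' \<in> F (j - w * size l')"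
        using ext_filtrationD[OF f(1), of l] ext_filtrationD[OF g(1), of l'] by auto
      show ?thesis
      proof (cases "l > M")
        case True
        then show ?thesis
          using below_mult_left[OF M(4)[OF True] gl(2)] False k[OF l'[symmetric] fl(1) gl(1)] eq by simp
      next
        case lt: False
        then have "l' > N" using ne l' by (metis add_less_le_mono linorder_neqE not_less order_less_irrefl)
        then show ?thesis
          using below_mult_right[OF fl(2) N(4)[of l']] False k[OF l'[symmetric] fl(1) gl(1)] eq by simp
      qed
    qed
  qed simp_all
  moreover have "pconv A (monoid.mult A) f g (M + N) \<in> below ?k"
    using fg unfolding below_ext_filtration by (cases "pconv A (monoid.mult A) f g (M + N) = \<zero>\<^bsub>A\<^esub>") auto
  ultimately show False by blast
qed

lemma ext_filtration_gr_domain: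
  assumes "domain (gr A F)" "\<one>\<^bsub>A\<^esub> \<noteq> \<zero>\<^bsub>A\<^esub>"
  shows "domain (gr (poly_ext A n) (ext_filtration A n w F))"
proof -
  interpret P: poisson_algebra K "poly_ext A n" by (rule poly_ext_poisson)
  interpret P: filtered_algebra K "poly_ext A n" "ext_filtration A n w F"
    by unfold_locales (rule ext_filtration_filtration)
  show ?thesis
  proof (rule P.gr_domain_of_strict_filtration)
    show "strict_filtration (poly_ext A n) (ext_filtration A n w F)"
      using assms(1) by (intro ext_filtration_strict strict_filtration_of_gr_domain)
    show "\<one>\<^bsub>poly_ext A n\<^esub> \<noteq> \<zero>\<^bsub>poly_ext A n\<^esub>" using assms(2) by (auto simp: pmonom_def fun_eq_iff)
    show "\<one>\<^bsub>poly_ext A n\<^esub> \<in> ext_filtration A n w F 0"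
      using one_in_F0[OF assms(1)] by (auto simp: ext_filtration_def) (auto simp: pmonom_def split: if_splits)
  qed
qed

lemma filt_deg_const:
  assumes "a \<in> carrier A"
  shows "filt_deg (ext_filtration A n w F) (pmonom A a {#}) = filt_deg F a"
proof -
  have "pmonom A a {#} \<in> ext_filtration A n w F k \<longleftrightarrow> a \<in> F k" for k
    using assms by (auto simp: ext_filtration_def) (auto simp: pmonom_def split: if_splits)
  then show ?thesis by (simp add: filt_deg_def)
qed

end

section \<open>Polynomials over a domain\<close>

lemma (in poisson_algebra) trivial_filtration: "filtration K A (\<lambda>_. carrier A)"
  unfolding filtration_def by (auto intro: carrier_is_submodule)

text \<open>
  With all coefficients in degree zero and variables of weight one, the extended filtration is the
  one by total degree. Its strictness says that the total degree is additive.
\<close>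
lemma (in poisson_algebra) trivial_filtration_strict:
  assumes "domain A"
  shows "strict_filtration A (\<lambda>_. carrier A)"
proof -
  interpret D: "domain" A by fact
  show ?thesis
    unfolding strict_filtration_def filt_below_def using D.integral by (auto split: nat.splits)
qed

lemma (in poisson_algebra) poly_degree_filtration:
  assumes "domain A"
  shows "filtered_algebra K (poly_ext A n) (ext_filtration A n 1 (\<lambda>_. carrier A))"
    and "strict_filtration (poly_ext A n) (ext_filtration A n 1 (\<lambda>_. carrier A))"
proof -
  interpret filtered_poisson K A "\<lambda>_. carrier A"
    by (rule filtered_poissonI[OF poisson_algebra_axioms trivial_filtration])
  interpret P: poisson_algebra K "poly_ext A n" by (rule poly_ext_poisson)
  show "filtered_algebra K (poly_ext A n) (ext_filtration A n 1 (\<lambda>_. carrier A))"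
    by unfold_locales (rule ext_filtration_filtration)
  show "strict_filtration (poly_ext A n) (ext_filtration A n 1 (\<lambda>_. carrier A))"
    by (rule ext_filtration_strict[OF trivial_filtration_strict[OF assms]])
qed

lemma (in poisson_algebra) poly_domain:
  assumes "domain A"
  shows "domain (poly_ext A n)"
proof -
  interpret P: filtered_algebra K "poly_ext A n" "ext_filtration A n 1 (\<lambda>_. carrier A)"
    by (rule poly_degree_filtration[OF assms])
  show ?thesis
  proof (rule domainI[OF P.M_cring])
    show "\<one>\<^bsub>poly_ext A n\<^esub> \<noteq> \<zero>\<^bsub>poly_ext A n\<^esub>"
      using domain.one_not_zero[OF assms] by (auto simp: pmonom_def fun_eq_iff)
  qed (use P.strict_filtration_integral[OF poly_degree_filtration(2)[OF assms]] in blast)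
qed

text \<open>
  The total degree is additive, so both factors of a nonzero constant have degree zero.
\<close>
lemma (in poisson_algebra) factor_of_const:
  assumes "domain A" and f: "f \<in> carrier (poly_ext A n)" and g: "g \<in> carrier (poly_ext A n)"
    and fg: "f \<otimes>\<^bsub>poly_ext A n\<^esub> g = pmonom A c {#}" and c: "c \<in> carrier A" "c \<noteq> \<zero>\<^bsub>A\<^esub>"
  shows "f = pmonom A (f {#}) {#}"
proof -
  let ?G = "ext_filtration A n 1 (\<lambda>_. carrier A)"
  interpret P: filtered_algebra K "poly_ext A n" ?G by (rule poly_degree_filtration[OF assms(1)])
  have nz: "pmonom A c {#} \<noteq> \<zero>\<^bsub>poly_ext A n\<^esub>" using c by (auto simp: pmonom_def fun_eq_iff)
  have "f \<noteq> \<zero>\<^bsub>poly_ext A n\<^esub>"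
  proof
    assume "f = \<zero>\<^bsub>poly_ext A n\<^esub>"
    then have "f \<otimes>\<^bsub>poly_ext A n\<^esub> g = \<zero>\<^bsub>poly_ext A n\<^esub>" by (simp only: P.l_null[OF g])
    then show False using nz fg by (simp only:)
  qed
  have "g \<noteq> \<zero>\<^bsub>poly_ext A n\<^esub>"
  proof
    assume "g = \<zero>\<^bsub>poly_ext A n\<^esub>"
    then have "f \<otimes>\<^bsub>poly_ext A n\<^esub> g = \<zero>\<^bsub>poly_ext A n\<^esub>" by (simp only: P.r_null[OF f])
    then show False using nz fg by (simp only:)
  qed
  define i j where "i = filt_deg ?G f" and "j = filt_deg ?G g"
  have "f \<in> ?G i - P.below i" "g \<in> ?G j - P.below j"
    using P.filt_deg_mem[OF f] P.filt_deg_mem[OF g] P.filt_deg_below[OF f \<open>f \<noteq> _\<close>]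
      P.filt_deg_below[OF g \<open>g \<noteq> _\<close>] by (auto simp: i_def j_def)
  then have "f \<otimes>\<^bsub>poly_ext A n\<^esub> g \<notin> P.below (i + j)"
    using poly_degree_filtration(2)[OF assms(1), of n] unfolding strict_filtration_def by blast
  moreover have "pmonom A c {#} \<in> ?G 0"
    using c by (auto simp: ext_filtration_def) (auto simp: pmonom_def split: if_splits)
  ultimately have "i = 0" using P.F_below[of 0 "i + j"] fg by (cases "i + j = 0") auto
  then have "f \<in> ?G 0" using P.filt_deg_mem[OF f] by (simp add: i_def)
  then have "f m = \<zero>\<^bsub>A\<^esub>" if "m \<noteq> {#}" for m using that by (auto simp: ext_filtration_def)
  then show ?thesis by (auto simp: pmonom_def)
qed

section \<open>Poisson isomorphisms\<close>

lemma poisson_isoD: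
  assumes "\<phi> \<in> poisson_iso K A B"
  shows "\<phi> \<in> ring_iso A B" "\<phi> \<in> ring_hom A B" "bij_betw \<phi> (carrier A) (carrier B)"
    "\<And>a. a \<in> carrier A \<Longrightarrow> \<phi> a \<in> carrier B"
    "\<And>a b. a \<in> carrier A \<Longrightarrow> b \<in> carrier A \<Longrightarrow> \<phi> (a \<oplus>\<^bsub>A\<^esub> b) = \<phi> a \<oplus>\<^bsub>B\<^esub> \<phi> b"
    "\<And>a b. a \<in> carrier A \<Longrightarrow> b \<in> carrier A \<Longrightarrow> \<phi> (a \<otimes>\<^bsub>A\<^esub> b) = \<phi> a \<otimes>\<^bsub>B\<^esub> \<phi> b"
    "\<phi> \<one>\<^bsub>A\<^esub> = \<one>\<^bsub>B\<^esub>"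
    "\<And>k a. k \<in> carrier K \<Longrightarrow> a \<in> carrier A \<Longrightarrow> \<phi> (k \<odot>\<^bsub>A\<^esub> a) = k \<odot>\<^bsub>B\<^esub> \<phi> a"
    "\<And>a b. a \<in> carrier A \<Longrightarrow> b \<in> carrier A \<Longrightarrow> \<phi> \<lbrace>a, b\<rbrace>\<^bsub>A\<^esub> = \<lbrace>\<phi> a, \<phi> b\<rbrace>\<^bsub>B\<^esub>"
  using assms by (auto simp: poisson_iso_def ring_iso_def ring_hom_memE dest: ring_hom_memE)

lemma poisson_isoI:
  assumes "bij_betw \<phi> (carrier A) (carrier B)"
    "\<And>a b. a \<in> carrier A \<Longrightarrow> b \<in> carrier A \<Longrightarrow> \<phi> (a \<oplus>\<^bsub>A\<^esub> b) = \<phi> a \<oplus>\<^bsub>B\<^esub> \<phi> b"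
    "\<And>a b. a \<in> carrier A \<Longrightarrow> b \<in> carrier A \<Longrightarrow> \<phi> (a \<otimes>\<^bsub>A\<^esub> b) = \<phi> a \<otimes>\<^bsub>B\<^esub> \<phi> b"
    "\<phi> \<one>\<^bsub>A\<^esub> = \<one>\<^bsub>B\<^esub>"
    "\<And>k a. k \<in> carrier K \<Longrightarrow> a \<in> carrier A \<Longrightarrow> \<phi> (k \<odot>\<^bsub>A\<^esub> a) = k \<odot>\<^bsub>B\<^esub> \<phi> a"
    "\<And>a b. a \<in> carrier A \<Longrightarrow> b \<in> carrier A \<Longrightarrow> \<phi> \<lbrace>a, b\<rbrace>\<^bsub>A\<^esub> = \<lbrace>\<phi> a, \<phi> b\<rbrace>\<^bsub>B\<^esub>"
  shows "\<phi> \<in> poisson_iso K A B"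
  using assms bij_betwE[OF assms(1)]
  by (auto simp: poisson_iso_def ring_iso_def intro!: ring_hom_memI)

lemma poisson_iso_zero:
  assumes "poisson_algebra K A" "poisson_algebra K B" "\<phi> \<in> poisson_iso K A B"
  shows "\<phi> \<zero>\<^bsub>A\<^esub> = \<zero>\<^bsub>B\<^esub>"
proof -
  interpret A: poisson_algebra K A by fact
  interpret B: poisson_algebra K B by fact
  show ?thesis using ring_hom_zero[OF poisson_isoD(2)[OF assms(3)]] A.ring_axioms B.ring_axioms by blast
qed

lemma poisson_iso_compose:
  assumes \<phi>: "\<phi> \<in> poisson_iso K A B" and \<psi>: "\<psi> \<in> poisson_iso K B C"
  shows "\<psi> \<circ> \<phi> \<in> poisson_iso K A C"
  by (rule poisson_isoI)
    (simp_all add: bij_betw_trans[OF poisson_isoD(3)[OF \<phi>] poisson_isoD(3)[OF \<psi>]]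
      poisson_isoD(4-)[OF \<phi>] poisson_isoD(5-)[OF \<psi>])

lemma poisson_iso_inverse:
  assumes A: "poisson_algebra K A" and \<phi>: "\<phi> \<in> poisson_iso K A B"
  shows "inv_into (carrier A) \<phi> \<in> poisson_iso K B A"
proof (rule poisson_isoI)
  interpret A: poisson_algebra K A by fact
  let ?\<psi> = "inv_into (carrier A) \<phi>"
  note bij = poisson_isoD(3)[OF \<phi>]
  show "bij_betw ?\<psi> (carrier B) (carrier A)" by (rule bij_betw_inv_into[OF bij])
  have inv: "?\<psi> (\<phi> a) = a" if "a \<in> carrier A" for a
    using that bij by (rule bij_betw_inv_into_left[rotated])
  have obt: "\<exists>a\<in>carrier A. b = \<phi> a" if "b \<in> carrier B" for b
    using that bij by (auto simp: bij_betw_def)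
  show "?\<psi> \<one>\<^bsub>B\<^esub> = \<one>\<^bsub>A\<^esub>" using inv[of "\<one>\<^bsub>A\<^esub>"] poisson_isoD(7)[OF \<phi>] by simp
  fix b assume "b \<in> carrier B"
  then obtain a where a: "a \<in> carrier A" "b = \<phi> a" using obt by blast
  show "?\<psi> (k \<odot>\<^bsub>B\<^esub> b) = k \<odot>\<^bsub>A\<^esub> ?\<psi> b" if k: "k \<in> carrier K" for k
    using inv[of "k \<odot>\<^bsub>A\<^esub> a"] inv[of a] a k poisson_isoD(8)[OF \<phi> k] by simp
  fix b' assume "b' \<in> carrier B"
  then obtain a' where a': "a' \<in> carrier A" "b' = \<phi> a'" using obt by blast
  show "?\<psi> (b \<oplus>\<^bsub>B\<^esub> b') = ?\<psi> b \<oplus>\<^bsub>A\<^esub> ?\<psi> b'"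
    using inv[of "a \<oplus>\<^bsub>A\<^esub> a'"] inv[of a] inv[of a'] a a' poisson_isoD(5)[OF \<phi>] by simp
  show "?\<psi> (b \<otimes>\<^bsub>B\<^esub> b') = ?\<psi> b \<otimes>\<^bsub>A\<^esub> ?\<psi> b'"
    using inv[of "a \<otimes>\<^bsub>A\<^esub> a'"] inv[of a] inv[of a'] a a' poisson_isoD(6)[OF \<phi>] by simp
  show "?\<psi> \<lbrace>b, b'\<rbrace>\<^bsub>B\<^esub> = \<lbrace>?\<psi> b, ?\<psi> b'\<rbrace>\<^bsub>A\<^esub>"
    using inv[of "\<lbrace>a, a'\<rbrace>\<^bsub>A\<^esub>"] inv[of a] inv[of a'] a a' poisson_isoD(9)[OF \<phi>] A.bracket_closed by simp
qed

section \<open>The Poisson center\<close>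

context poisson_algebra begin

lemma center_carrier:
  "carrier (poisson_center A) = {z \<in> carrier A. \<forall>a\<in>carrier A. \<lbrace>z, a\<rbrace>\<^bsub>A\<^esub> = \<zero>\<^bsub>A\<^esub>}"
  by (simp add: poisson_center_def)

lemma center_simps [simp]:
  "\<zero>\<^bsub>poisson_center A\<^esub> = \<zero>\<^bsub>A\<^esub>" "\<one>\<^bsub>poisson_center A\<^esub> = \<one>\<^bsub>A\<^esub>"
  "a \<oplus>\<^bsub>poisson_center A\<^esub> b = a \<oplus>\<^bsub>A\<^esub> b" "a \<otimes>\<^bsub>poisson_center A\<^esub> b = a \<otimes>\<^bsub>A\<^esub> b"
  "k \<odot>\<^bsub>poisson_center A\<^esub> a = k \<odot>\<^bsub>A\<^esub> a" "\<lbrace>a, b\<rbrace>\<^bsub>poisson_center A\<^esub> = \<lbrace>a, b\<rbrace>\<^bsub>A\<^esub>"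
  by (simp_all add: poisson_center_def)

lemma center_sub: "z \<in> carrier (poisson_center A) \<Longrightarrow> z \<in> carrier A"
  by (simp add: center_carrier)

lemma center_bracket:
  assumes "z \<in> carrier (poisson_center A)" "a \<in> carrier A"
  shows "\<lbrace>z, a\<rbrace>\<^bsub>A\<^esub> = \<zero>\<^bsub>A\<^esub>" "\<lbrace>a, z\<rbrace>\<^bsub>A\<^esub> = \<zero>\<^bsub>A\<^esub>"
  using assms bracket_swap[of a z] by (auto simp: center_carrier)

lemma bracket_leibniz_left:
  assumes "a \<in> carrier A" "b \<in> carrier A" "c \<in> carrier A"
  shows "\<lbrace>a \<otimes>\<^bsub>A\<^esub> b, c\<rbrace>\<^bsub>A\<^esub> = \<lbrace>a, c\<rbrace>\<^bsub>A\<^esub> \<otimes>\<^bsub>A\<^esub> b \<oplus>\<^bsub>A\<^esub> a \<otimes>\<^bsub>A\<^esub> \<lbrace>b, c\<rbrace>\<^bsub>A\<^esub>"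
  using assms bracket_swap[of "a \<otimes>\<^bsub>A\<^esub> b" c] bracket_swap[of a c] bracket_swap[of b c] bracket_leibniz[of c a b]
    bracket_closed[of c a] bracket_closed[of c b]
  by (simp add: l_minus r_minus minus_add)

lemma bracket_one: "a \<in> carrier A \<Longrightarrow> \<lbrace>\<one>\<^bsub>A\<^esub>, a\<rbrace>\<^bsub>A\<^esub> = \<zero>\<^bsub>A\<^esub>"
  using bracket_leibniz_left[of "\<one>\<^bsub>A\<^esub>" "\<one>\<^bsub>A\<^esub>" a] bracket_closed[of "\<one>\<^bsub>A\<^esub>" a] by simp

theorem poisson_center_poisson: "poisson_algebra K (poisson_center A)"
proof -
  let ?Z = "poisson_center A"
  have closed: "\<zero>\<^bsub>A\<^esub> \<in> carrier ?Z" "\<one>\<^bsub>A\<^esub> \<in> carrier ?Z"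
    by (simp_all add: center_carrier bracket_one)
  have closed2: "a \<oplus>\<^bsub>A\<^esub> b \<in> carrier ?Z" "a \<otimes>\<^bsub>A\<^esub> b \<in> carrier ?Z"
    "\<lbrace>a, b\<rbrace>\<^bsub>A\<^esub> \<in> carrier ?Z" "\<ominus>\<^bsub>A\<^esub> a \<in> carrier ?Z"
    if "a \<in> carrier ?Z" "b \<in> carrier ?Z" for a b
  proof -
    have ab: "a \<in> carrier A" "b \<in> carrier A" using that center_sub by auto
    show "a \<oplus>\<^bsub>A\<^esub> b \<in> carrier ?Z"
      using that ab by (simp add: center_carrier bracket_add_left)
    show "a \<otimes>\<^bsub>A\<^esub> b \<in> carrier ?Z"
      using that ab by (simp add: center_carrier bracket_leibniz_left)
    show "\<lbrace>a, b\<rbrace>\<^bsub>A\<^esub> \<in> carrier ?Z" using center_bracket(1)[OF that(1) ab(2)] closed by simp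
    have "\<lbrace>\<ominus>\<^bsub>A\<^esub> a, c\<rbrace>\<^bsub>A\<^esub> = \<zero>\<^bsub>A\<^esub>" if "c \<in> carrier A" for c
      using bracket_add_left[of a "\<ominus>\<^bsub>A\<^esub> a" c] center_bracket(1)[OF \<open>a \<in> carrier ?Z\<close> that] ab that
        bracket_closed[of "\<ominus>\<^bsub>A\<^esub> a" c] by (simp add: r_neg)
    then show "\<ominus>\<^bsub>A\<^esub> a \<in> carrier ?Z" using ab by (simp add: center_carrier)
  qed
  have smult: "k \<odot>\<^bsub>A\<^esub> a \<in> carrier ?Z" if "k \<in> carrier K" "a \<in> carrier ?Z" for k a
    using that by (simp add: center_carrier bracket_smult_left)
  note sub = center_sub
  have "abelian_group ?Z"
  proof (rule abelian_groupI)
    fix x assume "x \<in> carrier ?Z"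
    then show "\<exists>y\<in>carrier ?Z. y \<oplus>\<^bsub>?Z\<^esub> x = \<zero>\<^bsub>?Z\<^esub>"
      using closed2(4)[of x x] sub by (intro bexI[of _ "\<ominus>\<^bsub>A\<^esub> x"]) (simp_all add: l_neg)
  qed (simp_all add: closed closed2 sub a_assoc, simp add: sub a_comm)
  moreover have "comm_monoid ?Z"
    by (rule comm_monoidI) (simp_all add: closed closed2 sub m_assoc, simp add: sub m_comm)
  ultimately have "cring ?Z" by (intro cringI) (simp_all add: sub l_distr)
  then have "algebra K ?Z"
    by (intro algebraI) (simp_all add: R_cring smult sub smult_l_distr smult_r_distr smult_assoc1 smult_assoc2)
  then show ?thesis
    by (rule poisson_algebra.intro, unfold_locales)
      (simp_all add: closed2 sub bracket_add_left bracket_add_right bracket_smult_left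
        bracket_smult_right bracket_self bracket_jacobi bracket_leibniz)
qed

end

lemma poisson_iso_center:
  assumes A: "poisson_algebra K A" and B: "poisson_algebra K B" and \<phi>: "\<phi> \<in> poisson_iso K A B"
  shows "\<phi> \<in> poisson_iso K (poisson_center A) (poisson_center B)"
proof -
  interpret A: poisson_algebra K A by fact
  interpret B: poisson_algebra K B by fact
  have inj: "inj_on \<phi> (carrier A)" and img: "\<phi> ` carrier A = carrier B"
    using poisson_isoD(3)[OF \<phi>] by (auto simp: bij_betw_def)
  have iff: "\<phi> z \<in> carrier (poisson_center B) \<longleftrightarrow> z \<in> carrier (poisson_center A)" if "z \<in> carrier A" for z
  proof -
    have "\<phi> \<lbrace>z, a\<rbrace>\<^bsub>A\<^esub> = \<phi> \<zero>\<^bsub>A\<^esub> \<longleftrightarrow> \<lbrace>z, a\<rbrace>\<^bsub>A\<^esub> = \<zero>\<^bsub>A\<^esub>" if "a \<in> carrier A" for a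
      using inj that \<open>z \<in> carrier A\<close> A.bracket_closed by (intro inj_on_eq_iff) auto
    then have "(\<forall>b\<in>carrier B. \<lbrace>\<phi> z, b\<rbrace>\<^bsub>B\<^esub> = \<zero>\<^bsub>B\<^esub>) \<longleftrightarrow> (\<forall>a\<in>carrier A. \<lbrace>z, a\<rbrace>\<^bsub>A\<^esub> = \<zero>\<^bsub>A\<^esub>)"
      unfolding img[symmetric] using poisson_isoD(9)[OF \<phi> that] poisson_iso_zero[OF A B \<phi>] by simp
    then show ?thesis using that poisson_isoD(4)[OF \<phi> that] by (simp add: A.center_carrier B.center_carrier)
  qed
  have "\<phi> ` carrier (poisson_center A) = carrier (poisson_center B)"
  proof (intro equalityI subsetI)
    fix b assume b: "b \<in> carrier (poisson_center B)"
    then obtain a where "a \<in> carrier A" "b = \<phi> a" using img B.center_sub[OF b] by blast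
    then show "b \<in> \<phi> ` carrier (poisson_center A)" using iff b by blast
  qed (use iff A.center_sub in blast)
  moreover have "inj_on \<phi> (carrier (poisson_center A))"
    using inj by (rule inj_on_subset) (auto intro: A.center_sub)
  ultimately show ?thesis
    by (intro poisson_isoI) (simp_all add: bij_betw_def A.center_sub poisson_isoD(5-)[OF \<phi>])
qed

section \<open>The discriminant ideal is an isomorphism invariant\<close>

lemma ring_iso_ideal_image:
  assumes R: "cring R" and S: "cring S" and h: "h \<in> ring_iso R S" and I: "ideal I R"
  shows "ideal (h ` I) S"
proof -
  interpret R: cring R by fact
  interpret S: cring S by fact
  interpret I: ideal I R by fact
  let ?g = "inv_into (carrier R) h"
  have bij: "bij_betw h (carrier R) (carrier S)" using h by (simp add: ring_iso_def)
  have g: "?g \<in> ring_iso S R" by (rule ring_iso_set_sym[OF R.ring_axioms h])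
  interpret g: ring_hom_ring S R ?g
    using g by (intro ring_hom_ringI2) (auto simp: ring_iso_def R.ring_axioms S.ring_axioms)
  have "h ` I = {s \<in> carrier S. ?g s \<in> I}"
  proof (intro equalityI subsetI)
    fix s assume "s \<in> h ` I"
    then obtain r where r: "r \<in> I" "s = h r" by blast
    then have "r \<in> carrier R" using I.a_subset by blast
    then show "s \<in> {s \<in> carrier S. ?g s \<in> I}"
      using r bij_betw_inv_into_left[OF bij] bij_betwE[OF bij] by auto
  next
    fix s assume "s \<in> {s \<in> carrier S. ?g s \<in> I}"
    then have "?g s \<in> I" "s = h (?g s)" using bij_betw_inv_into_right[OF bij, of s] by auto
    then show "s \<in> h ` I" by blast
  qed
  then show ?thesis using g.ideal_vimage[OF I] by simp
qed

lemma ring_iso_vimage_image: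
  assumes "h \<in> ring_iso R S" "J \<subseteq> carrier S"
  shows "h ` {r \<in> carrier R. h r \<in> J} = J"
  using assms by (auto simp: ring_iso_def bij_betw_def image_iff)

lemma ring_iso_vimage_ideal:
  assumes "cring R" "cring S" "h \<in> ring_iso R S" "ideal J S"
  shows "ideal {r \<in> carrier R. h r \<in> J} R"
proof -
  interpret ring_hom_ring R S h
    using assms by (intro ring_hom_ringI2) (auto simp: ring_iso_def cring.axioms)
  show ?thesis by (rule ideal_vimage[OF assms(4)])
qed

lemma ring_iso_genideal_image:
  assumes R: "cring R" and S: "cring S" and h: "h \<in> ring_iso R S" and X: "Y \<subseteq> carrier R"
  shows "h ` (Idl\<^bsub>R\<^esub> Y) = Idl\<^bsub>S\<^esub> (h ` Y)"
proof
  interpret R: cring R by fact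
  interpret S: cring S by fact
  have hc: "h r \<in> carrier S" if "r \<in> carrier R" for r
    using h that by (auto simp: ring_iso_def dest: ring_hom_memE)
  then have hX: "h ` Y \<subseteq> carrier S" using X by auto
  show "Idl\<^bsub>S\<^esub> (h ` Y) \<subseteq> h ` (Idl\<^bsub>R\<^esub> Y)"
    by (intro S.genideal_minimal ring_iso_ideal_image[OF R S h] R.genideal_ideal[OF X]
      image_mono R.genideal_self[OF X])
  let ?J = "Idl\<^bsub>S\<^esub> (h ` Y)"
  have "Y \<subseteq> {r \<in> carrier R. h r \<in> ?J}" using X S.genideal_self[OF hX] by auto
  then have "Idl\<^bsub>R\<^esub> Y \<subseteq> {r \<in> carrier R. h r \<in> ?J}"
    by (intro R.genideal_minimal ring_iso_vimage_ideal[OF R S h] S.genideal_ideal[OF hX])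
  then show "h ` (Idl\<^bsub>R\<^esub> Y) \<subseteq> ?J" by auto
qed

lemma ring_iso_maximalideal_image:
  assumes R: "cring R" and S: "cring S" and h: "h \<in> ring_iso R S" and m: "maximalideal m R"
  shows "maximalideal (h ` m) S"
proof (rule maximalidealI)
  interpret m: maximalideal m R by fact
  have bij: "bij_betw h (carrier R) (carrier S)" using h by (simp add: ring_iso_def)
  show "ideal (h ` m) S" by (rule ring_iso_ideal_image[OF R S h m.is_ideal])
  have sub: "m \<subseteq> carrier R" by (rule m.a_subset)
  show "carrier S \<noteq> h ` m"
    using m.I_notcarr sub bij by (metis bij_betw_def inj_on_image_eq_iff order_refl)
  fix J assume J: "ideal J S" "h ` m \<subseteq> J" "J \<subseteq> carrier S"
  let ?J = "{r \<in> carrier R. h r \<in> J}"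
  have "m \<subseteq> ?J" using sub J by auto
  then have "?J = m \<or> ?J = carrier R"
    by (intro m.I_maximal ring_iso_vimage_ideal[OF R S h J(1)]) auto
  moreover have "h ` ?J = J" by (rule ring_iso_vimage_image[OF h J(3)])
  ultimately show "J = h ` m \<or> J = carrier S" using bij by (auto simp: bij_betw_def)
qed

text \<open>
  An isomorphism acts on cosets by taking images. The operations of the quotient are unions of
  cosets of representatives, and unions are preserved by taking images.
\<close>
lemma poisson_quot_iso:
  assumes A: "poisson_algebra K A" and B: "poisson_algebra K B" and \<phi>: "\<phi> \<in> poisson_iso K A B"
    and I: "I \<subseteq> carrier A"
  shows "(\<lambda>U. \<phi> ` U) \<in> poisson_iso K (poisson_quot A I) (poisson_quot B (\<phi> ` I))"
proof -
  interpret A: poisson_algebra K A by fact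
  interpret B: poisson_algebra K B by fact
  have inj: "inj_on \<phi> (carrier A)" and img: "\<phi> ` carrier A = carrier B"
    using poisson_isoD(3)[OF \<phi>] by (auto simp: bij_betw_def)
  have coset: "\<phi> ` (I +>\<^bsub>A\<^esub> a) = \<phi> ` I +>\<^bsub>B\<^esub> \<phi> a" if "a \<in> carrier A" for a
  proof -
    have "\<phi> (h \<oplus>\<^bsub>A\<^esub> a) = \<phi> h \<oplus>\<^bsub>B\<^esub> \<phi> a" if "h \<in> I" for h
      using that I \<open>a \<in> carrier A\<close> by (intro poisson_isoD(5)[OF \<phi>]) auto
    then show ?thesis by (simp add: a_r_coset_def' image_UN)
  qed
  have car: "carrier (poisson_quot A I) = {I +>\<^bsub>A\<^esub> a | a. a \<in> carrier A}"
    by (auto simp: poisson_quot_def FactRing_def A_RCOSETS_def')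
  have car': "carrier (poisson_quot B (\<phi> ` I)) = {\<phi> ` I +>\<^bsub>B\<^esub> \<phi> a | a. a \<in> carrier A}"
    unfolding poisson_quot_def FactRing_def A_RCOSETS_def' img[symmetric] by auto
  have sub: "U \<subseteq> carrier A" if "U \<in> carrier (poisson_quot A I)" for U
  proof -
    obtain a where "U = I +>\<^bsub>A\<^esub> a" "a \<in> carrier A" using \<open>U \<in> _\<close> unfolding car by blast
    then show ?thesis using A.M.a_r_coset_subset_G[OF I] by simp
  qed
  show ?thesis
  proof (rule poisson_isoI)
    have "inj_on (\<lambda>U. \<phi> ` U) (carrier (poisson_quot A I))"
      by (rule inj_onI) (use inj_on_image_eq_iff[OF inj sub sub] in simp)
    moreover have "(\<lambda>U. \<phi> ` U) ` carrier (poisson_quot A I) = carrier (poisson_quot B (\<phi> ` I))"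
      unfolding car car' using coset by (auto simp: image_iff)
    ultimately show "bij_betw (\<lambda>U. \<phi> ` U) (carrier (poisson_quot A I)) (carrier (poisson_quot B (\<phi> ` I)))"
      by (simp add: bij_betw_def)
    show "\<phi> ` \<one>\<^bsub>poisson_quot A I\<^esub> = \<one>\<^bsub>poisson_quot B (\<phi> ` I)\<^esub>"
      using coset[of "\<one>\<^bsub>A\<^esub>"] poisson_isoD(7)[OF \<phi>] by (simp add: poisson_quot_def FactRing_def)
    fix U assume U: "U \<in> carrier (poisson_quot A I)"
    have U': "a \<in> carrier A" if "a \<in> U" for a using that sub[OF U] by blast
    show "\<phi> ` (k \<odot>\<^bsub>poisson_quot A I\<^esub> U) = k \<odot>\<^bsub>poisson_quot B (\<phi> ` I)\<^esub> (\<phi> ` U)" if "k \<in> carrier K" for k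
      using that by (simp add: poisson_quot_def image_UN coset U' poisson_isoD(8)[OF \<phi>])
    fix V assume V: "V \<in> carrier (poisson_quot A I)"
    have V': "a \<in> carrier A" if "a \<in> V" for a using that sub[OF V] by blast
    show "\<phi> ` (U \<oplus>\<^bsub>poisson_quot A I\<^esub> V) = \<phi> ` U \<oplus>\<^bsub>poisson_quot B (\<phi> ` I)\<^esub> \<phi> ` V"
      by (simp add: poisson_quot_def FactRing_def set_add_def' image_UN U' V' poisson_isoD(5)[OF \<phi>])
    show "\<phi> ` (U \<otimes>\<^bsub>poisson_quot A I\<^esub> V) = \<phi> ` U \<otimes>\<^bsub>poisson_quot B (\<phi> ` I)\<^esub> \<phi> ` V"
      by (simp add: poisson_quot_def FactRing_def rcoset_mult_def image_UN coset U' V' poisson_isoD(6)[OF \<phi>])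
    show "\<phi> ` \<lbrace>U, V\<rbrace>\<^bsub>poisson_quot A I\<^esub> = \<lbrace>\<phi> ` U, \<phi> ` V\<rbrace>\<^bsub>poisson_quot B (\<phi> ` I)\<^esub>"
      by (simp add: poisson_quot_def image_UN coset U' V' A.bracket_closed poisson_isoD(9)[OF \<phi>])
  qed
qed

lemma has_property_iso:
  assumes "h \<in> poisson_iso K Q' Q" "has_property K P Q"
  shows "has_property K P Q'"
  using assms poisson_iso_compose unfolding has_property_def poisson_isomorphic_def by blast

lemma L_locus_iso:
  assumes A: "poisson_algebra K A" and B: "poisson_algebra K B" and \<phi>: "\<phi> \<in> poisson_iso K A B"
    and m: "m \<in> L_locus K P A"
  shows "\<phi> ` m \<in> L_locus K P B"
proof -
  interpret A: poisson_algebra K A by fact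
  interpret B: poisson_algebra K B by fact
  interpret ZA: poisson_algebra K "poisson_center A" by (rule A.poisson_center_poisson)
  interpret ZB: poisson_algebra K "poisson_center B" by (rule B.poisson_center_poisson)
  let ?\<psi> = "inv_into (carrier A) \<phi>"
  note bij = poisson_isoD(3)[OF \<phi>]
  have \<psi>: "?\<psi> \<in> poisson_iso K B A" by (rule poisson_iso_inverse[OF A \<phi>])
  have max: "maximalideal m (poisson_center A)"
    and hasP: "has_property K P (poisson_quot A (Idl\<^bsub>A\<^esub> m))"
    using m by (auto simp: L_locus_def max_spec_def)
  have mZ: "m \<subseteq> carrier (poisson_center A)"
    using max by (simp add: additive_subgroup.a_subset ideal.axioms(1) maximalideal.axioms(1))
  then have mA: "m \<subseteq> carrier A" using A.center_sub by blast
  then have mB: "\<phi> ` m \<subseteq> carrier B" using bij by (auto simp: bij_betw_def)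
  have IB: "Idl\<^bsub>B\<^esub> (\<phi> ` m) \<subseteq> carrier B"
    using B.genideal_ideal[OF mB] by (simp add: additive_subgroup.a_subset ideal.axioms(1))
  have "maximalideal (\<phi> ` m) (poisson_center B)"
    by (rule ring_iso_maximalideal_image[OF ZA.M_cring ZB.M_cring
          poisson_isoD(1)[OF poisson_iso_center[OF A B \<phi>]] max])
  moreover have "?\<psi> ` (Idl\<^bsub>B\<^esub> (\<phi> ` m)) = Idl\<^bsub>A\<^esub> m"
  proof -
    have "?\<psi> ` (\<phi> ` m) = m" using bij mA by (simp add: bij_betw_def image_inv_into_cancel inv_into_image_cancel)
    then show ?thesis
      using ring_iso_genideal_image[OF B.M_cring A.M_cring poisson_isoD(1)[OF \<psi>] mB] by simp
  qed
  then have "has_property K P (poisson_quot B (Idl\<^bsub>B\<^esub> (\<phi> ` m)))"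
    using has_property_iso[OF poisson_quot_iso[OF B A \<psi> IB]] hasP by simp
  ultimately show ?thesis by (simp add: L_locus_def max_spec_def)
qed

lemma disc_ideal_image_subset:
  assumes A: "poisson_algebra K A" and B: "poisson_algebra K B" and \<phi>: "\<phi> \<in> poisson_iso K A B"
  shows "\<phi> ` disc_ideal K P A \<subseteq> disc_ideal K P B"
proof -
  interpret A: poisson_algebra K A by fact
  interpret B: poisson_algebra K B by fact
  interpret ZA: poisson_algebra K "poisson_center A" by (rule A.poisson_center_poisson)
  interpret ZB: poisson_algebra K "poisson_center B" by (rule B.poisson_center_poisson)
  let ?\<psi> = "inv_into (carrier A) \<phi>"
  note bij = poisson_isoD(3)[OF \<phi>]
  have \<psi>: "?\<psi> \<in> poisson_iso K B A" by (rule poisson_iso_inverse[OF A \<phi>])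
  have "\<phi> x \<in> m'" if x: "x \<in> disc_ideal K P A" and m': "m' \<in> D_locus K P B" for x m'
  proof -
    have max: "maximalideal m' (poisson_center B)" using m' by (auto simp: D_locus_def max_spec_def)
    then have "m' \<subseteq> carrier (poisson_center B)"
      by (simp add: additive_subgroup.a_subset ideal.axioms(1) maximalideal.axioms(1))
    then have "m' \<subseteq> carrier B" using B.center_sub by blast
    then have eq: "\<phi> ` (?\<psi> ` m') = m'" using bij by (simp add: bij_betw_def image_inv_into_cancel)
    have "?\<psi> ` m' \<in> max_spec (poisson_center A)"
      using ring_iso_maximalideal_image[OF ZB.M_cring ZA.M_cring
          poisson_isoD(1)[OF poisson_iso_center[OF B A \<psi>]] max] by (simp add: max_spec_def)
    moreover have "?\<psi> ` m' \<notin> L_locus K P A"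
      using L_locus_iso[OF A B \<phi>, of "?\<psi> ` m'" P] eq m' by (auto simp: D_locus_def)
    ultimately have "x \<in> ?\<psi> ` m'" using x by (auto simp: disc_ideal_def D_locus_def)
    then show ?thesis using eq by blast
  qed
  moreover have "\<phi> x \<in> carrier (poisson_center B)" if "x \<in> disc_ideal K P A" for x
    using that poisson_isoD(4)[OF poisson_iso_center[OF A B \<phi>]] by (auto simp: disc_ideal_def)
  ultimately show ?thesis by (auto simp: disc_ideal_def)
qed

text \<open>
  Maximal ideals of the centers correspond under the isomorphism, and so do the quotients by the
  ideals that they generate. The invariance of the property itself is built into
  \<^const>\<open>has_property\<close>, which asks for an isomorphic copy with the property.
\<close>
theorem disc_ideal_iso:
  assumes A: "poisson_algebra K A" and B: "poisson_algebra K B" and \<phi>: "\<phi> \<in> poisson_iso K A B"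
  shows "disc_ideal K P B = \<phi> ` disc_ideal K P A"
proof
  let ?\<psi> = "inv_into (carrier A) \<phi>"
  have "?\<psi> ` disc_ideal K P B \<subseteq> disc_ideal K P A"
    by (rule disc_ideal_image_subset[OF B A poisson_iso_inverse[OF A \<phi>]])
  moreover have "disc_ideal K P B \<subseteq> carrier B"
    using poisson_algebra.center_sub[OF B] by (auto simp: disc_ideal_def)
  ultimately show "disc_ideal K P B \<subseteq> \<phi> ` disc_ideal K P A"
    using poisson_isoD(3)[OF \<phi>] by (metis bij_betw_def image_inv_into_cancel image_mono)
qed (rule disc_ideal_image_subset[OF assms])

section \<open>Transport of structure\<close>

locale algebra_iso = algebra K S for K (structure) and S (structure) +
  fixes T (structure) and e
  assumes bij: "bij_betw e (carrier S) (carrier T)"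
    and iso_add: "\<And>a b. a \<in> carrier S \<Longrightarrow> b \<in> carrier S \<Longrightarrow> e (a \<oplus>\<^bsub>S\<^esub> b) = e a \<oplus>\<^bsub>T\<^esub> e b"
    and iso_mult: "\<And>a b. a \<in> carrier S \<Longrightarrow> b \<in> carrier S \<Longrightarrow> e (a \<otimes>\<^bsub>S\<^esub> b) = e a \<otimes>\<^bsub>T\<^esub> e b"
    and iso_one: "e \<one>\<^bsub>S\<^esub> = \<one>\<^bsub>T\<^esub>"
    and iso_zero: "e \<zero>\<^bsub>S\<^esub> = \<zero>\<^bsub>T\<^esub>"
    and iso_smult: "\<And>k a. k \<in> carrier K \<Longrightarrow> a \<in> carrier S \<Longrightarrow> e (k \<odot>\<^bsub>S\<^esub> a) = k \<odot>\<^bsub>T\<^esub> e a"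
begin

lemma iso_closed: "a \<in> carrier S \<Longrightarrow> e a \<in> carrier T"
  using bij by (rule bij_betwE[rule_format])

lemma iso_surj: "b \<in> carrier T \<Longrightarrow> \<exists>a\<in>carrier S. b = e a"
  using bij by (auto simp: bij_betw_def)

lemma iso_eq_iff: "a \<in> carrier S \<Longrightarrow> b \<in> carrier S \<Longrightarrow> e a = e b \<longleftrightarrow> a = b"
  using bij by (auto simp: bij_betw_def dest: inj_onD)

lemma iso_ring_hom: "e \<in> ring_hom S T"
  by (rule ring_hom_memI) (simp_all add: iso_closed iso_add iso_mult iso_one)

lemma target_algebra: "algebra K T"
proof -
  have "e \<in> ring_iso S T" using iso_ring_hom bij by (simp add: ring_iso_def)
  then have "cring (T\<lparr>zero := e \<zero>\<^bsub>S\<^esub>\<rparr>)" by (rule cring.ring_iso_imp_img_cring[OF M_cring])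
  then have T: "cring T" by (simp add: iso_zero)
  have smult_closed: "k \<odot>\<^bsub>T\<^esub> y \<in> carrier T" if "k \<in> carrier K" "y \<in> carrier T" for k y
    using iso_surj[OF that(2)] that(1) iso_smult iso_closed by (metis smult_closed)
  show ?thesis
  proof (rule algebraI[OF R_cring T])
    fix k l y assume kl: "k \<in> carrier K" "l \<in> carrier K" and "y \<in> carrier T"
    then obtain a where a: "a \<in> carrier S" "y = e a" using iso_surj by blast
    show "(k \<oplus>\<^bsub>K\<^esub> l) \<odot>\<^bsub>T\<^esub> y = k \<odot>\<^bsub>T\<^esub> y \<oplus>\<^bsub>T\<^esub> l \<odot>\<^bsub>T\<^esub> y"
      using a kl smult_l_distr[OF kl a(1)] by (simp add: iso_smult[symmetric] iso_add[symmetric])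
    show "(k \<otimes>\<^bsub>K\<^esub> l) \<odot>\<^bsub>T\<^esub> y = k \<odot>\<^bsub>T\<^esub> (l \<odot>\<^bsub>T\<^esub> y)"
      using a kl smult_assoc1[OF kl a(1)] by (simp add: iso_smult[symmetric])
  next
    fix k y z assume k: "k \<in> carrier K" and "y \<in> carrier T" "z \<in> carrier T"
    then obtain a b where ab: "a \<in> carrier S" "y = e a" "b \<in> carrier S" "z = e b" using iso_surj by metis
    show "k \<odot>\<^bsub>T\<^esub> (y \<oplus>\<^bsub>T\<^esub> z) = k \<odot>\<^bsub>T\<^esub> y \<oplus>\<^bsub>T\<^esub> k \<odot>\<^bsub>T\<^esub> z"
      using ab k smult_r_distr[OF k ab(1,3)] by (simp add: iso_smult[symmetric] iso_add[symmetric])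
    show "(k \<odot>\<^bsub>T\<^esub> y) \<otimes>\<^bsub>T\<^esub> z = k \<odot>\<^bsub>T\<^esub> (y \<otimes>\<^bsub>T\<^esub> z)"
      using ab k smult_assoc2[OF k ab(1,3)] by (simp add: iso_smult[symmetric] iso_mult[symmetric])
  next
    fix y assume "y \<in> carrier T"
    then obtain a where a: "a \<in> carrier S" "y = e a" using iso_surj by blast
    show "\<one>\<^bsub>K\<^esub> \<odot>\<^bsub>T\<^esub> y = y"
      using a smult_one[OF a(1)] iso_smult[of "\<one>\<^bsub>K\<^esub>" a] by simp
  qed (simp add: smult_closed)
qed

lemma image_submodule:
  assumes "submodule H K S"
  shows "submodule (e ` H) K T"
proof -
  interpret T: algebra K T by (rule target_algebra)
  note H = submoduleE[OF assms] submodule.axioms(1)[OF assms, THEN subgroup.one_closed]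
  have sub: "a \<in> carrier S" if "a \<in> H" for a using H(1) that by blast
  show ?thesis
  proof (rule T.submoduleI)
    show "e ` H \<subseteq> carrier T" using H(1) iso_closed by blast
    have "e \<zero>\<^bsub>S\<^esub> \<in> e ` H" using H by (intro imageI) simp
    then show "\<zero>\<^bsub>T\<^esub> \<in> e ` H" by (simp add: iso_zero)
    have smult: "k \<odot>\<^bsub>T\<^esub> y \<in> e ` H" if k: "k \<in> carrier K" and y: "y \<in> e ` H" for k y
    proof -
      obtain a where a: "a \<in> H" "y = e a" using y by blast
      then have "k \<odot>\<^bsub>T\<^esub> y = e (k \<odot>\<^bsub>S\<^esub> a)" using iso_smult[OF k sub[OF a(1)]] by simp
      moreover have "k \<odot>\<^bsub>S\<^esub> a \<in> H" by (rule H(4)[OF k a(1)])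
      ultimately show ?thesis by (simp only: imageI)
    qed
    show "k \<odot>\<^bsub>T\<^esub> y \<in> e ` H" if "k \<in> carrier K" "y \<in> e ` H" for k y using that by (rule smult)
    fix y assume y: "y \<in> e ` H"
    then have "y \<in> carrier T" using H(1) iso_closed by blast
    then have "\<ominus>\<^bsub>T\<^esub> y = (\<ominus>\<^bsub>K\<^esub> \<one>\<^bsub>K\<^esub>) \<odot>\<^bsub>T\<^esub> y" using T.smult_l_minus[of "\<one>\<^bsub>K\<^esub>" y] by simp
    then show "\<ominus>\<^bsub>T\<^esub> y \<in> e ` H" using smult[OF _ y, of "\<ominus>\<^bsub>K\<^esub> \<one>\<^bsub>K\<^esub>"] by simp
    fix z assume "z \<in> e ` H"
    then obtain a b where ab: "a \<in> H" "y = e a" "b \<in> H" "z = e b" using y by blast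
    have "y \<oplus>\<^bsub>T\<^esub> z = e (a \<oplus>\<^bsub>S\<^esub> b)" using ab iso_add[OF sub[OF ab(1)] sub[OF ab(3)]] by simp
    moreover have "a \<oplus>\<^bsub>S\<^esub> b \<in> H" using H(5)[OF ab(1,3)] .
    ultimately show "y \<oplus>\<^bsub>T\<^esub> z \<in> e ` H" by (simp only: imageI)
  qed
qed

context
  fixes F assumes F: "filtration K S F"
begin

interpretation F: filtered_algebra K S F by unfold_locales (rule F)

lemma image_filtration: "filtration K T (\<lambda>i. e ` F i)"
  unfolding filtration_def
proof (intro conjI allI ballI)
  show "submodule (e ` F i) K T" for i by (rule image_submodule[OF F.F_submodule])
  show "e ` F i \<subseteq> e ` F (Suc i)" for i by (rule image_mono[OF F.F_mono]) simp
  have "(\<Union>i. e ` F i) = e ` (\<Union>i. F i)" by blast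
  also have "(\<Union>i. F i) = carrier S" using F by (simp add: filtration_def)
  finally show "(\<Union>i. e ` F i) = carrier T" using bij by (simp add: bij_betw_def)
  fix i j y z assume "y \<in> e ` F i" "z \<in> e ` F j"
  then obtain a b where ab: "a \<in> F i" "y = e a" "b \<in> F j" "z = e b" by blast
  have "y \<otimes>\<^bsub>T\<^esub> z = e (a \<otimes>\<^bsub>S\<^esub> b)" using ab iso_mult[OF F.F_sub[OF ab(1)] F.F_sub[OF ab(3)]] by simp
  then show "y \<otimes>\<^bsub>T\<^esub> z \<in> e ` F (i + j)" using F.F_mult[OF ab(1,3)] by simp
qed

lemma image_filtration_mem: "a \<in> carrier S \<Longrightarrow> e a \<in> e ` F i \<longleftrightarrow> a \<in> F i"
  using F.F_sub iso_eq_iff by blast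

lemma image_filt_deg: "a \<in> carrier S \<Longrightarrow> filt_deg (\<lambda>i. e ` F i) (e a) = filt_deg F a"
  by (simp add: filt_deg_def image_filtration_mem)

lemma image_gr_domain:
  assumes "domain (gr S F)" "\<one>\<^bsub>S\<^esub> \<noteq> \<zero>\<^bsub>S\<^esub>"
  shows "domain (gr T (\<lambda>i. e ` F i))"
proof -
  let ?G = "\<lambda>i. e ` F i"
  interpret T: algebra K T by (rule target_algebra)
  interpret T: filtered_algebra K T ?G by unfold_locales (rule image_filtration)
  have below: "filt_below T ?G i = e ` filt_below S F i" for i
    by (auto simp: filt_below_def iso_zero split: nat.splits)
  have below_mem: "e a \<in> filt_below T ?G i \<longleftrightarrow> a \<in> filt_below S F i" if "a \<in> carrier S" for a i
    unfolding below using that iso_eq_iff F.F_sub F.below_F by blast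
  show ?thesis
  proof (rule T.gr_domain_of_strict_filtration)
    show "\<one>\<^bsub>T\<^esub> \<in> e ` F 0" using F.one_in_F0[OF assms(1)] by (metis imageI iso_one)
    show "\<one>\<^bsub>T\<^esub> \<noteq> \<zero>\<^bsub>T\<^esub>" using assms(2) iso_eq_iff[of "\<one>\<^bsub>S\<^esub>" "\<zero>\<^bsub>S\<^esub>"] by (simp add: iso_one iso_zero)
    show "strict_filtration T ?G"
      unfolding strict_filtration_def
    proof (intro allI ballI)
      fix i j y z
      assume "y \<in> e ` F i - filt_below T ?G i" "z \<in> e ` F j - filt_below T ?G j"
      then obtain a b where ab: "a \<in> F i" "y = e a" "b \<in> F j" "z = e b"
        and "e a \<notin> filt_below T ?G i" "e b \<notin> filt_below T ?G j" by blast
      moreover have c: "a \<in> carrier S" "b \<in> carrier S" using F.F_sub[OF ab(1)] F.F_sub[OF ab(3)] .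
      ultimately have "a \<otimes>\<^bsub>S\<^esub> b \<notin> filt_below S F (i + j)"
        using F.strict_filtration_of_gr_domain[OF assms(1)] below_mem
        unfolding strict_filtration_def by blast
      then show "y \<otimes>\<^bsub>T\<^esub> z \<notin> filt_below T ?G (i + j)"
        using below_mem[of "a \<otimes>\<^bsub>S\<^esub> b" "i + j"] iso_mult[OF c] ab c by simp
    qed
  qed
qed

end

end

lemma poisson_iso_algebra_iso:
  assumes "poisson_algebra K A" "poisson_algebra K B" "\<phi> \<in> poisson_iso K A B"
  shows "algebra_iso K A B \<phi>"
proof -
  interpret A: poisson_algebra K A by fact
  show ?thesis
    using poisson_isoD(3,5-)[OF assms(3)] poisson_iso_zero[OF assms]
    by unfold_locales simp_all
qed

lemma poisson_algebra_of_iso: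
  assumes A: "poisson_algebra K A" and "algebra_iso K A B \<phi>"
    and brk: "\<And>a b. a \<in> carrier A \<Longrightarrow> b \<in> carrier A \<Longrightarrow> \<phi> \<lbrace>a, b\<rbrace>\<^bsub>A\<^esub> = \<lbrace>\<phi> a, \<phi> b\<rbrace>\<^bsub>B\<^esub>"
  shows "poisson_algebra K B"
proof -
  interpret A: poisson_algebra K A by fact
  interpret algebra_iso K A B \<phi> by fact
  note ops = brk[symmetric] iso_add[symmetric] iso_mult[symmetric] iso_smult[symmetric]
    iso_zero[symmetric]
  have ax1: "\<lbrace>a, b\<rbrace>\<^bsub>B\<^esub> \<in> carrier B" "k \<in> carrier K \<Longrightarrow> \<lbrace>k \<odot>\<^bsub>B\<^esub> a, b\<rbrace>\<^bsub>B\<^esub> = k \<odot>\<^bsub>B\<^esub> \<lbrace>a, b\<rbrace>\<^bsub>B\<^esub>"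
    "k \<in> carrier K \<Longrightarrow> \<lbrace>a, k \<odot>\<^bsub>B\<^esub> b\<rbrace>\<^bsub>B\<^esub> = k \<odot>\<^bsub>B\<^esub> \<lbrace>a, b\<rbrace>\<^bsub>B\<^esub>" "\<lbrace>a, a\<rbrace>\<^bsub>B\<^esub> = \<zero>\<^bsub>B\<^esub>"
    if ab: "a \<in> carrier B" "b \<in> carrier B" for a b k
  proof -
    obtain x where "x \<in> carrier A" "a = \<phi> x" using iso_surj[OF ab(1)] by blast
    moreover obtain y where "y \<in> carrier A" "b = \<phi> y" using iso_surj[OF ab(2)] by blast
    ultimately show "\<lbrace>a, b\<rbrace>\<^bsub>B\<^esub> \<in> carrier B" "k \<in> carrier K \<Longrightarrow> \<lbrace>k \<odot>\<^bsub>B\<^esub> a, b\<rbrace>\<^bsub>B\<^esub> = k \<odot>\<^bsub>B\<^esub> \<lbrace>a, b\<rbrace>\<^bsub>B\<^esub>"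
      "k \<in> carrier K \<Longrightarrow> \<lbrace>a, k \<odot>\<^bsub>B\<^esub> b\<rbrace>\<^bsub>B\<^esub> = k \<odot>\<^bsub>B\<^esub> \<lbrace>a, b\<rbrace>\<^bsub>B\<^esub>" "\<lbrace>a, a\<rbrace>\<^bsub>B\<^esub> = \<zero>\<^bsub>B\<^esub>"
      by (simp_all add: ops A.bracket_closed iso_closed A.bracket_smult_left A.bracket_smult_right
        A.bracket_self)
  qed
  have ax2: "\<lbrace>a \<oplus>\<^bsub>B\<^esub> b, c\<rbrace>\<^bsub>B\<^esub> = \<lbrace>a, c\<rbrace>\<^bsub>B\<^esub> \<oplus>\<^bsub>B\<^esub> \<lbrace>b, c\<rbrace>\<^bsub>B\<^esub>"
    "\<lbrace>a, b \<oplus>\<^bsub>B\<^esub> c\<rbrace>\<^bsub>B\<^esub> = \<lbrace>a, b\<rbrace>\<^bsub>B\<^esub> \<oplus>\<^bsub>B\<^esub> \<lbrace>a, c\<rbrace>\<^bsub>B\<^esub>"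
    "\<lbrace>a, \<lbrace>b, c\<rbrace>\<^bsub>B\<^esub>\<rbrace>\<^bsub>B\<^esub> \<oplus>\<^bsub>B\<^esub> \<lbrace>b, \<lbrace>c, a\<rbrace>\<^bsub>B\<^esub>\<rbrace>\<^bsub>B\<^esub> \<oplus>\<^bsub>B\<^esub> \<lbrace>c, \<lbrace>a, b\<rbrace>\<^bsub>B\<^esub>\<rbrace>\<^bsub>B\<^esub> = \<zero>\<^bsub>B\<^esub>"
    "\<lbrace>a, b \<otimes>\<^bsub>B\<^esub> c\<rbrace>\<^bsub>B\<^esub> = \<lbrace>a, b\<rbrace>\<^bsub>B\<^esub> \<otimes>\<^bsub>B\<^esub> c \<oplus>\<^bsub>B\<^esub> b \<otimes>\<^bsub>B\<^esub> \<lbrace>a, c\<rbrace>\<^bsub>B\<^esub>"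
    if abc: "a \<in> carrier B" "b \<in> carrier B" "c \<in> carrier B" for a b c
  proof -
    obtain x where x: "x \<in> carrier A" "a = \<phi> x" using iso_surj[OF abc(1)] by blast
    obtain y where y: "y \<in> carrier A" "b = \<phi> y" using iso_surj[OF abc(2)] by blast
    obtain z where z: "z \<in> carrier A" "c = \<phi> z" using iso_surj[OF abc(3)] by blast
    note xyz = x(1) y(1) z(1) x(2) y(2) z(2)
    show "\<lbrace>a \<oplus>\<^bsub>B\<^esub> b, c\<rbrace>\<^bsub>B\<^esub> = \<lbrace>a, c\<rbrace>\<^bsub>B\<^esub> \<oplus>\<^bsub>B\<^esub> \<lbrace>b, c\<rbrace>\<^bsub>B\<^esub>"
      using xyz A.bracket_add_left[OF xyz(1-3)] by (simp add: ops A.bracket_closed)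
    show "\<lbrace>a, b \<oplus>\<^bsub>B\<^esub> c\<rbrace>\<^bsub>B\<^esub> = \<lbrace>a, b\<rbrace>\<^bsub>B\<^esub> \<oplus>\<^bsub>B\<^esub> \<lbrace>a, c\<rbrace>\<^bsub>B\<^esub>"
      using xyz A.bracket_add_right[OF xyz(1-3)] by (simp add: ops A.bracket_closed)
    show "\<lbrace>a, \<lbrace>b, c\<rbrace>\<^bsub>B\<^esub>\<rbrace>\<^bsub>B\<^esub> \<oplus>\<^bsub>B\<^esub> \<lbrace>b, \<lbrace>c, a\<rbrace>\<^bsub>B\<^esub>\<rbrace>\<^bsub>B\<^esub> \<oplus>\<^bsub>B\<^esub> \<lbrace>c, \<lbrace>a, b\<rbrace>\<^bsub>B\<^esub>\<rbrace>\<^bsub>B\<^esub> = \<zero>\<^bsub>B\<^esub>"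
      using xyz A.bracket_jacobi[OF xyz(1-3)] by (simp add: ops A.bracket_closed)
    show "\<lbrace>a, b \<otimes>\<^bsub>B\<^esub> c\<rbrace>\<^bsub>B\<^esub> = \<lbrace>a, b\<rbrace>\<^bsub>B\<^esub> \<otimes>\<^bsub>B\<^esub> c \<oplus>\<^bsub>B\<^esub> b \<otimes>\<^bsub>B\<^esub> \<lbrace>a, c\<rbrace>\<^bsub>B\<^esub>"
      using xyz A.bracket_leibniz[OF xyz(1-3)] by (simp add: ops A.bracket_closed)
  qed
  show ?thesis
    by (rule poisson_algebra.intro[OF target_algebra], unfold_locales) (simp_all add: ax1 ax2)
qed

lemma poisson_filtration_image:
  assumes "poisson_algebra K A" "algebra_iso K A B \<phi>" "poisson_filtration K A F"
    and brk: "\<And>a b. a \<in> carrier A \<Longrightarrow> b \<in> carrier A \<Longrightarrow> \<phi> \<lbrace>a, b\<rbrace>\<^bsub>A\<^esub> = \<lbrace>\<phi> a, \<phi> b\<rbrace>\<^bsub>B\<^esub>"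
  shows "poisson_filtration K B (\<lambda>i. \<phi> ` F i)"
proof -
  interpret A: poisson_algebra K A by fact
  interpret algebra_iso K A B \<phi> by fact
  have F: "filtration K A F" and FB: "\<And>i j a b. a \<in> F i \<Longrightarrow> b \<in> F j \<Longrightarrow> \<lbrace>a, b\<rbrace>\<^bsub>A\<^esub> \<in> F (i + j)"
    using assms(3) by (auto simp: poisson_filtration_def)
  interpret F: filtered_algebra K A F by unfold_locales (rule F)
  have "\<lbrace>y, z\<rbrace>\<^bsub>B\<^esub> \<in> \<phi> ` F (i + j)" if "y \<in> \<phi> ` F i" "z \<in> \<phi> ` F j" for y z i j
  proof -
    obtain a b where ab: "a \<in> F i" "y = \<phi> a" "b \<in> F j" "z = \<phi> b" using \<open>y \<in> _\<close> \<open>z \<in> _\<close> by blast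
    then have "\<lbrace>y, z\<rbrace>\<^bsub>B\<^esub> = \<phi> \<lbrace>a, b\<rbrace>\<^bsub>A\<^esub>" using brk[OF F.F_sub[OF ab(1)] F.F_sub[OF ab(3)]] by simp
    then show ?thesis using FB[OF ab(1,3)] by simp
  qed
  then show ?thesis using image_filtration[OF F] by (simp add: poisson_filtration_def)
qed

text \<open>
  Effectiveness quantifies over test algebras on a single type. An injection of the carrier into
  that type yields a copy of an algebra on any other type. The test algebras with and without
  bracket have different record types, hence the two versions.
\<close>
definition transported_algebra :: "('b \<Rightarrow> 'a) \<Rightarrow> ('k, 'b, 'z) module_scheme \<Rightarrow> ('k, 'a) module"
  where "transported_algebra e S = (let g = inv_into (carrier S) e in
    \<lparr>carrier = e ` carrier S, monoid.mult = \<lambda>x y. e (g x \<otimes>\<^bsub>S\<^esub> g y), one = e \<one>\<^bsub>S\<^esub>,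
     zero = e \<zero>\<^bsub>S\<^esub>, add = \<lambda>x y. e (g x \<oplus>\<^bsub>S\<^esub> g y), smult = \<lambda>k x. e (k \<odot>\<^bsub>S\<^esub> g x)\<rparr>)"

definition transported_poisson :: "('b \<Rightarrow> 'a) \<Rightarrow> ('k, 'b, 'z) palg_scheme \<Rightarrow> ('k, 'a) palg"
  where "transported_poisson e S = (let g = inv_into (carrier S) e in
    \<lparr>carrier = e ` carrier S, monoid.mult = \<lambda>x y. e (g x \<otimes>\<^bsub>S\<^esub> g y), one = e \<one>\<^bsub>S\<^esub>,
     zero = e \<zero>\<^bsub>S\<^esub>, add = \<lambda>x y. e (g x \<oplus>\<^bsub>S\<^esub> g y), smult = \<lambda>k x. e (k \<odot>\<^bsub>S\<^esub> g x),
     pbracket = \<lambda>x y. e \<lbrace>g x, g y\<rbrace>\<^bsub>S\<^esub>\<rparr>)"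

lemma transported_algebra_ops:
  assumes "inj_on e (carrier S)"
  defines "T \<equiv> transported_algebra e S"
  shows "bij_betw e (carrier S) (carrier T)" "e \<one>\<^bsub>S\<^esub> = \<one>\<^bsub>T\<^esub>" "e \<zero>\<^bsub>S\<^esub> = \<zero>\<^bsub>T\<^esub>"
    "\<And>a b. a \<in> carrier S \<Longrightarrow> b \<in> carrier S \<Longrightarrow> e (a \<oplus>\<^bsub>S\<^esub> b) = e a \<oplus>\<^bsub>T\<^esub> e b"
    "\<And>a b. a \<in> carrier S \<Longrightarrow> b \<in> carrier S \<Longrightarrow> e (a \<otimes>\<^bsub>S\<^esub> b) = e a \<otimes>\<^bsub>T\<^esub> e b"
    "\<And>k a. a \<in> carrier S \<Longrightarrow> e (k \<odot>\<^bsub>S\<^esub> a) = k \<odot>\<^bsub>T\<^esub> e a"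
  using assms by (simp_all add: transported_algebra_def Let_def bij_betw_def)

lemma transported_poisson_ops:
  assumes "inj_on e (carrier S)"
  defines "T \<equiv> transported_poisson e S"
  shows "bij_betw e (carrier S) (carrier T)" "e \<one>\<^bsub>S\<^esub> = \<one>\<^bsub>T\<^esub>" "e \<zero>\<^bsub>S\<^esub> = \<zero>\<^bsub>T\<^esub>"
    "\<And>a b. a \<in> carrier S \<Longrightarrow> b \<in> carrier S \<Longrightarrow> e (a \<oplus>\<^bsub>S\<^esub> b) = e a \<oplus>\<^bsub>T\<^esub> e b"
    "\<And>a b. a \<in> carrier S \<Longrightarrow> b \<in> carrier S \<Longrightarrow> e (a \<otimes>\<^bsub>S\<^esub> b) = e a \<otimes>\<^bsub>T\<^esub> e b"
    "\<And>k a. a \<in> carrier S \<Longrightarrow> e (k \<odot>\<^bsub>S\<^esub> a) = k \<odot>\<^bsub>T\<^esub> e a"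
    "\<And>a b. a \<in> carrier S \<Longrightarrow> b \<in> carrier S \<Longrightarrow> e \<lbrace>a, b\<rbrace>\<^bsub>S\<^esub> = \<lbrace>e a, e b\<rbrace>\<^bsub>T\<^esub>"
  using assms by (simp_all add: transported_poisson_def Let_def bij_betw_def)

lemma transported_algebra_iso:
  assumes "algebra K S" "inj_on e (carrier S)"
  shows "algebra_iso K S (transported_algebra e S) e"
  using assms(1) transported_algebra_ops[OF assms(2)]
  by (intro algebra_iso.intro algebra_iso_axioms.intro)

lemma transported_poisson_iso:
  assumes "algebra K S" "inj_on e (carrier S)"
  shows "algebra_iso K S (transported_poisson e S) e"
  using assms(1) transported_poisson_ops[OF assms(2)]
  by (intro algebra_iso.intro algebra_iso_axioms.intro)

text \<open>
  Lists are encoded by iterating an injection of pairs, with \<open>a\<close> and \<open>b\<close> as tags for the two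
  constructors.
\<close>
lemma infinite_inj_lists:
  assumes "infinite (UNIV :: 'a set)"
  shows "\<exists>e :: 'a list \<Rightarrow> 'a. inj e"
proof -
  have "\<exists>p. inj_on p (UNIV \<times> UNIV :: ('a \<times> 'a) set) \<and> p ` (UNIV \<times> UNIV) \<subseteq> (UNIV :: 'a set)"
    unfolding card_of_ordLeq
    by (rule ordIso_imp_ordLeq[OF card_of_Times_same_infinite[OF assms]])
  then obtain p :: "'a \<times> 'a \<Rightarrow> 'a" where p: "inj p" by auto
  obtain a b :: 'a where ab: "a \<noteq> b"
    using assms by (metis UNIV_eq_I finite.emptyI finite.insertI insert_iff)
  define e where "e = rec_list (p (a, a)) (\<lambda>x _ r. p (b, p (x, r)))"
  have e: "e [] = p (a, a)" "e (x # xs) = p (b, p (x, e xs))" for x xs by (simp_all add: e_def)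
  have "e xs = e ys \<Longrightarrow> xs = ys" for xs ys
  proof (induction xs arbitrary: ys)
    case Nil
    then show ?case using p ab by (cases ys) (auto simp: e dest!: injD[OF p])
  next
    case (Cons x xs)
    then show ?case using p ab by (cases ys) (auto simp: e dest!: injD[OF p])
  qed
  then have "inj e" by (rule injI)
  then show ?thesis by blast
qed

text \<open>
  A finitely supported family is determined by the finite list of its nonzero entries.
\<close>
lemma finite_support_inj:
  assumes inf: "infinite (UNIV :: 'a set)"
  shows "\<exists>e :: (nat multiset \<Rightarrow> 'a) \<Rightarrow> 'a. inj_on e {f. finite {m. f m \<noteq> z}}"
proof -
  obtain l :: "'a list \<Rightarrow> 'a" where l: "inj l" using infinite_inj_lists[OF inf] by blast
  obtain c :: "nat \<Rightarrow> 'a" where c: "inj c" using infinite_countable_subset[OF inf] by auto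
  define code where "code = (\<lambda>f :: nat multiset \<Rightarrow> 'a. SOME xs. set xs = {(m, f m) | m. f m \<noteq> z})"
  have code: "set (code f) = {(m, f m) | m. f m \<noteq> z}" if "finite {m. f m \<noteq> z}" for f
  proof -
    have "{(m, f m) | m. f m \<noteq> z} = (\<lambda>m. (m, f m)) ` {m. f m \<noteq> z}" by auto
    then have "\<exists>xs. set xs = {(m, f m) | m. f m \<noteq> z}" using that by (simp add: finite_list)
    then show ?thesis unfolding code_def by (rule someI_ex)
  qed
  define g where "g = (\<lambda>p :: nat multiset \<times> 'a. l [l (map c (sorted_list_of_multiset (fst p))), snd p])"
  have g: "inj g"
  proof (rule injI)
    fix p q assume "g p = g q"
    then have "l (map c (sorted_list_of_multiset (fst p))) = l (map c (sorted_list_of_multiset (fst q)))"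
      "snd p = snd q" using injD[OF l] by (auto simp: g_def)
    then have "map c (sorted_list_of_multiset (fst p)) = map c (sorted_list_of_multiset (fst q))"
      using injD[OF l] by blast
    then have "sorted_list_of_multiset (fst p) = sorted_list_of_multiset (fst q)"
      using c by (simp add: inj_map_eq_map)
    then have "fst p = fst q" by (metis mset_sorted_list_of_multiset)
    then show "p = q" using \<open>snd p = snd q\<close> by (simp add: prod_eq_iff)
  qed
  have "inj_on (\<lambda>f. l (map g (code f))) {f. finite {m. f m \<noteq> z}}"
  proof (rule inj_onI)
    fix f f' assume fin: "f \<in> {f. finite {m. f m \<noteq> z}}" "f' \<in> {f. finite {m. f m \<noteq> z}}"
      and "l (map g (code f)) = l (map g (code f'))"
    then have "map g (code f) = map g (code f')" using injD[OF l] by blast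
    then have "code f = code f'" using g by (simp add: inj_map_eq_map)
    then have "{(m, f m) | m. f m \<noteq> z} = {(m, f' m) | m. f' m \<noteq> z}" 
      using code[of f] code[of f'] fin unfolding mem_Collect_eq by (simp only:)
    then have eq: "f m \<noteq> z \<and> y = f m \<longleftrightarrow> f' m \<noteq> z \<and> y = f' m" for m y
      by (auto simp: set_eq_iff)
    show "f = f'"
    proof
      fix m show "f m = f' m" using eq[of m "f m"] eq[of m "f' m"] by metis
    qed
  qed
  then show ?thesis by blast
qed

lemma (in poisson_algebra) poly_ext_inj:
  assumes inf: "infinite (UNIV :: 'c set)" and e: "inj_on (e :: 'a \<Rightarrow> 'c) (carrier A)"
  shows "\<exists>e' :: (nat multiset \<Rightarrow> 'a) \<Rightarrow> 'c. inj_on e' (carrier (poly_ext A n))"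
proof -
  obtain g :: "(nat multiset \<Rightarrow> 'c) \<Rightarrow> 'c" where g: "inj_on g {f. finite {m. f m \<noteq> e \<zero>\<^bsub>A\<^esub>}}"
    using finite_support_inj[OF inf] by blast
  have "inj_on (\<lambda>f. g (\<lambda>m. e (f m))) (carrier (poly_ext A n))"
  proof (rule inj_onI)
    fix f f' assume f: "f \<in> carrier (poly_ext A n)" "f' \<in> carrier (poly_ext A n)"
      and eq: "g (\<lambda>m. e (f m)) = g (\<lambda>m. e (f' m))"
    have "finite {m. e (f m) \<noteq> e \<zero>\<^bsub>A\<^esub>}" if "f \<in> carrier (poly_ext A n)" for f
      by (rule finite_subset[OF _ poly_finite_support[OF that]]) auto
    then have "(\<lambda>m. e (f m)) = (\<lambda>m. e (f' m))" using g eq f by (auto dest!: inj_onD)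
    then have "e (f m) = e (f' m)" for m by (rule fun_cong)
    then show "f = f'"
      using inj_onD[OF e] poly_coeff_closed[OF f(1)] poly_coeff_closed[OF f(2)] by blast
  qed
  then show ?thesis by blast
qed

section \<open>Collecting the powers of one variable\<close>

context poisson_algebra begin

text \<open>
  The coefficient of the \<open>k\<close>-th power of the \<open>j\<close>-th variable.
\<close>
definition strip :: "nat \<Rightarrow> nat \<Rightarrow> (nat multiset \<Rightarrow> 'a) \<Rightarrow> nat multiset \<Rightarrow> 'a"
  where "strip j k f = (\<lambda>m. if j \<in># m then \<zero>\<^bsub>A\<^esub> else f (m + replicate_mset k j))"

text \<open>
  The homomorphism that sends the \<open>j\<close>-th variable to the new variable of the outer polynomial ring
  and fixes all coefficients and all other variables.
\<close>
definition collect :: "nat \<Rightarrow> (nat multiset \<Rightarrow> 'a) \<Rightarrow> nat multiset \<Rightarrow> nat multiset \<Rightarrow> 'a"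
  where "collect j f = (\<lambda>\<mu>. if set_mset \<mu> \<subseteq> {..<1} then strip j (size \<mu>) f else (\<lambda>_. \<zero>\<^bsub>A\<^esub>))"

lemma strip_index:
  "(j \<notin># m \<and> m + replicate_mset k j = e) \<longleftrightarrow> (m = filter_mset (\<lambda>i. i \<noteq> j) e \<and> k = count e j)"
proof
  assume "j \<notin># m \<and> m + replicate_mset k j = e"
  then have "count e a = count m a + (if a = j then k else 0)" and "count m j = 0" for a
    by (auto simp: not_in_iff)
  then show "m = filter_mset (\<lambda>i. i \<noteq> j) e \<and> k = count e j"
    by (simp add: multiset_eq_iff)
next
  assume h: "m = filter_mset (\<lambda>i. i \<noteq> j) e \<and> k = count e j"
  then have "j \<notin># m" by simp
  moreover have "filter_mset (\<lambda>i. i \<noteq> j) e + replicate_mset (count e j) j = e"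
    by (simp add: multiset_eq_iff)
  ultimately show "j \<notin># m \<and> m + replicate_mset k j = e" using h by simp
qed

lemma single_variable: "set_mset \<mu> \<subseteq> {..<1} \<longleftrightarrow> \<mu> = replicate_mset (size \<mu>) (0 :: nat)"
proof
  assume "set_mset \<mu> \<subseteq> {..<1}"
  then have "set_mset \<mu> \<subseteq> {0}" by auto
  then show "\<mu> = replicate_mset (size \<mu>) 0" by (rule set_mset_subset_singletonD)
next
  assume "\<mu> = replicate_mset (size \<mu>) 0"
  then have "set_mset \<mu> = set_mset (replicate_mset (size \<mu>) 0)" by simp
  then show "set_mset \<mu> \<subseteq> {..<1}" by (auto split: if_splits)
qed

lemma collect_replicate: "collect j f (replicate_mset k 0) = strip j k f"
  by (auto simp: collect_def)

lemma collect_monom: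
  "collect j (pmonom A a e) =
    pmonom (poly_ext A n) (pmonom A a (filter_mset (\<lambda>i. i \<noteq> j) e)) (replicate_mset (count e j) 0)"
proof
  fix \<mu>
  show "collect j (pmonom A a e) \<mu> =
    pmonom (poly_ext A n) (pmonom A a (filter_mset (\<lambda>i. i \<noteq> j) e)) (replicate_mset (count e j) 0) \<mu>"
  proof (cases "set_mset \<mu> \<subseteq> {..<1}")
    case True
    define k where "k = size \<mu>"
    have \<mu>: "\<mu> = replicate_mset k 0" using True unfolding k_def by (rule single_variable[THEN iffD1])
    have "strip j k (pmonom A a e) m = (if k = count e j then pmonom A a (filter_mset (\<lambda>i. i \<noteq> j) e) m else \<zero>\<^bsub>A\<^esub>)" for m
    proof -
      have "strip j k (pmonom A a e) m = (if j \<notin># m \<and> m + replicate_mset k j = e then a else \<zero>\<^bsub>A\<^esub>)"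
        by (simp add: strip_def pmonom_def)
      then show ?thesis unfolding strip_index by (auto simp: pmonom_def)
    qed
    moreover have "replicate_mset k (0 :: nat) = replicate_mset (count e j) 0 \<longleftrightarrow> k = count e j"
      by (metis size_replicate_mset)
    ultimately show ?thesis by (auto simp: \<mu> collect_replicate pmonom_def[of "poly_ext A n"])
  next
    case False
    then have "\<mu> \<noteq> replicate_mset (count e j) 0" by (auto split: if_splits)
    then show ?thesis using False by (simp add: collect_def pmonom_def)
  qed
qed

lemma collect_zero: "collect j (\<lambda>_. \<zero>\<^bsub>A\<^esub>) = (\<lambda>_ _. \<zero>\<^bsub>A\<^esub>)"
  by (auto simp: collect_def strip_def)

lemma collect_add:
  "collect j (\<lambda>m. f m \<oplus>\<^bsub>A\<^esub> g m) = (\<lambda>\<mu> m. collect j f \<mu> m \<oplus>\<^bsub>A\<^esub> collect j g \<mu> m)"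
  by (auto simp: collect_def strip_def fun_eq_iff)

lemma collect_smult:
  "k \<in> carrier K \<Longrightarrow> collect j (\<lambda>m. k \<odot>\<^bsub>A\<^esub> f m) = (\<lambda>\<mu> m. k \<odot>\<^bsub>A\<^esub> collect j f \<mu> m)"
  by (auto simp: collect_def strip_def fun_eq_iff)

lemma collect_coeff:
  "f m = collect j f (replicate_mset (count m j) 0) (filter_mset (\<lambda>i. i \<noteq> j) m)"
proof -
  have "filter_mset (\<lambda>i. i \<noteq> j) m + replicate_mset (count m j) j = m"
    using strip_index[of j "filter_mset (\<lambda>i. i \<noteq> j) m" "count m j" m] by blast
  then show ?thesis unfolding collect_replicate strip_def by simp
qed

lemma collect_inj: "collect j f = collect j g \<Longrightarrow> f = g"
  by (rule ext) (metis collect_coeff)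

lemma collect_free:
  assumes "\<And>m. f m \<noteq> \<zero>\<^bsub>A\<^esub> \<Longrightarrow> j \<notin># m"
  shows "collect j f = pmonom (poly_ext A n) f {#}"
proof
  fix \<mu>
  have "strip j k f = (if k = 0 then f else (\<lambda>_. \<zero>\<^bsub>A\<^esub>))" for k
    using assms by (force simp: strip_def fun_eq_iff)
  then show "collect j f \<mu> = pmonom (poly_ext A n) f {#} \<mu>"
    by (auto simp: collect_def pmonom_def)
qed

lemma collect_closed:
  assumes "f \<in> carrier (poly_ext A n)"
  shows "collect j f \<in> carrier (poly_ext (poly_ext A n) 1)"
proof -
  interpret P: poisson_algebra K "poly_ext A n" by (rule poly_ext_poisson)
  show ?thesis
    using assms
  proof (induction rule: poly_induct)
    case zero
    then show ?case using P.zero_in_poly[of 1] by (simp add: collect_zero)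
  next
    case (monom a e)
    have "set_mset (replicate_mset (count e j) (0 :: nat)) \<subseteq> {..<1}" by (auto split: if_splits)
    moreover have "pmonom A a (filter_mset (\<lambda>i. i \<noteq> j) e) \<in> carrier (poly_ext A n)"
      using monom by (intro pmonom_in_poly) auto
    ultimately show ?case unfolding collect_monom[where n = n] by (rule P.pmonom_in_poly[rotated])
  next
    case (add f g)
    then show ?case using P.add_in_poly[of "collect j f" 1 "collect j g"] by (simp add: collect_add)
  qed
qed

lemma collect_ring_hom: "collect j \<in> ring_hom (poly_ext A n) (poly_ext (poly_ext A n) 1)"
proof (rule ring_hom_memI)
  interpret P: poisson_algebra K "poly_ext A n" by (rule poly_ext_poisson)
  interpret PP: poisson_algebra K "poly_ext (poly_ext A n) 1" by (rule P.poly_ext_poisson)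
  let ?P = "poly_ext A n" and ?PP = "poly_ext (poly_ext A n) 1"
  have add: "collect j (f \<oplus>\<^bsub>?P\<^esub> g) = collect j f \<oplus>\<^bsub>?PP\<^esub> collect j g" for f g
    by (simp add: collect_add)
  show "collect j f \<in> carrier ?PP" if "f \<in> carrier ?P" for f using that by (rule collect_closed)
  show "collect j (f \<oplus>\<^bsub>?P\<^esub> g) = collect j f \<oplus>\<^bsub>?PP\<^esub> collect j g" for f g by (rule add)
  show "collect j \<one>\<^bsub>?P\<^esub> = \<one>\<^bsub>?PP\<^esub>" using collect_monom[of j "\<one>\<^bsub>A\<^esub>" "{#}" n] by simp
  fix f g assume fg: "f \<in> carrier ?P" "g \<in> carrier ?P"
  show "collect j (f \<otimes>\<^bsub>?P\<^esub> g) = collect j f \<otimes>\<^bsub>?PP\<^esub> collect j g"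
  proof (rule biadditive_maps_eqI[OF fg PP.abelian_group_axioms,
        where F = "\<lambda>f g. collect j (f \<otimes>\<^bsub>?P\<^esub> g)" and F' = "\<lambda>f g. collect j f \<otimes>\<^bsub>?PP\<^esub> collect j g"])
    fix f g h assume fgh: "f \<in> carrier ?P" "g \<in> carrier ?P" "h \<in> carrier ?P"
    have eq: "(\<lambda>m. f m \<oplus>\<^bsub>A\<^esub> g m) = f \<oplus>\<^bsub>?P\<^esub> g" by simp
    show "collect j ((\<lambda>m. f m \<oplus>\<^bsub>A\<^esub> g m) \<otimes>\<^bsub>?P\<^esub> h) =
        collect j (f \<otimes>\<^bsub>?P\<^esub> h) \<oplus>\<^bsub>?PP\<^esub> collect j (g \<otimes>\<^bsub>?P\<^esub> h)"
      unfolding eq add[symmetric] using P.l_distr[OF fgh] by (simp only:)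
    show "collect j (h \<otimes>\<^bsub>?P\<^esub> (\<lambda>m. f m \<oplus>\<^bsub>A\<^esub> g m)) =
        collect j (h \<otimes>\<^bsub>?P\<^esub> f) \<oplus>\<^bsub>?PP\<^esub> collect j (h \<otimes>\<^bsub>?P\<^esub> g)"
      unfolding eq add[symmetric] using P.r_distr[OF fgh] by (simp only:)
    note cfgh = fgh[THEN collect_closed, of j]
    show "collect j (\<lambda>m. f m \<oplus>\<^bsub>A\<^esub> g m) \<otimes>\<^bsub>?PP\<^esub> collect j h =
        collect j f \<otimes>\<^bsub>?PP\<^esub> collect j h \<oplus>\<^bsub>?PP\<^esub> collect j g \<otimes>\<^bsub>?PP\<^esub> collect j h"
      unfolding eq add using PP.l_distr[OF cfgh] by (simp only:)
    show "collect j h \<otimes>\<^bsub>?PP\<^esub> collect j (\<lambda>m. f m \<oplus>\<^bsub>A\<^esub> g m) =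
        collect j h \<otimes>\<^bsub>?PP\<^esub> collect j f \<oplus>\<^bsub>?PP\<^esub> collect j h \<otimes>\<^bsub>?PP\<^esub> collect j g"
      unfolding eq add using PP.r_distr[OF cfgh] by (simp only:)
  next
    fix a b and e e' :: "nat multiset"
    assume ab: "a \<in> carrier A" "b \<in> carrier A" "set_mset e \<subseteq> {..<n}" "set_mset e' \<subseteq> {..<n}"
    let ?s = "filter_mset (\<lambda>i. i \<noteq> j)"
    have s: "pmonom A a (?s e) \<in> carrier ?P" "pmonom A b (?s e') \<in> carrier ?P"
      using ab by (auto intro!: pmonom_in_poly)
    have "collect j (pmonom A a e) \<otimes>\<^bsub>?PP\<^esub> collect j (pmonom A b e') =
        pmonom ?P (pmonom A a (?s e) \<otimes>\<^bsub>?P\<^esub> pmonom A b (?s e'))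
          (replicate_mset (count e j) 0 + replicate_mset (count e' j) 0)"
      unfolding collect_monom[where n = n] P.poly_ext_simps(4) by (rule P.mul.pconv_monom[OF s])
    also have "pmonom A a (?s e) \<otimes>\<^bsub>?P\<^esub> pmonom A b (?s e') = pmonom A (a \<otimes>\<^bsub>A\<^esub> b) (?s (e + e'))"
      using mul.pconv_monom[OF ab(1,2)] by simp
    also have "replicate_mset (count e j) 0 + replicate_mset (count e' j) 0 =
        replicate_mset (count (e + e') j) (0 :: nat)"
      by (simp add: multiset_eq_iff)
    also have "pmonom ?P (pmonom A (a \<otimes>\<^bsub>A\<^esub> b) (?s (e + e'))) \<dots> =
        collect j (pmonom A a e \<otimes>\<^bsub>?P\<^esub> pmonom A b e')"
      unfolding poly_ext_simps(4) mul.pconv_monom[OF ab(1,2)] collect_monom[where n = n] ..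
    finally show "collect j (pmonom A a e \<otimes>\<^bsub>?P\<^esub> pmonom A b e') =
        collect j (pmonom A a e) \<otimes>\<^bsub>?PP\<^esub> collect j (pmonom A b e')" by (rule sym)
  qed (use collect_closed in \<open>blast intro: P.m_closed PP.m_closed\<close>)+
qed

end

section \<open>Polynomial presentations and algebra homomorphisms\<close>

lemma (in algebra) subalgebra_closedI:
  assumes sub: "H \<subseteq> carrier M" and one: "\<one>\<^bsub>M\<^esub> \<in> H"
    and add: "\<And>a b. a \<in> H \<Longrightarrow> b \<in> H \<Longrightarrow> a \<oplus>\<^bsub>M\<^esub> b \<in> H"
    and mult: "\<And>a b. a \<in> H \<Longrightarrow> b \<in> H \<Longrightarrow> a \<otimes>\<^bsub>M\<^esub> b \<in> H"
    and smult: "\<And>k a. k \<in> carrier R \<Longrightarrow> a \<in> H \<Longrightarrow> k \<odot>\<^bsub>M\<^esub> a \<in> H"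
  shows "subring H M" and "submodule H R M"
proof -
  have minus: "\<ominus>\<^bsub>M\<^esub> a \<in> H" if "a \<in> H" for a
  proof -
    have "\<ominus>\<^bsub>M\<^esub> a = (\<ominus>\<^bsub>R\<^esub> \<one>\<^bsub>R\<^esub>) \<odot>\<^bsub>M\<^esub> a" using that sub smult_l_minus[of "\<one>\<^bsub>R\<^esub>" a] by auto
    then show ?thesis using smult[OF _ that, of "\<ominus>\<^bsub>R\<^esub> \<one>\<^bsub>R\<^esub>"] by simp
  qed
  show "subring H M" by (rule subringI) (use sub one minus mult add in auto)
  have "\<zero>\<^bsub>M\<^esub> \<in> H" using add[OF one minus[OF one]] by (simp add: r_neg)
  then show "submodule H R M" by (intro submoduleI) (use sub minus smult add in auto)
qed

lemma poly_eval_hom: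
  assumes "algebra K S" "algebra K T" and h: "h \<in> ring_hom S T"
    and smult: "\<And>k a. k \<in> carrier K \<Longrightarrow> a \<in> carrier S \<Longrightarrow> h (k \<odot>\<^bsub>S\<^esub> a) = k \<odot>\<^bsub>T\<^esub> h a"
    and p: "p \<in> ring.indexed_pset K {..<N} (carrier K)" and y: "y \<in> {..<N} \<rightarrow> carrier S"
  shows "poly_eval K T p (\<lambda>i. h (y i)) = h (poly_eval K S p y)"
proof -
  interpret S: algebra K S by fact
  interpret T: algebra K T by fact
  interpret h: ring_hom_cring S T h
    using h by (intro ring_hom_cringI S.M_cring T.M_cring ring_hom_ring.axioms) (auto intro: ring_hom_memE)
  have hom_pow: "h (a [^]\<^bsub>S\<^esub> k) = h a [^]\<^bsub>T\<^esub> k" if "a \<in> carrier S" for a and k :: nat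
    using that by (induction k) simp_all
  have p': "p m \<in> carrier K" "p m \<noteq> \<zero>\<^bsub>K\<^esub> \<Longrightarrow> set_mset m \<subseteq> {..<N}" for m
    using p by (auto simp: S.R.indexed_pset_eq)
  have monom: "(\<Otimes>\<^bsub>T\<^esub>i\<in>set_mset m. h (y i) [^]\<^bsub>T\<^esub> count m i) = h (\<Otimes>\<^bsub>S\<^esub>i\<in>set_mset m. y i [^]\<^bsub>S\<^esub> count m i)"
    and closed: "(\<Otimes>\<^bsub>S\<^esub>i\<in>set_mset m. y i [^]\<^bsub>S\<^esub> count m i) \<in> carrier S" if "p m \<noteq> \<zero>\<^bsub>K\<^esub>" for m
  proof -
    have y': "y i \<in> carrier S" if "i \<in> set_mset m" for i using p'(2)[OF \<open>p m \<noteq> _\<close>] y that by auto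
    then show "(\<Otimes>\<^bsub>S\<^esub>i\<in>set_mset m. y i [^]\<^bsub>S\<^esub> count m i) \<in> carrier S" by (intro S.finprod_closed) auto
    have "h (\<Otimes>\<^bsub>S\<^esub>i\<in>set_mset m. y i [^]\<^bsub>S\<^esub> count m i) = (\<Otimes>\<^bsub>T\<^esub>i\<in>set_mset m. (h \<circ> (\<lambda>i. y i [^]\<^bsub>S\<^esub> count m i)) i)"
      using y' by (subst h.hom_finprod) (auto simp: o_def)
    also have "\<dots> = (\<Otimes>\<^bsub>T\<^esub>i\<in>set_mset m. h (y i) [^]\<^bsub>T\<^esub> count m i)"
      using y' by (intro T.finprod_cong') (auto simp: hom_pow)
    finally show "(\<Otimes>\<^bsub>T\<^esub>i\<in>set_mset m. h (y i) [^]\<^bsub>T\<^esub> count m i) = h (\<Otimes>\<^bsub>S\<^esub>i\<in>set_mset m. y i [^]\<^bsub>S\<^esub> count m i)" by simp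
  qed
  let ?t = "\<lambda>m. p m \<odot>\<^bsub>S\<^esub> (\<Otimes>\<^bsub>S\<^esub>i\<in>set_mset m. y i [^]\<^bsub>S\<^esub> count m i)"
  have t: "?t m \<in> carrier S" if "p m \<noteq> \<zero>\<^bsub>K\<^esub>" for m using p'(1) closed[OF that] by (rule S.smult_closed)
  have "h (poly_eval K S p y) = (\<Oplus>\<^bsub>T\<^esub>m\<in>{m. p m \<noteq> \<zero>\<^bsub>K\<^esub>}. h (?t m))"
    unfolding poly_eval_def using t by (subst h.hom_finsum) (auto simp: o_def)
  also have "\<dots> = poly_eval K T p (\<lambda>i. h (y i))"
    unfolding poly_eval_def
  proof (rule T.M.finsum_cong')
    fix m assume m: "m \<in> {m. p m \<noteq> \<zero>\<^bsub>K\<^esub>}"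
    then have "p m \<noteq> \<zero>\<^bsub>K\<^esub>" by simp
    then show "h (?t m) = p m \<odot>\<^bsub>T\<^esub> (\<Otimes>\<^bsub>T\<^esub>i\<in>set_mset m. h (y i) [^]\<^bsub>T\<^esub> count m i)"
      using smult[OF p'(1) closed] monom by simp
  next
    show "(\<lambda>m. p m \<odot>\<^bsub>T\<^esub> (\<Otimes>\<^bsub>T\<^esub>i\<in>set_mset m. h (y i) [^]\<^bsub>T\<^esub> count m i)) \<in> {m. p m \<noteq> \<zero>\<^bsub>K\<^esub>} \<rightarrow> carrier T"
      using p'(1) monom closed h.hom_closed by (auto intro!: T.smult_closed)
  qed simp
  finally show ?thesis by simp
qed

lemma lin_indep_mod_one_hom:
  assumes "algebra K S" "algebra K T" and h: "h \<in> ring_hom S T" and inj: "inj_on h (carrier S)"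
    and smult: "\<And>k a. k \<in> carrier K \<Longrightarrow> a \<in> carrier S \<Longrightarrow> h (k \<odot>\<^bsub>S\<^esub> a) = k \<odot>\<^bsub>T\<^esub> h a"
    and y: "y \<in> {..<N} \<rightarrow> carrier S" and indep: "lin_indep_mod_one K S N y"
  shows "lin_indep_mod_one K T N (\<lambda>i. h (y i))"
  unfolding lin_indep_mod_one_def
proof (intro allI impI)
  interpret S: algebra K S by fact
  interpret T: algebra K T by fact
  interpret h: ring_hom_cring S T h
    using h by (intro ring_hom_cringI S.M_cring T.M_cring ring_hom_ring.axioms) (auto intro: ring_hom_memE)
  fix c i assume c: "c \<in> {..<N} \<rightarrow> carrier K" and i: "i < N"
    and "\<exists>a\<in>carrier K. (\<Oplus>\<^bsub>T\<^esub>i\<in>{..<N}. c i \<odot>\<^bsub>T\<^esub> h (y i)) = a \<odot>\<^bsub>T\<^esub> \<one>\<^bsub>T\<^esub>"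
  then obtain a where a: "a \<in> carrier K" "(\<Oplus>\<^bsub>T\<^esub>i\<in>{..<N}. c i \<odot>\<^bsub>T\<^esub> h (y i)) = a \<odot>\<^bsub>T\<^esub> \<one>\<^bsub>T\<^esub>" by blast
  have cy: "c i \<odot>\<^bsub>S\<^esub> y i \<in> carrier S" if "i < N" for i using c y that by (intro S.smult_closed) auto
  then have z: "(\<Oplus>\<^bsub>S\<^esub>i\<in>{..<N}. c i \<odot>\<^bsub>S\<^esub> y i) \<in> carrier S" by (intro S.M.finsum_closed) auto
  have "h (\<Oplus>\<^bsub>S\<^esub>i\<in>{..<N}. c i \<odot>\<^bsub>S\<^esub> y i) = (\<Oplus>\<^bsub>T\<^esub>i\<in>{..<N}. h (c i \<odot>\<^bsub>S\<^esub> y i))"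
    using cy by (subst h.hom_finsum) (auto simp: o_def)
  also have "\<dots> = (\<Oplus>\<^bsub>T\<^esub>i\<in>{..<N}. c i \<odot>\<^bsub>T\<^esub> h (y i))"
  proof (rule T.M.finsum_cong')
    show "(\<lambda>i. c i \<odot>\<^bsub>T\<^esub> h (y i)) \<in> {..<N} \<rightarrow> carrier T" using c y by (auto intro!: T.smult_closed h.hom_closed)
    show "h (c i \<odot>\<^bsub>S\<^esub> y i) = c i \<odot>\<^bsub>T\<^esub> h (y i)" if "i \<in> {..<N}" for i
      using c y that by (intro smult) auto
  qed simp
  also have "\<dots> = h (a \<odot>\<^bsub>S\<^esub> \<one>\<^bsub>S\<^esub>)" using a smult[OF a(1) S.one_closed] by simp
  finally have "(\<Oplus>\<^bsub>S\<^esub>i\<in>{..<N}. c i \<odot>\<^bsub>S\<^esub> y i) = a \<odot>\<^bsub>S\<^esub> \<one>\<^bsub>S\<^esub>"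
    using inj z a(1) by (auto dest!: inj_onD)
  then show "c i = \<zero>\<^bsub>K\<^esub>" using indep c a(1) i unfolding lin_indep_mod_one_def by blast
qed

text \<open>
  To use an algebra as a test algebra it is enough that an isomorphic copy of it is one.
\<close>
lemma (in algebra_iso) effective_against_pullback:
  assumes G: "filtration K S G" and eff: "effective_against K C N x F f T (\<lambda>i. e ` G i)"
  shows "effective_against K C N x F f S G"
  unfolding effective_against_def
proof (intro allI impI)
  interpret G: filtered_algebra K S G by unfold_locales (rule G)
  note T = target_algebra
  interpret T: algebra K T by (rule T)
  fix y assume y: "y \<in> {..<N} \<rightarrow> carrier S" and indep: "lin_indep_mod_one K S N y"
    and le: "\<forall>i<N. filt_deg F (x i) \<le> filt_deg G (y i)" and lt: "\<exists>i<N. filt_deg F (x i) < filt_deg G (y i)"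
  have inj: "inj_on e (carrier S)" using bij by (simp add: bij_betw_def)
  have deg: "filt_deg (\<lambda>i. e ` G i) (e (y i)) = filt_deg G (y i)" if "i < N" for i
    using image_filt_deg[OF G] y that by auto
  have "(\<lambda>i. e (y i)) \<in> {..<N} \<rightarrow> carrier T" using y iso_closed by auto
  moreover have "lin_indep_mod_one K T N (\<lambda>i. e (y i))"
    by (rule lin_indep_mod_one_hom[OF algebra_axioms T iso_ring_hom inj iso_smult y indep])
  ultimately obtain p where p: "p \<in> ring.indexed_pset K {..<N} (carrier K)" "poly_eval K C p x = f"
    "poly_eval K T p (\<lambda>i. e (y i)) = \<zero>\<^bsub>T\<^esub> \<or>
      filt_deg F f < filt_deg (\<lambda>i. e ` G i) (poly_eval K T p (\<lambda>i. e (y i)))"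
    using eff le lt deg unfolding effective_against_def by (metis (no_types, lifting))
  have ev: "poly_eval K T p (\<lambda>i. e (y i)) = e (poly_eval K S p y)"
    by (rule poly_eval_hom[OF algebra_axioms T iso_ring_hom iso_smult p(1) y])
  show "\<exists>p\<in>ring.indexed_pset K {..<N} (carrier K). poly_eval K C p x = f \<and>
    (poly_eval K S p y = \<zero>\<^bsub>S\<^esub> \<or> filt_deg F f < filt_deg G (poly_eval K S p y))"
  proof (cases "poly_eval K S p y \<in> carrier S")
    case True
    then have "poly_eval K S p y = \<zero>\<^bsub>S\<^esub> \<or> filt_deg F f < filt_deg G (poly_eval K S p y)"
      using p(3) iso_eq_iff[OF True M.zero_closed] image_filt_deg[OF G True] unfolding ev iso_zero[symmetric]
      by auto
    then show ?thesis using p(1,2) by blast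
  next
    case False
    have "(\<Otimes>\<^bsub>S\<^esub>i\<in>set_mset m. y i [^]\<^bsub>S\<^esub> count m i) \<in> carrier S" if "p m \<noteq> \<zero>\<^bsub>K\<^esub>" for m
      using p(1) that y by (auto simp: R.indexed_pset_eq intro!: finprod_closed nat_pow_closed)
    then have "poly_eval K S p y \<in> carrier S"
      unfolding poly_eval_def using p(1)
      by (intro M.finsum_closed) (auto simp: R.indexed_pset_eq intro!: smult_closed)
    with False show ?thesis by blast
  qed
qed

section \<open>Effective elements detect the coefficient ring\<close>

text \<open>
  The test algebra is \<open>B[s\<^sub>1, \<dots>, s\<^sub>n][u]\<close>, and the test family is the image of the generators
  under the substitution of \<open>u\<close> for a variable \<open>s\<^sub>j\<close> that occurs in one of them.
\<close>
theorem effective_image_of_constants: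
  fixes C B :: "('k, 'a) palg"
  assumes inf: "infinite (UNIV :: 'a set)"
    and C: "poisson_algebra K C" and B: "poisson_algebra K B"
    and \<phi>: "\<phi> \<in> poisson_iso K (poly_ext C n) (poly_ext B n)"
    and eff: "effective K C d \<or> poisson_effective K C d"
    and d: "\<phi> (pmonom C d {#}) = pmonom B b {#}"
    and c: "c \<in> carrier C"
  shows "\<exists>b'\<in>carrier B. \<phi> (pmonom C c {#}) = pmonom B b' {#}"
proof -
  let ?RC = "poly_ext C n" and ?R = "poly_ext B n"
  let ?T = "poly_ext ?R 1"
  interpret C: poisson_algebra K C by (rule C)
  interpret B: poisson_algebra K B by (rule B)
  interpret RC: poisson_algebra K ?RC by (rule C.poly_ext_poisson)
  interpret R: poisson_algebra K ?R by (rule B.poly_ext_poisson)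
  interpret T: poisson_algebra K ?T by (rule R.poly_ext_poisson)
  interpret iso: algebra_iso K ?RC ?R \<phi>
    by (rule poisson_iso_algebra_iso[OF RC.poisson_algebra_axioms R.poisson_algebra_axioms \<phi>])
  define \<kappa> where "\<kappa> = (\<lambda>a. \<phi> (pmonom C a {#}))"
  have \<kappa>_hom: "\<kappa> \<in> ring_hom C ?R"
    using ring_hom_trans[OF C.const_ring_hom poisson_isoD(2)[OF \<phi>]] by (simp add: \<kappa>_def o_def)
  note \<kappa> = ring_hom_memE[OF \<kappa>_hom]
  have const_closed: "pmonom C a {#} \<in> carrier ?RC" if "a \<in> carrier C" for a
    using that by (rule C.pmonom_in_poly) simp
  have \<kappa>_smult: "\<kappa> (k \<odot>\<^bsub>C\<^esub> a) = k \<odot>\<^bsub>?R\<^esub> \<kappa> a" if "k \<in> carrier K" "a \<in> carrier C" for k a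
    unfolding \<kappa>_def C.const_smult[OF that(1), where n = n]
    by (rule poisson_isoD(8)[OF \<phi> that(1) const_closed[OF that(2)]])
  have \<kappa>_inj: "\<kappa> a = \<kappa> a' \<longleftrightarrow> a = a'" if "a \<in> carrier C" "a' \<in> carrier C" for a a'
    unfolding \<kappa>_def using iso.iso_eq_iff[OF const_closed const_closed] that C.const_inj by blast

  obtain e1 :: "(nat multiset \<Rightarrow> 'a) \<Rightarrow> 'a" where "inj_on e1 (carrier ?R)"
    using B.poly_ext_inj[OF inf inj_on_id] by blast
  then obtain e :: "(nat multiset \<Rightarrow> nat multiset \<Rightarrow> 'a) \<Rightarrow> 'a" where e: "inj_on e (carrier ?T)"
    using R.poly_ext_inj[OF inf] by blast

  have dC: "d \<in> carrier C" "d \<noteq> \<zero>\<^bsub>C\<^esub>" using eff by (auto simp: effective_def poisson_effective_def)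
  have one_C: "\<one>\<^bsub>C\<^esub> \<noteq> \<zero>\<^bsub>C\<^esub>"
  proof
    assume "\<one>\<^bsub>C\<^esub> = \<zero>\<^bsub>C\<^esub>"
    then have "\<one>\<^bsub>C\<^esub> \<otimes>\<^bsub>C\<^esub> d = \<zero>\<^bsub>C\<^esub> \<otimes>\<^bsub>C\<^esub> d" by simp
    then show False using dC by simp
  qed
  have one_R: "\<one>\<^bsub>?R\<^esub> \<noteq> \<zero>\<^bsub>?R\<^esub>"
  proof
    assume "\<one>\<^bsub>?R\<^esub> = \<zero>\<^bsub>?R\<^esub>"
    then have "\<kappa> \<one>\<^bsub>C\<^esub> = \<kappa> \<zero>\<^bsub>C\<^esub>"
      using \<kappa>(4) ring_hom_zero[OF \<kappa>_hom C.ring_axioms R.ring_axioms] by metis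
    then show False using one_C \<kappa>_inj by simp
  qed
  have one_T: "\<one>\<^bsub>?T\<^esub> \<noteq> \<zero>\<^bsub>?T\<^esub>"
  proof
    assume "\<one>\<^bsub>?T\<^esub> = \<zero>\<^bsub>?T\<^esub>"
    then have "\<one>\<^bsub>?T\<^esub> {#} = \<zero>\<^bsub>?T\<^esub> {#}" by (rule fun_cong)
    then have "\<one>\<^bsub>?R\<^esub> = \<zero>\<^bsub>?R\<^esub>" unfolding R.poly_ext_simps(1,2) pmonom_def by (simp only: if_True refl)
    then show False using one_R by contradiction
  qed

  \<comment> \<open>As \<open>'a\<close> is infinite, the polynomials have a copy carried by \<open>'a\<close>, which serves as test algebra.\<close>
  have "\<exists>N x F. generating_family K C N x \<and> filtration K C F \<and> domain (gr C F) \<and>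
      (\<forall>G. filtration K ?T G \<longrightarrow> (poisson_filtration K C F \<longrightarrow> poisson_filtration K ?T G) \<longrightarrow>
        domain (gr ?T G) \<longrightarrow> effective_against K C N x F d ?T G)"
    using eff
  proof
    assume "effective K C d"
    then obtain N x F where gen: "generating_family K C N x" and F: "filtration K C F" "domain (gr C F)"
      and test: "\<And>(T :: ('k, 'a) module) G. algebra K T \<Longrightarrow> filtration K T G \<Longrightarrow> domain (gr T G) \<Longrightarrow>
        effective_against K C N x F d T G"
      unfolding effective_def by blast
    interpret tr: algebra_iso K ?T "transported_algebra e ?T" e
      by (rule transported_algebra_iso[OF T.algebra_axioms e])
    have "effective_against K C N x F d ?T G" if "filtration K ?T G" "domain (gr ?T G)" for G
      by (rule tr.effective_against_pullback[OF that(1)],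
          rule test[OF tr.target_algebra tr.image_filtration[OF that(1)] tr.image_gr_domain[OF that one_T]])
    then show ?thesis using gen F by blast
  next
    assume "poisson_effective K C d"
    then obtain N x F where gen: "generating_family K C N x" and F: "poisson_filtration K C F" "domain (gr C F)"
      and test: "\<And>(T :: ('k, 'a) palg) G. poisson_algebra K T \<Longrightarrow> poisson_filtration K T G \<Longrightarrow>
        domain (gr T G) \<Longrightarrow> effective_against K C N x F d T G"
      unfolding poisson_effective_def by blast
    have tr: "algebra_iso K ?T (transported_poisson e ?T) e"
      by (rule transported_poisson_iso[OF T.algebra_axioms e])
    interpret tr: algebra_iso K ?T "transported_poisson e ?T" e by (rule tr)
    note brk = transported_poisson_ops(7)[OF e]
    have TP: "poisson_algebra K (transported_poisson e ?T)"
      by (rule poisson_algebra_of_iso[OF T.poisson_algebra_axioms tr]) (rule brk)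
    have "effective_against K C N x F d ?T G"
      if "filtration K ?T G" "poisson_filtration K ?T G" "domain (gr ?T G)" for G
      by (rule tr.effective_against_pullback[OF that(1)], rule test[OF TP],
          rule poisson_filtration_image[OF T.poisson_algebra_axioms tr that(2)], rule brk, assumption+,
          rule tr.image_gr_domain[OF that(1,3) one_T])
    then show ?thesis using gen F unfolding poisson_filtration_def by blast
  qed
  then obtain N x F where gen: "generating_family K C N x" and F: "filtration K C F" "domain (gr C F)"
    and test: "\<And>G. filtration K ?T G \<Longrightarrow> (poisson_filtration K C F \<Longrightarrow> poisson_filtration K ?T G) \<Longrightarrow>
        domain (gr ?T G) \<Longrightarrow> effective_against K C N x F d ?T G"
    by blast
  have xC: "x \<in> {..<N} \<rightarrow> carrier C" and indep: "lin_indep_mod_one K C N x"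
    and generates: "generates_algebra K C (x ` {..<N})"
    using gen by (auto simp: generating_family_def)

  interpret FC: filtered_poisson K C F by (rule filtered_poissonI[OF C F(1)])
  define H where "H = (\<lambda>k. \<phi> ` ext_filtration C n 1 F k)"
  have H: "filtration K ?R H"
    unfolding H_def by (rule iso.image_filtration[OF FC.ext_filtration_filtration])
  have one_RC: "\<one>\<^bsub>?RC\<^esub> \<noteq> \<zero>\<^bsub>?RC\<^esub>" using one_C by (auto simp: pmonom_def fun_eq_iff)
  have H_gr: "domain (gr ?R H)"
    unfolding H_def
    by (rule iso.image_gr_domain[OF FC.ext_filtration_filtration FC.ext_filtration_gr_domain[OF F(2) one_C] one_RC])
  have H_deg: "filt_deg H (\<kappa> a) = filt_deg F a" if "a \<in> carrier C" for a
    unfolding H_def \<kappa>_def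
    using iso.image_filt_deg[OF FC.ext_filtration_filtration const_closed[OF that]] FC.filt_deg_const[OF that]
    by simp
  have H_poisson: "poisson_filtration K ?R H" if "poisson_filtration K C F"
    unfolding H_def
    by (rule poisson_filtration_image[OF RC.poisson_algebra_axioms iso.algebra_iso_axioms
          FC.ext_filtration_poisson[OF that]]) (rule poisson_isoD(9)[OF \<phi>])
  interpret FR: filtered_poisson K ?R H by (rule filtered_poissonI[OF R.poisson_algebra_axioms H])

  show ?thesis
  proof (rule ccontr)
    assume neg: "\<not> ?thesis"
    let ?const = "\<lambda>f. \<exists>b\<in>carrier B. f = pmonom B b {#}"
    \<comment> \<open>The elements with constant image form a subalgebra, so it cannot contain all generators.\<close>
    have "\<exists>i<N. \<not> ?const (\<kappa> (x i))"
    proof (rule ccontr)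
      assume all: "\<not> ?thesis"
      define S where "S = {a \<in> carrier C. ?const (\<kappa> a)}"
      have const_op: "?const (f \<oplus>\<^bsub>?R\<^esub> g)" "?const (f \<otimes>\<^bsub>?R\<^esub> g)" if "?const f" "?const g" for f g
      proof -
        obtain a b where ab: "a \<in> carrier B" "b \<in> carrier B" and f: "f = pmonom B a {#}" and g: "g = pmonom B b {#}"
          using \<open>?const f\<close> \<open>?const g\<close> by blast
        have "f \<oplus>\<^bsub>?R\<^esub> g = pmonom B (a \<oplus>\<^bsub>B\<^esub> b) {#}" "f \<otimes>\<^bsub>?R\<^esub> g = pmonom B (a \<otimes>\<^bsub>B\<^esub> b) {#}"
          unfolding f g using ring_hom_memE(2,3)[OF B.const_ring_hom ab, where n1 = n] by (simp_all only:)
        then show "?const (f \<oplus>\<^bsub>?R\<^esub> g)" "?const (f \<otimes>\<^bsub>?R\<^esub> g)" using ab by blast+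
      qed
      have S_smult: "k \<odot>\<^bsub>C\<^esub> a \<in> S" if k: "k \<in> carrier K" and a: "a \<in> S" for k a
      proof -
        obtain b where b: "b \<in> carrier B" "\<kappa> a = pmonom B b {#}" "a \<in> carrier C" using a by (auto simp: S_def)
        have "\<kappa> (k \<odot>\<^bsub>C\<^esub> a) = pmonom B (k \<odot>\<^bsub>B\<^esub> b) {#}"
          unfolding \<kappa>_smult[OF k b(3)] b(2) by (rule B.const_smult[OF k, symmetric])
        then show ?thesis using b k by (auto simp: S_def)
      qed
      have S_add: "a \<oplus>\<^bsub>C\<^esub> b \<in> S" and S_mult: "a \<otimes>\<^bsub>C\<^esub> b \<in> S" if "a \<in> S" "b \<in> S" for a b
        using that \<kappa>(2,3)[of a b] const_op[of "\<kappa> a" "\<kappa> b"] unfolding S_def by simp_all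
      have "\<one>\<^bsub>C\<^esub> \<in> S" using \<kappa>(4) by (auto simp: S_def)
      then have "subring S C" "submodule S K C"
        by (rule C.subalgebra_closedI[rotated]; use S_smult S_mult S_add in \<open>auto simp: S_def\<close>)+
      moreover have "x ` {..<N} \<subseteq> S" using all xC by (auto simp: S_def)
      ultimately have "S = carrier C" using generates by (simp add: generates_algebra_def)
      then show False using neg c by (auto simp: S_def \<kappa>_def)
    qed
    then obtain i0 where i0: "i0 < N" "\<not> ?const (\<kappa> (x i0))" by blast
    have \<kappa>x: "\<kappa> (x i) \<in> carrier ?R" if "i < N" for i using \<kappa>(1) xC that by auto
    have "\<exists>m. m \<noteq> {#} \<and> \<kappa> (x i0) m \<noteq> \<zero>\<^bsub>B\<^esub>"
    proof (rule ccontr)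
      assume neg': "\<not> ?thesis"
      have "\<kappa> (x i0) m = pmonom B (\<kappa> (x i0) {#}) {#} m" for m
        using neg' unfolding pmonom_def by (metis (full_types))
      then have "\<kappa> (x i0) = pmonom B (\<kappa> (x i0) {#}) {#}" by (rule ext)
      then show False using i0 B.poly_coeff_closed[OF \<kappa>x[OF i0(1)]] by blast
    qed
    then obtain m where m: "m \<noteq> {#}" "\<kappa> (x i0) m \<noteq> \<zero>\<^bsub>B\<^esub>" by blast
    obtain j where j: "j \<in># m" using m(1) by (rule multiset_nonemptyE)
    \<comment> \<open>The weight of the new variable exceeds the degrees of all generators.\<close>
    define W where "W = Suc (\<Sum>i<N. filt_deg F (x i))"
    define G where "G = ext_filtration ?R 1 W H"
    interpret G: filtered_algebra K ?T G
      unfolding G_def by unfold_locales (rule FR.ext_filtration_filtration)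
    define \<theta> where "\<theta> = (\<lambda>a. B.collect j (\<kappa> a))"
    have \<theta>_hom: "\<theta> \<in> ring_hom C ?T"
      using ring_hom_trans[OF \<kappa>_hom B.collect_ring_hom] by (simp add: \<theta>_def o_def)
    have \<theta>_closed: "\<theta> a \<in> carrier ?T" if "a \<in> carrier C" for a using ring_hom_memE(1)[OF \<theta>_hom that] .
    have \<theta>_smult: "\<theta> (k \<odot>\<^bsub>C\<^esub> a) = k \<odot>\<^bsub>?T\<^esub> \<theta> a" if "k \<in> carrier K" "a \<in> carrier C" for k a
      unfolding \<theta>_def \<kappa>_smult[OF that] using B.collect_smult[OF that(1)] by simp
    have \<theta>_inj: "inj_on \<theta> (carrier C)"
      unfolding \<theta>_def using \<kappa>_inj B.collect_inj by (intro inj_onI) blast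
    \<comment> \<open>Elements whose image is free of the \<open>j\<close>-th variable keep their degree; the others reach the
      weight of the new variable.\<close>
    have deg_free: "filt_deg G (\<theta> a) = filt_deg F a"
      if "a \<in> carrier C" "\<And>m. \<kappa> a m \<noteq> \<zero>\<^bsub>B\<^esub> \<Longrightarrow> j \<notin># m" for a
    proof -
      have "\<theta> a = pmonom ?R (\<kappa> a) {#}"
        unfolding \<theta>_def by (rule B.collect_free) (rule that(2))
      then show ?thesis
        unfolding G_def using FR.filt_deg_const[OF \<kappa>(1)[OF that(1)]] H_deg[OF that(1)] by (simp only:)
    qed
    have deg_large: "W \<le> filt_deg G (\<theta> a)"
      if "a \<in> carrier C" "\<kappa> a m \<noteq> \<zero>\<^bsub>B\<^esub>" "j \<in># m" for a m
    proof -
      let ?\<mu> = "replicate_mset (count m j) (0 :: nat)"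
      have "\<theta> a ?\<mu> (filter_mset (\<lambda>i. i \<noteq> j) m) \<noteq> \<zero>\<^bsub>B\<^esub>"
        using that(2) B.collect_coeff[of "\<kappa> a" m j] by (simp add: \<theta>_def)
      then have "\<theta> a ?\<mu> \<noteq> \<zero>\<^bsub>?R\<^esub>" by auto
      then have "W * size ?\<mu> \<le> filt_deg G (\<theta> a)"
        using FR.ext_filtrationD[of "\<theta> a" 1 W "filt_deg G (\<theta> a)" ?\<mu>] G.filt_deg_mem[OF \<theta>_closed[OF that(1)]]
        unfolding G_def by blast
      moreover have "1 \<le> size ?\<mu>" using that(3) by (simp add: Suc_le_eq)
      ultimately show ?thesis by (metis mult.right_neutral mult_le_mono2 order_trans)
    qed
    have degF: "filt_deg F (x i) < W" if "i < N" for i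
      using member_le_sum[of i "{..<N}" "\<lambda>i. filt_deg F (x i)"] that by (simp add: W_def)
    have "effective_against K C N x F d ?T G"
      unfolding G_def
      by (rule test[OF FR.ext_filtration_filtration FR.ext_filtration_poisson[OF H_poisson]
            FR.ext_filtration_gr_domain[OF H_gr one_R]])
    moreover have "(\<lambda>i. \<theta> (x i)) \<in> {..<N} \<rightarrow> carrier ?T" using \<theta>_closed xC by auto
    moreover have "lin_indep_mod_one K ?T N (\<lambda>i. \<theta> (x i))"
      by (rule lin_indep_mod_one_hom[OF C.algebra_axioms T.algebra_axioms \<theta>_hom \<theta>_inj \<theta>_smult xC indep])
    moreover have "\<forall>i<N. filt_deg F (x i) \<le> filt_deg G (\<theta> (x i))"
    proof (intro allI impI)
      fix i assume i: "i < N"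
      then have xi: "x i \<in> carrier C" using xC by auto
      show "filt_deg F (x i) \<le> filt_deg G (\<theta> (x i))"
      proof (cases "\<forall>m. \<kappa> (x i) m \<noteq> \<zero>\<^bsub>B\<^esub> \<longrightarrow> j \<notin># m")
        case True
        then show ?thesis using deg_free[OF xi] by simp
      next
        case False
        then show ?thesis using deg_large[OF xi] degF[OF i] by force
      qed
    qed
    moreover have "x i0 \<in> carrier C" using xC i0(1) by auto
    then have "filt_deg F (x i0) < filt_deg G (\<theta> (x i0))"
      using deg_large[OF _ m(2) j] degF[OF i0(1)] by force
    then have "\<exists>i<N. filt_deg F (x i) < filt_deg G (\<theta> (x i))" using i0(1) by blast
    ultimately obtain p where p: "p \<in> ring.indexed_pset K {..<N} (carrier K)" "poly_eval K C p x = d"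
      and ineq: "poly_eval K ?T p (\<lambda>i. \<theta> (x i)) = \<zero>\<^bsub>?T\<^esub> \<or>
        filt_deg F d < filt_deg G (poly_eval K ?T p (\<lambda>i. \<theta> (x i)))"
      unfolding effective_against_def by blast
    have "poly_eval K ?T p (\<lambda>i. \<theta> (x i)) = \<theta> d"
      using poly_eval_hom[OF C.algebra_axioms T.algebra_axioms \<theta>_hom \<theta>_smult p(1) xC] p(2) by simp
    moreover have "\<theta> d \<noteq> \<zero>\<^bsub>?T\<^esub>"
      using ring_hom_zero[OF \<theta>_hom C.ring_axioms T.ring_axioms] \<theta>_inj dC by (metis C.zero_closed inj_onD)
    moreover have "filt_deg G (\<theta> d) = filt_deg F d"
      using dC(1) d by (intro deg_free) (auto simp: \<kappa>_def pmonom_def split: if_splits)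
    ultimately show False using ineq by simp
  qed
qed

section \<open>A transcendence degree argument\<close>

text \<open>
  Fraction free elimination: a pivot in column \<open>j\<close> removes one column and one row.
\<close>
lemma (in domain) linear_dependence:
  assumes "finite J" "finite I" "card J < card I" "\<And>i j. i \<in> I \<Longrightarrow> j \<in> J \<Longrightarrow> M i j \<in> carrier R"
  shows "\<exists>c. (\<forall>i\<in>I. c i \<in> carrier R) \<and> (\<exists>i\<in>I. c i \<noteq> \<zero>) \<and> (\<forall>j\<in>J. (\<Oplus>i\<in>I. c i \<otimes> M i j) = \<zero>)"
  using assms
proof (induction J arbitrary: I M rule: finite_induct)
  case empty
  then have "I \<noteq> {}" by auto
  then show ?case by (intro exI[of _ "\<lambda>_. \<one>"]) auto
next
  case (insert j J)
  show ?case
  proof (cases "\<forall>i\<in>I. M i j = \<zero>")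
    case True
    have "card J < card I" using insert by simp
    then obtain c where c: "\<forall>i\<in>I. c i \<in> carrier R" "\<exists>i\<in>I. c i \<noteq> \<zero>"
      "\<forall>k\<in>J. (\<Oplus>i\<in>I. c i \<otimes> M i k) = \<zero>"
      using insert.IH[of I M] insert.prems by blast
    have "(\<Oplus>i\<in>I. c i \<otimes> M i j) = \<zero>"
      by (rule add.finprod_one_eqI) (use True c(1) in auto)
    then show ?thesis using c by blast
  next
    case False
    then obtain i0 where i0: "i0 \<in> I" "M i0 j \<noteq> \<zero>" by blast
    define p where "p = M i0 j"
    define I' where "I' = I - {i0}"
    define M' where "M' = (\<lambda>i k. p \<otimes> M i k \<ominus> M i j \<otimes> M i0 k)"
    have p: "p \<in> carrier R" "p \<noteq> \<zero>" using i0 insert.prems by (auto simp: p_def)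
    have I: "I = insert i0 I'" "i0 \<notin> I'" "finite I'" using i0 insert.prems by (auto simp: I'_def)
    have M: "M i k \<in> carrier R" if "i \<in> I" "k \<in> insert j J" for i k using insert.prems that by blast
    have "card J < card I'" using insert.prems insert.hyps I by (simp add: card_insert_if)
    moreover have "M' i k \<in> carrier R" if "i \<in> I'" "k \<in> J" for i k
      unfolding M'_def using that p M I by simp
    ultimately obtain c where c: "\<forall>i\<in>I'. c i \<in> carrier R" "\<exists>i\<in>I'. c i \<noteq> \<zero>"
      "\<forall>k\<in>J. (\<Oplus>i\<in>I'. c i \<otimes> M' i k) = \<zero>"
      using insert.IH[of I' M'] I(3) by blast
    define s where "s = (\<Oplus>i\<in>I'. c i \<otimes> M i j)"
    have s: "s \<in> carrier R" unfolding s_def using c(1) M I(1) by (intro finsum_closed) auto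
    define c' where "c' = (\<lambda>i. if i = i0 then \<ominus> s else p \<otimes> c i)"
    have c': "c' i0 = \<ominus> s" "\<And>i. i \<in> I' \<Longrightarrow> c' i = p \<otimes> c i" using I(2) by (auto simp: c'_def)
    have "(\<Oplus>i\<in>I. c' i \<otimes> M i k) = \<zero>" if k: "k \<in> insert j J" for k
    proof -
      have cM: "c i \<in> carrier R" "M i k \<in> carrier R" "M i j \<in> carrier R" if "i \<in> I'" for i
        using c(1) M k that I(1) by auto
      have M0: "M i0 k \<in> carrier R" using M k i0 by blast
      have t: "(\<lambda>i. c' i \<otimes> M i k) \<in> I' \<rightarrow> carrier R" using cM c'(2) p by auto
      have eq: "c' i \<otimes> M i k = c i \<otimes> M' i k \<oplus> c i \<otimes> M i j \<otimes> M i0 k" if "i \<in> I'" for i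
        unfolding c'(2)[OF that] M'_def using cM[OF that] M0 p(1) by algebra
      have M'c: "M' i k \<in> carrier R" if "i \<in> I'" for i unfolding M'_def using cM[OF that] M0 p(1) by simp
      have "(\<Oplus>i\<in>I'. c' i \<otimes> M i k) = (\<Oplus>i\<in>I'. c i \<otimes> M' i k \<oplus> c i \<otimes> M i j \<otimes> M i0 k)"
        by (rule finsum_cong') (use eq cM M0 M'c in auto)
      also have "\<dots> = (\<Oplus>i\<in>I'. c i \<otimes> M' i k) \<oplus> (\<Oplus>i\<in>I'. c i \<otimes> M i j \<otimes> M i0 k)"
        by (rule finsum_addf) (use cM M0 M'c in auto)
      also have "(\<Oplus>i\<in>I'. c i \<otimes> M i j \<otimes> M i0 k) = s \<otimes> M i0 k"
        unfolding s_def by (rule finsum_ldistr[symmetric]) (use I cM M0 in auto)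
      also have "(\<Oplus>i\<in>I'. c i \<otimes> M' i k) = \<zero>"
      proof (cases "k = j")
        case True
        have "M' i k = \<zero>" if "i \<in> I'" for i
          unfolding M'_def True p_def using cM[OF that] M0 True by (simp add: m_comm a_minus_def r_neg)
        then show ?thesis using cM by (intro add.finprod_one_eqI) auto
      qed (use c(3) k in blast)
      finally have "(\<Oplus>i\<in>I'. c' i \<otimes> M i k) = s \<otimes> M i0 k" using s M0 by simp
      moreover have "(\<Oplus>i\<in>I. c' i \<otimes> M i k) = c' i0 \<otimes> M i0 k \<oplus> (\<Oplus>i\<in>I'. c' i \<otimes> M i k)"
        unfolding I(1) by (rule finsum_insert[OF I(3,2) t]) (use c'(1) s M0 in simp)
      ultimately show ?thesis using s M0 by (simp add: c'(1) l_minus l_neg)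
    qed
    moreover have "\<forall>i\<in>I. c' i \<in> carrier R" using c(1) p s I by (auto simp: c'_def)
    moreover have "\<exists>i\<in>I. c' i \<noteq> \<zero>"
    proof -
      obtain i where i: "i \<in> I'" "c i \<noteq> \<zero>" using c(2) by blast
      then have "p \<otimes> c i \<noteq> \<zero>" using c(1) p integral[of p "c i"] by auto
      then have "c' i \<noteq> \<zero>" using c'(2)[OF i(1)] by simp
      then show ?thesis using i I by blast
    qed
    ultimately show ?thesis by blast
  qed
qed

definition exponents :: "nat \<Rightarrow> (nat \<Rightarrow> nat) \<Rightarrow> nat multiset"
  where "exponents n f = (\<Sum>i<n. replicate_mset (f i) i)"

lemma count_exponents: "i < n \<Longrightarrow> count (exponents n f) i = f i"
  by (simp add: exponents_def count_sum)

lemma set_exponents: "set_mset (exponents n f) \<subseteq> {..<n}"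
  by (auto simp: exponents_def set_mset_sum split: if_splits)

lemma size_exponents: "size (exponents n f) = (\<Sum>i<n. f i)"
  by (simp add: exponents_def size_multiset_sum)

lemma card_bounded_monomials:
  "finite {m :: nat multiset. set_mset m \<subseteq> {..<n} \<and> size m \<le> L} \<and>
   card {m :: nat multiset. set_mset m \<subseteq> {..<n} \<and> size m \<le> L} \<le> Suc L ^ n"
proof -
  let ?J = "{m :: nat multiset. set_mset m \<subseteq> {..<n} \<and> size m \<le> L}"
  let ?g = "\<lambda>m. restrict (count m) {..<n}"
  have inj: "inj_on ?g ?J"
  proof (rule inj_onI)
    fix m m' assume m: "m \<in> ?J" "m' \<in> ?J" "?g m = ?g m'"
    show "m = m'"
    proof (rule multiset_eqI)
      fix i
      show "count m i = count m' i"
      proof (cases "i < n")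
        case True
        then show ?thesis using fun_cong[OF m(3), of i] by simp
      next
        case False
        then have "i \<notin># m" "i \<notin># m'" using m by auto
        then show ?thesis by (simp add: not_in_iff)
      qed
    qed
  qed
  have "count m i \<le> L" if "m \<in> ?J" for m i
    using that count_le_size[of m i] by simp
  then have sub: "?g ` ?J \<subseteq> PiE {..<n} (\<lambda>_. {..L})" by (intro image_subsetI) (simp add: restrict_PiE_iff)
  have fin: "finite (PiE {..<n} (\<lambda>_. {..L}))" by (intro finite_PiE) auto
  have "card ?J = card (?g ` ?J)" using inj by (simp add: card_image)
  also have "\<dots> \<le> card (PiE {..<n} (\<lambda>_. {..L}))" by (rule card_mono[OF fin sub])
  also have "\<dots> = Suc L ^ n" by (simp add: card_PiE)
  finally show ?thesis using finite_imageD[OF finite_subset[OF sub fin] inj] by blast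
qed

text \<open>
  For the count of monomials below: it bounds the monomials of one polynomial ring that can occur
  in a monomial of another one.
\<close>
lemma (in poisson_algebra) power_monomial_in_filtration:
  assumes S: "filtered_algebra K S G" and \<psi>: "\<psi> \<in> ring_hom (poly_ext A n) S" and one: "\<one>\<^bsub>S\<^esub> \<in> G 0"
    and b: "b \<in> carrier A" "\<psi> (pmonom A b {#}) \<in> G q"
    and vars: "\<And>i. i < n \<Longrightarrow> \<psi> (pmonom A \<one>\<^bsub>A\<^esub> {#i#}) \<in> G q"
    and e: "set_mset e \<subseteq> {..<n}"
  shows "\<psi> (pmonom A (b [^]\<^bsub>A\<^esub> (k :: nat)) e) \<in> G (q * (k + size e))"
  using e
proof (induction e)
  case empty
  interpret S: filtered_algebra K S G by (rule S)
  show ?case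
  proof (induction k)
    case 0
    then show ?case using ring_hom_memE(4)[OF \<psi>] one by simp
  next
    case (Suc k)
    have "pmonom A (b [^]\<^bsub>A\<^esub> Suc k) {#} = pmonom A (b [^]\<^bsub>A\<^esub> k) {#} \<otimes>\<^bsub>poly_ext A n\<^esub> pmonom A b {#}"
      using mul.pconv_monom[of "b [^]\<^bsub>A\<^esub> k" b "{#} :: nat multiset" "{#}"] b(1) by simp
    then have "\<psi> (pmonom A (b [^]\<^bsub>A\<^esub> Suc k) {#}) = \<psi> (pmonom A (b [^]\<^bsub>A\<^esub> k) {#}) \<otimes>\<^bsub>S\<^esub> \<psi> (pmonom A b {#})"
      using ring_hom_memE(2)[OF \<psi>, of "pmonom A (b [^]\<^bsub>A\<^esub> k) {#}" "pmonom A b {#}"] b(1) by simp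
    then show ?case using S.F_mult[OF Suc b(2)] by (simp add: algebra_simps)
  qed
next
  case (add i e)
  interpret S: filtered_algebra K S G by (rule S)
  have i: "i < n" and e: "set_mset e \<subseteq> {..<n}" using add.prems by auto
  have "pmonom A (b [^]\<^bsub>A\<^esub> k) (add_mset i e) =
      pmonom A \<one>\<^bsub>A\<^esub> {#i#} \<otimes>\<^bsub>poly_ext A n\<^esub> pmonom A (b [^]\<^bsub>A\<^esub> k) e"
    using mul.pconv_monom[of "\<one>\<^bsub>A\<^esub>" "b [^]\<^bsub>A\<^esub> k" "{#i#}" e] b(1) by simp
  then have "\<psi> (pmonom A (b [^]\<^bsub>A\<^esub> k) (add_mset i e)) =
      \<psi> (pmonom A \<one>\<^bsub>A\<^esub> {#i#}) \<otimes>\<^bsub>S\<^esub> \<psi> (pmonom A (b [^]\<^bsub>A\<^esub> k) e)"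
    using ring_hom_memE(2)[OF \<psi>, of "pmonom A \<one>\<^bsub>A\<^esub> {#i#}" "pmonom A (b [^]\<^bsub>A\<^esub> k) e"] b(1) i e by simp
  then show ?case using S.F_mult[OF vars[OF i] add.IH[OF e]] by (simp add: algebra_simps)
qed

text \<open>
  An element that is killed by a retraction of \<open>B\<close> onto \<open>C\<close> is transcendental over \<open>C\<close>: the
  retraction kills all terms of a relation except the constant one, so the latter is
  zero, and the rest of the relation can be divided by \<open>b\<close>.
\<close>
lemma power_relation_trivial:
  fixes k M :: nat
  assumes C: "cring C" and B: "domain B" and \<iota>: "\<iota> \<in> ring_hom C B" and \<rho>: "\<rho> \<in> ring_hom B C"
    and \<rho>\<iota>: "\<And>a. a \<in> carrier C \<Longrightarrow> \<rho> (\<iota> a) = a"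
    and b: "b \<in> carrier B" "b \<noteq> \<zero>\<^bsub>B\<^esub>" "\<rho> b = \<zero>\<^bsub>C\<^esub>"
    and c: "\<And>k. k \<le> M \<Longrightarrow> c k \<in> carrier C"
    and rel: "(\<Oplus>\<^bsub>B\<^esub>k\<in>{..M}. \<iota> (c k) \<otimes>\<^bsub>B\<^esub> b [^]\<^bsub>B\<^esub> k) = \<zero>\<^bsub>B\<^esub>"
  shows "k \<le> M \<Longrightarrow> c k = \<zero>\<^bsub>C\<^esub>"
  using c rel
proof (induction M arbitrary: c k)
  case 0
  interpret C: cring C by (rule C)
  interpret B: "domain" B by (rule B)
  have "\<iota> (c 0) = \<zero>\<^bsub>B\<^esub>" using 0 ring_hom_memE(1)[OF \<iota>, of "c 0"] by simp
  then show ?case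
    using 0 \<rho>\<iota>[of "c 0"] ring_hom_zero[OF \<rho> B.ring_axioms C.ring_axioms] by simp
next
  case (Suc M)
  interpret C: cring C by (rule C)
  interpret B: "domain" B by (rule B)
  note \<iota>' = ring_hom_memE[OF \<iota>] and \<rho>' = ring_hom_memE[OF \<rho>]
  let ?s = "\<Oplus>\<^bsub>B\<^esub>k\<in>{..M}. \<iota> (c (Suc k)) \<otimes>\<^bsub>B\<^esub> b [^]\<^bsub>B\<^esub> k"
  have ic: "\<iota> (c k) \<in> carrier B" if "k \<le> Suc M" for k using Suc.prems(2)[OF that] by (rule \<iota>'(1))
  have s: "?s \<in> carrier B" using ic b(1) by (intro B.finsum_closed) auto
  have "(\<Oplus>\<^bsub>B\<^esub>k\<in>{..Suc M}. \<iota> (c k) \<otimes>\<^bsub>B\<^esub> b [^]\<^bsub>B\<^esub> k) =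
      (\<Oplus>\<^bsub>B\<^esub>k\<in>{..M}. \<iota> (c (Suc k)) \<otimes>\<^bsub>B\<^esub> b [^]\<^bsub>B\<^esub> Suc k) \<oplus>\<^bsub>B\<^esub> \<iota> (c 0) \<otimes>\<^bsub>B\<^esub> b [^]\<^bsub>B\<^esub> (0 :: nat)"
    by (rule B.finsum_Suc2) (use ic b(1) in auto)
  also have "(\<Oplus>\<^bsub>B\<^esub>k\<in>{..M}. \<iota> (c (Suc k)) \<otimes>\<^bsub>B\<^esub> b [^]\<^bsub>B\<^esub> Suc k) =
      (\<Oplus>\<^bsub>B\<^esub>k\<in>{..M}. (\<iota> (c (Suc k)) \<otimes>\<^bsub>B\<^esub> b [^]\<^bsub>B\<^esub> k) \<otimes>\<^bsub>B\<^esub> b)"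
    by (rule B.finsum_cong') (use ic b(1) in \<open>auto simp: B.m_assoc\<close>)
  also have "\<dots> = ?s \<otimes>\<^bsub>B\<^esub> b" by (rule B.finsum_ldistr[symmetric]) (use ic b(1) in auto)
  also have "\<iota> (c 0) \<otimes>\<^bsub>B\<^esub> b [^]\<^bsub>B\<^esub> (0 :: nat) = \<iota> (c 0)" using ic[of 0] by simp
  finally have sum: "?s \<otimes>\<^bsub>B\<^esub> b \<oplus>\<^bsub>B\<^esub> \<iota> (c 0) = \<zero>\<^bsub>B\<^esub>" using Suc.prems(3) by simp
  have "\<rho> (?s \<otimes>\<^bsub>B\<^esub> b \<oplus>\<^bsub>B\<^esub> \<iota> (c 0)) = c 0"
    using s b ic[of 0] \<rho>'(1,2,3) \<rho>\<iota>[of "c 0"] Suc.prems(2)[of 0] by simp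
  then have c0: "c 0 = \<zero>\<^bsub>C\<^esub>" using sum ring_hom_zero[OF \<rho> B.ring_axioms C.ring_axioms] by simp
  then have "\<iota> (c 0) = \<zero>\<^bsub>B\<^esub>" using ring_hom_zero[OF \<iota> C.ring_axioms B.ring_axioms] by simp
  then have "?s \<otimes>\<^bsub>B\<^esub> b = \<zero>\<^bsub>B\<^esub>" using sum s b(1) by simp
  then have "?s = \<zero>\<^bsub>B\<^esub>" using B.integral s b by blast
  then have "c (Suc k) = \<zero>\<^bsub>C\<^esub>" if "k \<le> M" for k
    using Suc.IH[of k "\<lambda>k. c (Suc k)"] Suc.prems(2) that by simp
  then show ?case using c0 Suc.prems(1) by (cases k) auto
qed

text \<open>
  \<open>B\<close> embeds into \<open>B[s\<^sub>1, \<dots>, s\<^sub>n]\<close>, which is isomorphic to a polynomial ring over a domain.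
\<close>
lemma domain_coefficients:
  assumes C: "poisson_algebra K C" and B: "poisson_algebra K B" and dom: "domain C"
    and \<phi>: "\<phi> \<in> poisson_iso K (poly_ext C n) (poly_ext B n)"
  shows "domain B"
proof -
  interpret C: poisson_algebra K C by (rule C)
  interpret B: poisson_algebra K B by (rule B)
  let ?RC = "poly_ext C n" and ?RB = "poly_ext B n"
  interpret RC: poisson_algebra K ?RC by (rule C.poly_ext_poisson)
  interpret RB: poisson_algebra K ?RB by (rule B.poly_ext_poisson)
  interpret D: "domain" ?RC by (rule C.poly_domain[OF dom])
  let ?\<psi> = "inv_into (carrier ?RC) \<phi>"
  have \<psi>: "?\<psi> \<in> poisson_iso K ?RB ?RC" by (rule poisson_iso_inverse[OF RC.poisson_algebra_axioms \<phi>])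
  interpret \<psi>: algebra_iso K ?RB ?RC ?\<psi>
    by (rule poisson_iso_algebra_iso[OF RB.poisson_algebra_axioms RC.poisson_algebra_axioms \<psi>])
  define \<kappa> where "\<kappa> = (\<lambda>b. ?\<psi> (pmonom B b {#}))"
  have \<kappa>: "\<kappa> \<in> ring_hom B ?RC"
    using ring_hom_trans[OF B.const_ring_hom \<psi>.iso_ring_hom] by (simp add: \<kappa>_def o_def)
  note zero = ring_hom_zero[OF \<kappa> B.ring_axioms RC.ring_axioms]
  have inj: "\<kappa> a = \<kappa> b \<longleftrightarrow> a = b" if "a \<in> carrier B" "b \<in> carrier B" for a b
    unfolding \<kappa>_def using that by (subst \<psi>.iso_eq_iff) (simp_all add: B.const_inj)
  show ?thesis
  proof (rule domainI[OF B.M_cring])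
    show "\<one>\<^bsub>B\<^esub> \<noteq> \<zero>\<^bsub>B\<^esub>" using D.one_not_zero zero ring_hom_memE(4)[OF \<kappa>] by metis
    fix a b assume ab: "a \<otimes>\<^bsub>B\<^esub> b = \<zero>\<^bsub>B\<^esub>" "a \<in> carrier B" "b \<in> carrier B"
    then have "\<kappa> a \<otimes>\<^bsub>?RC\<^esub> \<kappa> b = \<zero>\<^bsub>?RC\<^esub>" using ring_hom_memE(2)[OF \<kappa> ab(2,3)] zero by simp
    then have "\<kappa> a = \<zero>\<^bsub>?RC\<^esub> \<or> \<kappa> b = \<zero>\<^bsub>?RC\<^esub>"
      using D.integral ring_hom_memE(1)[OF \<kappa>] ab(2,3) by blast
    then show "a = \<zero>\<^bsub>B\<^esub> \<or> b = \<zero>\<^bsub>B\<^esub>" using inj ab(2,3) zero B.zero_closed by metis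
  qed
qed

text \<open>
  Taking constant terms in \<open>C[t\<^sub>1, \<dots>, t\<^sub>n]\<close> defines a retraction \<open>\<rho>\<close> of \<open>B\<close> onto \<open>C\<close>. An element of \<open>B\<close>
  outside of the image \<open>\<iota>\<close> of \<open>C\<close> yields a nonzero \<open>b0\<close> in the kernel of \<open>\<rho>\<close>, and then the
  elements \<open>b0\<close>, \<open>s\<^sub>1\<close>, \<dots>, \<open>s\<^sub>n\<close> would be algebraically independent over \<open>C\<close>. A count of
  monomials, based on \<open>linear_dependence\<close>, shows that they are not.
\<close>
theorem constants_surjective:
  assumes C: "poisson_algebra K C" and B: "poisson_algebra K B" and dom: "domain C"
    and \<phi>: "\<phi> \<in> poisson_iso K (poly_ext C n) (poly_ext B n)"
    and const: "\<And>c. c \<in> carrier C \<Longrightarrow> \<exists>b\<in>carrier B. \<phi> (pmonom C c {#}) = pmonom B b {#}"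
    and b: "b \<in> carrier B"
  shows "\<exists>c\<in>carrier C. \<phi> (pmonom C c {#}) = pmonom B b {#}"
proof -
  interpret C: poisson_algebra K C by (rule C)
  interpret B: poisson_algebra K B by (rule B)
  let ?RC = "poly_ext C n" and ?RB = "poly_ext B n"
  interpret RC: poisson_algebra K ?RC by (rule C.poly_ext_poisson)
  interpret RB: poisson_algebra K ?RB by (rule B.poly_ext_poisson)
  interpret D: "domain" C by (rule dom)
  interpret DB: "domain" B by (rule domain_coefficients[OF C B dom \<phi>])
  define \<psi> where "\<psi> = inv_into (carrier ?RC) \<phi>"
  have \<psi>: "\<psi> \<in> poisson_iso K ?RB ?RC"
    unfolding \<psi>_def by (rule poisson_iso_inverse[OF RC.poisson_algebra_axioms \<phi>])
  have \<phi>_hom: "\<phi> \<in> ring_hom ?RC ?RB" by (rule poisson_isoD(2)[OF \<phi>])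
  have \<psi>_hom: "\<psi> \<in> ring_hom ?RB ?RC" by (rule poisson_isoD(2)[OF \<psi>])
  have \<psi>\<phi>: "\<psi> (\<phi> f) = f" if "f \<in> carrier ?RC" for f
    unfolding \<psi>_def by (rule bij_betw_inv_into_left[OF poisson_isoD(3)[OF \<phi>] that])
  have \<phi>\<psi>: "\<phi> (\<psi> g) = g" if "g \<in> carrier ?RB" for g
    unfolding \<psi>_def by (rule bij_betw_inv_into_right[OF poisson_isoD(3)[OF \<phi>] that])
  have constC: "pmonom C c {#} \<in> carrier ?RC" if "c \<in> carrier C" for c
    using that by (rule C.pmonom_in_poly) simp
  have constB: "pmonom B c {#} \<in> carrier ?RB" if "c \<in> carrier B" for c
    using that by (rule B.pmonom_in_poly) simp
  define \<iota> where "\<iota> = (\<lambda>c. \<phi> (pmonom C c {#}) {#})"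
  define \<rho> where "\<rho> = (\<lambda>b. \<psi> (pmonom B b {#}) {#})"
  have \<iota>: "\<iota> \<in> ring_hom C B"
    using ring_hom_trans[OF ring_hom_trans[OF C.const_ring_hom \<phi>_hom] B.const_term_ring_hom]
    by (simp add: \<iota>_def o_def)
  have \<rho>: "\<rho> \<in> ring_hom B C"
    using ring_hom_trans[OF ring_hom_trans[OF B.const_ring_hom \<psi>_hom] C.const_term_ring_hom]
    by (simp add: \<rho>_def o_def)
  have \<phi>_const: "\<phi> (pmonom C c {#}) = pmonom B (\<iota> c) {#}" if "c \<in> carrier C" for c
    using const[OF that] by (auto simp: \<iota>_def pmonom_def)
  have \<rho>\<iota>: "\<rho> (\<iota> c) = c" if "c \<in> carrier C" for c
    unfolding \<rho>_def \<phi>_const[OF that, symmetric] \<psi>\<phi>[OF constC[OF that]] by (simp add: pmonom_def)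
  define b0 where "b0 = b \<ominus>\<^bsub>B\<^esub> \<iota> (\<rho> b)"
  have \<rho>b: "\<rho> b \<in> carrier C" using ring_hom_memE(1)[OF \<rho> b] .
  have \<iota>\<rho>b: "\<iota> (\<rho> b) \<in> carrier B" using ring_hom_memE(1)[OF \<iota> \<rho>b] .
  have b0: "b0 \<in> carrier B" using b \<iota>\<rho>b by (simp add: b0_def)
  have b_eq: "b = b0 \<oplus>\<^bsub>B\<^esub> \<iota> (\<rho> b)" using b \<iota>\<rho>b by (simp add: b0_def a_minus_def B.a_assoc B.l_neg)
  have \<rho>_eq: "\<rho> b = \<rho> b0 \<oplus>\<^bsub>C\<^esub> \<rho> b"
    by (rule trans[OF arg_cong[OF b_eq, of \<rho>]])
      (simp only: ring_hom_memE(3)[OF \<rho> b0 \<iota>\<rho>b] \<rho>\<iota>[OF \<rho>b])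
  have "\<rho> b0 = (\<rho> b0 \<oplus>\<^bsub>C\<^esub> \<rho> b) \<ominus>\<^bsub>C\<^esub> \<rho> b"
    using ring_hom_memE(1)[OF \<rho> b0] \<rho>b by (simp add: a_minus_def C.a_assoc C.r_neg)
  also have "\<dots> = \<zero>\<^bsub>C\<^esub>"
    unfolding \<rho>_eq[symmetric] using \<rho>b by (simp add: a_minus_def C.r_neg)
  finally have \<rho>b0: "\<rho> b0 = \<zero>\<^bsub>C\<^esub>" .
  have "b0 = \<zero>\<^bsub>B\<^esub>"
  proof (rule ccontr)
    assume nz: "b0 \<noteq> \<zero>\<^bsub>B\<^esub>"
    let ?G = "ext_filtration C n 1 (\<lambda>_. carrier C)"
    have G: "filtered_algebra K ?RC ?G" by (rule C.poly_degree_filtration[OF dom])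
    interpret G: filtered_algebra K ?RC ?G by (rule G)
    define q where "q = filt_deg ?G (\<psi> (pmonom B b0 {#})) +
      (\<Sum>i<n. filt_deg ?G (\<psi> (pmonom B \<one>\<^bsub>B\<^esub> {#i#})))"
    have G_mem: "f \<in> ?G q" if "f \<in> carrier ?RC" "filt_deg ?G f \<le> q" for f
      using G.filt_deg_le_iff[OF that(1)] that(2) by blast
    have b0G: "\<psi> (pmonom B b0 {#}) \<in> ?G q"
      by (rule G_mem[OF poisson_isoD(4)[OF \<psi> constB[OF b0]]]) (simp add: q_def)
    have varG: "\<psi> (pmonom B \<one>\<^bsub>B\<^esub> {#i#}) \<in> ?G q" if i: "i < n" for i
    proof (rule G_mem)
      show "\<psi> (pmonom B \<one>\<^bsub>B\<^esub> {#i#}) \<in> carrier ?RC"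
        using i by (intro poisson_isoD(4)[OF \<psi>] B.pmonom_in_poly) auto
      show "filt_deg ?G (\<psi> (pmonom B \<one>\<^bsub>B\<^esub> {#i#})) \<le> q"
        using member_le_sum[of i "{..<n}" "\<lambda>i. filt_deg ?G (\<psi> (pmonom B \<one>\<^bsub>B\<^esub> {#i#}))"] i
        by (simp add: q_def)
    qed
    have oneG: "\<one>\<^bsub>?RC\<^esub> \<in> ?G 0"
      by (auto simp: ext_filtration_def) (auto simp: pmonom_def split: if_splits)
    \<comment> \<open>With exponents up to \<open>M\<close> there are \<open>(M + 1) ^ (n + 1)\<close> monomials in \<open>b0\<close> and the variables. They
      have degree at most \<open>L\<close>, and \<open>L + 1 \<le> (q * (n + 1) + 1) * (M + 1)\<close>, so they involve at most
      \<open>M * (M + 1) ^ n\<close> monomials of the other polynomial ring.\<close>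
    define M where "M = (q * Suc n + 1) ^ n"
    define L where "L = q * (Suc n * M)"
    define E where "E = PiE {..<n} (\<lambda>_. {..M})"
    define I where "I = {..M} \<times> E"
    define J where "J = {m :: nat multiset. set_mset m \<subseteq> {..<n} \<and> size m \<le> L}"
    define g where "g = (\<lambda>(k :: nat, f). \<psi> (pmonom B (b0 [^]\<^bsub>B\<^esub> k) (exponents n f)))"
    have finE: "finite E" unfolding E_def by (intro finite_PiE) auto
    have fin: "finite I" "finite J" using finE card_bounded_monomials by (auto simp: I_def J_def)
    have monoB: "pmonom B (b0 [^]\<^bsub>B\<^esub> (k :: nat)) (exponents n f) \<in> carrier ?RB" for k f
      using b0 by (intro B.pmonom_in_poly set_exponents B.nat_pow_closed)
    have g_closed: "g p \<in> carrier ?RC" for p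
      unfolding g_def by (cases p) (simp add: poisson_isoD(4)[OF \<psi> monoB])
    have gL: "g p m = \<zero>\<^bsub>C\<^esub>" if p: "p \<in> I" and m: "m \<notin> J" for p m
    proof -
      obtain k f where kf: "p = (k, f)" "k \<le> M" "f \<in> E" using p by (auto simp: I_def)
      have "f i \<le> M" if "i < n" for i using kf(3) that by (auto simp: E_def)
      then have "(\<Sum>i<n. f i) \<le> n * M" using sum_bounded_above[of "{..<n}" f M] by simp
      then have "q * (k + size (exponents n f)) \<le> L"
        using kf(2) by (simp add: L_def size_exponents)
      then have "g p \<in> ?G L"
        using B.power_monomial_in_filtration[OF G \<psi>_hom oneG b0 b0G varG set_exponents, of k f]
          G.F_mono kf(1) by (auto simp: g_def)
      then show ?thesis using m by (auto simp: ext_filtration_def J_def dest: C.poly_support)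
    qed
    have "card J < card I"
    proof -
      have "card J \<le> Suc L ^ n" using card_bounded_monomials[of n L] by (simp add: J_def)
      also have "Suc L \<le> (q * Suc n + 1) * Suc M" by (simp add: L_def algebra_simps)
      then have "Suc L ^ n \<le> ((q * Suc n + 1) * Suc M) ^ n" by (rule power_mono) simp
      also have "\<dots> = M * Suc M ^ n" unfolding M_def by (rule power_mult_distrib)
      also have "\<dots> < Suc M * Suc M ^ n" by simp
      also have "\<dots> = card I" by (simp add: I_def E_def card_cartesian_product card_PiE)
      finally show ?thesis .
    qed
    then obtain c where c: "\<forall>p\<in>I. c p \<in> carrier C" "\<exists>p\<in>I. c p \<noteq> \<zero>\<^bsub>C\<^esub>"
      "\<forall>m\<in>J. (\<Oplus>\<^bsub>C\<^esub>p\<in>I. c p \<otimes>\<^bsub>C\<^esub> g p m) = \<zero>\<^bsub>C\<^esub>"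
      using D.linear_dependence[OF fin(2,1), of g] C.poly_coeff_closed[OF g_closed] by blast
    define h where "h = (\<lambda>p. pmonom C (c p) {#} \<otimes>\<^bsub>?RC\<^esub> g p)"
    have h_closed: "h \<in> I \<rightarrow> carrier ?RC"
      using c(1) constC g_closed by (auto simp: h_def intro!: RC.m_closed simp del: C.poly_ext_simps)
    have h_coeff: "h p m = c p \<otimes>\<^bsub>C\<^esub> g p m" if "p \<in> I" for p m
      unfolding h_def using c(1) that
      by (simp add: C.pconv_const_left[OF C.mul.biadditive_axioms] C.poly_coeff_closed[OF g_closed])
    have "(\<Oplus>\<^bsub>?RC\<^esub>p\<in>I. h p) m = \<zero>\<^bsub>C\<^esub>" for m
    proof -
      have "(\<Oplus>\<^bsub>?RC\<^esub>p\<in>I. h p) m = (\<Oplus>\<^bsub>C\<^esub>p\<in>I. c p \<otimes>\<^bsub>C\<^esub> g p m)"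
        unfolding C.poly_finsum[OF fin(1) h_closed]
        by (rule C.M.finsum_cong') (use h_coeff c(1) C.poly_coeff_closed[OF g_closed] in auto)
      also have "\<dots> = \<zero>\<^bsub>C\<^esub>"
      proof (cases "m \<in> J")
        case False
        then show ?thesis using gL c(1) by (intro C.M.add.finprod_one_eqI) auto
      qed (use c(3) in blast)
      finally show ?thesis .
    qed
    then have sum0: "(\<Oplus>\<^bsub>?RC\<^esub>p\<in>I. h p) = \<zero>\<^bsub>?RC\<^esub>" by auto
    interpret \<phi>: ring_hom_cring ?RC ?RB \<phi>
      by (intro ring_hom_cringI RC.M_cring RB.M_cring ring_hom_ring.axioms \<phi>_hom)
    have \<phi>h: "\<phi> (h p) = pmonom B (\<iota> (c p) \<otimes>\<^bsub>B\<^esub> b0 [^]\<^bsub>B\<^esub> fst p) (exponents n (snd p))"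
      if p: "p \<in> I" for p
    proof -
      have cp: "c p \<in> carrier C" using c(1) p by blast
      have "\<phi> (h p) = pmonom B (\<iota> (c p)) {#} \<otimes>\<^bsub>?RB\<^esub> pmonom B (b0 [^]\<^bsub>B\<^esub> fst p) (exponents n (snd p))"
        unfolding h_def ring_hom_memE(2)[OF \<phi>_hom constC[OF cp] g_closed] \<phi>_const[OF cp]
        using \<phi>\<psi>[OF monoB] by (simp add: g_def split_beta)
      then show ?thesis
        using B.mul.pconv_monom[OF ring_hom_memE(1)[OF \<iota> cp], of "b0 [^]\<^bsub>B\<^esub> fst p" "{#}"] b0 by simp
    qed
    \<comment> \<open>In the other polynomial ring the relation splits into one relation between the powers of \<open>b0\<close>
      for each monomial in the variables.\<close>
    have \<phi>h_closed: "(\<lambda>p. \<phi> (h p)) \<in> I \<rightarrow> carrier ?RB" using h_closed poisson_isoD(4)[OF \<phi>] by auto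
    have "\<phi> (\<Oplus>\<^bsub>?RC\<^esub>p\<in>I. h p) = (\<Oplus>\<^bsub>?RB\<^esub>p\<in>I. \<phi> (h p))"
      using h_closed by (subst \<phi>.hom_finsum) (auto simp: o_def)
    then have "(\<Oplus>\<^bsub>?RB\<^esub>p\<in>I. \<phi> (h p)) = \<zero>\<^bsub>?RB\<^esub>"
      unfolding sum0 ring_hom_zero[OF \<phi>_hom RC.ring_axioms RB.ring_axioms] by (rule sym)
    then have rel: "(\<Oplus>\<^bsub>B\<^esub>p\<in>I. \<phi> (h p) m) = \<zero>\<^bsub>B\<^esub>" for m
      unfolding B.poly_finsum[OF fin(1) \<phi>h_closed] B.poly_ext_simps(1) by (rule fun_cong)
    have "c (k, f) = \<zero>\<^bsub>C\<^esub>" if k: "k \<le> M" and f: "f \<in> E" for k f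
    proof -
      let ?t = "\<lambda>k. \<iota> (c (k, f)) \<otimes>\<^bsub>B\<^esub> b0 [^]\<^bsub>B\<^esub> k"
      have cf: "c (k, f) \<in> carrier C" if "k \<le> M" for k using c(1) that f by (auto simp: I_def)
      have t: "?t k \<in> carrier B" if "k \<le> M" for k using ring_hom_memE(1)[OF \<iota> cf[OF that]] b0 by simp
      have "(\<Oplus>\<^bsub>B\<^esub>p\<in>I. \<phi> (h p) (exponents n f)) = (\<Oplus>\<^bsub>B\<^esub>p\<in>(\<lambda>k. (k, f)) ` {..M}. ?t (fst p))"
      proof (rule B.M.add.finprod_mono_neutral_cong_right)
        show "(\<lambda>k. (k, f)) ` {..M} \<subseteq> I" using f by (auto simp: I_def)
        show "(\<lambda>p. \<phi> (h p) (exponents n f)) \<in> I \<rightarrow> carrier B"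
          using \<phi>h_closed by (auto intro: B.poly_coeff_closed)
        show "\<phi> (h p) (exponents n f) = ?t (fst p)" if p: "p \<in> (\<lambda>k. (k, f)) ` {..M}" for p
        proof -
          have "p \<in> I" "snd p = f" "p = (fst p, f)" using p f by (auto simp: I_def)
          then show ?thesis using \<phi>h[of p] by (simp add: pmonom_def)
        qed
        show "\<phi> (h p) (exponents n f) = \<zero>\<^bsub>B\<^esub>" if p: "p \<in> I - (\<lambda>k. (k, f)) ` {..M}" for p
        proof -
          from p have pI: "p \<in> I" and "snd p \<noteq> f" "snd p \<in> E" by (auto simp: I_def image_iff)
          then obtain i where "i < n" "snd p i \<noteq> f i"
            using f PiE_ext[of "snd p" "{..<n}" "\<lambda>_. {..M}" f] by (auto simp: E_def)
          then have "exponents n (snd p) \<noteq> exponents n f" by (metis count_exponents)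
          then show "\<phi> (h p) (exponents n f) = \<zero>\<^bsub>B\<^esub>"
            unfolding \<phi>h[OF pI] by (auto simp: pmonom_def)
        qed
      qed (use fin in auto)
      also have "\<dots> = (\<Oplus>\<^bsub>B\<^esub>k\<in>{..M}. ?t k)"
      proof -
        have "(\<lambda>p. ?t (fst p)) \<in> (\<lambda>k. (k, f)) ` {..M} \<rightarrow> carrier B" using t by auto
        then show ?thesis
          by (subst B.M.add.finprod_reindex) (auto simp: inj_on_def)
      qed
      finally have "(\<Oplus>\<^bsub>B\<^esub>k\<in>{..M}. ?t k) = \<zero>\<^bsub>B\<^esub>" using rel by simp
      then show ?thesis
        using power_relation_trivial[OF C.M_cring DB.domain_axioms \<iota> \<rho> \<rho>\<iota> b0 nz \<rho>b0, of M "\<lambda>k. c (k, f)" k] cf k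
        by blast
    qed
    then show False using c(2) by (auto simp: I_def)
  qed
  then have "b = \<iota> (\<rho> b)" using b_eq \<iota>\<rho>b by simp
  then show ?thesis using \<phi>_const[OF \<rho>b] \<rho>b by metis
qed

section \<open>Affine algebras\<close>

lemma affine_algebra_image:
  assumes S: "algebra K S" and T: "algebra K T" and h: "h \<in> ring_hom S T"
    and smult: "\<And>k a. k \<in> carrier K \<Longrightarrow> a \<in> carrier S \<Longrightarrow> h (k \<odot>\<^bsub>S\<^esub> a) = k \<odot>\<^bsub>T\<^esub> h a"
    and onto: "carrier T \<subseteq> h ` carrier S" and aff: "affine_algebra K S"
  shows "affine_algebra K T"
proof -
  interpret S: algebra K S by (rule S)
  interpret T: algebra K T by (rule T)
  note h' = ring_hom_memE[OF h]
  obtain Y where Y: "finite Y" "Y \<subseteq> carrier S"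
    and gen: "\<And>H. subring H S \<Longrightarrow> submodule H K S \<Longrightarrow> Y \<subseteq> H \<Longrightarrow> H = carrier S"
    using aff by (auto simp: affine_algebra_def generates_algebra_def)
  have "H = carrier T" if H: "subring H T" "submodule H K T" "h ` Y \<subseteq> H" for H
  proof -
    note Hr = subringE[OF H(1)] and Hs = submodule.smult_closed[OF H(2)]
    let ?H = "{a \<in> carrier S. h a \<in> H}"
    have "subring ?H S" "submodule ?H K S"
      by (rule S.subalgebra_closedI; use h' smult Hr Hs in auto)+
    then have "?H = carrier S" using gen[of ?H] Y H(3) by auto
    then show ?thesis using onto Hr(1) by auto
  qed
  moreover have "h ` Y \<subseteq> carrier T" using Y h'(1) by auto
  ultimately have "generates_algebra K T (h ` Y)" unfolding generates_algebra_def by blast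
  then show ?thesis using Y(1) unfolding affine_algebra_def by blast
qed

lemma (in poisson_algebra) affine_poly_ext:
  assumes "affine_algebra K A"
  shows "affine_algebra K (poly_ext A n)"
proof -
  let ?P = "poly_ext A n"
  interpret P: poisson_algebra K ?P by (rule poly_ext_poisson)
  obtain Y where Y: "finite Y" "Y \<subseteq> carrier A"
    and gen: "\<And>H. subring H A \<Longrightarrow> submodule H K A \<Longrightarrow> Y \<subseteq> H \<Longrightarrow> H = carrier A"
    using assms by (auto simp: affine_algebra_def generates_algebra_def)
  define V where "V = (\<lambda>a. pmonom A a {#}) ` Y \<union> (\<lambda>i. pmonom A \<one>\<^bsub>A\<^esub> {#i#}) ` {..<n}"
  have const: "pmonom A a {#} \<in> carrier ?P" if "a \<in> carrier A" for a using that by (rule pmonom_in_poly) simp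
  have "H = carrier ?P" if H: "subring H ?P" "submodule H K ?P" "V \<subseteq> H" for H
  proof
    note Hr = subringE[OF H(1)] and Hs = submodule.smult_closed[OF H(2)]
    let ?H = "{a \<in> carrier A. pmonom A a {#} \<in> H}"
    note c = ring_hom_memE[OF const_ring_hom[of n]]
    have smultH: "pmonom A (k \<odot>\<^bsub>A\<^esub> a) {#} \<in> H" if "k \<in> carrier K" "pmonom A a {#} \<in> H" for k a
      unfolding const_smult[OF that(1), where n = n] by (rule Hs[OF that])
    have opH: "pmonom A (a \<oplus>\<^bsub>A\<^esub> b) {#} \<in> H" "pmonom A (a \<otimes>\<^bsub>A\<^esub> b) {#} \<in> H"
      if "a \<in> ?H" "b \<in> ?H" for a b
      using that c(2,3)[of a b] Hr(6,7)[of "pmonom A a {#}" "pmonom A b {#}"] by simp_all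
    have oneH: "pmonom A \<one>\<^bsub>A\<^esub> {#} \<in> H" using Hr(3) by simp
    have "subring ?H A" "submodule ?H K A"
      by (rule subalgebra_closedI; use smultH opH oneH in auto)+
    moreover have "Y \<subseteq> ?H" using H(3) Y by (auto simp: V_def)
    ultimately have constH: "pmonom A a {#} \<in> H" if "a \<in> carrier A" for a using gen[of ?H] that by blast
    have monoH: "pmonom A a e \<in> H" if "a \<in> carrier A" "set_mset e \<subseteq> {..<n}" for a e
      using that(2)
    proof (induction e)
      case empty
      then show ?case using constH[OF that(1)] by simp
    next
      case (add i e)
      then have "pmonom A a e \<in> H" "pmonom A \<one>\<^bsub>A\<^esub> {#i#} \<in> H" using H(3) by (auto simp: V_def)
      then have "pmonom A \<one>\<^bsub>A\<^esub> {#i#} \<otimes>\<^bsub>?P\<^esub> pmonom A a e \<in> H" using Hr(6) by blast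
      then show ?case using mul.pconv_monom[OF one_closed that(1), of "{#i#}" e] that(1) by simp
    qed
    show "H \<subseteq> carrier ?P" using Hr(1) .
    show "carrier ?P \<subseteq> H"
    proof
      fix f assume "f \<in> carrier ?P"
      then show "f \<in> H"
      proof (induction rule: poly_induct)
        case zero
        then show ?case using Hr(2) by simp
      next
        case (add f g)
        then show ?case using Hr(7)[of f g] by simp
      qed (rule monoH)
    qed
  qed
  moreover have "V \<subseteq> carrier ?P" using Y const by (auto simp: V_def intro!: pmonom_in_poly)
  ultimately have "generates_algebra K ?P V" unfolding generates_algebra_def by blast
  moreover have "finite V" using Y by (simp add: V_def)
  ultimately show ?thesis unfolding affine_algebra_def by blast
qed

section \<open>The center of a polynomial extension\<close>

context poisson_algebra begin

lemma pmonom_center: "pmonom (poisson_center A) a e = pmonom A a e"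
  unfolding pmonom_def center_simps ..

lemma finsum_center:
  assumes "finite S" "f \<in> S \<rightarrow> carrier (poisson_center A)"
  shows "finsum (poisson_center A) f S = finsum A f S"
  using assms
proof (induction S rule: finite_induct)
  case empty
  interpret Z: poisson_algebra K "poisson_center A" by (rule poisson_center_poisson)
  show ?case by simp
next
  case (insert x S)
  interpret Z: poisson_algebra K "poisson_center A" by (rule poisson_center_poisson)
  have Z: "f x \<in> carrier (poisson_center A)" "f \<in> S \<rightarrow> carrier (poisson_center A)" using insert.prems by auto
  then have "f x \<in> carrier A" "f \<in> S \<rightarrow> carrier A" using center_sub by auto
  then show ?case
    using M.finsum_insert[OF insert.hyps, of f] Z.M.finsum_insert[OF insert.hyps Z(2,1)] insert.IH[OF Z(2)] by simp
qed

lemma pconv_center: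
  assumes "biadditive (poisson_center A) opr"
    and "\<And>m. f m \<in> carrier (poisson_center A)" "\<And>m. g m \<in> carrier (poisson_center A)"
  shows "pconv (poisson_center A) opr f g = pconv A opr f g"
proof -
  interpret Z: biadditive "poisson_center A" opr by (rule assms(1))
  show ?thesis
    unfolding pconv_def by (rule ext, rule finsum_center) (use assms mul.finite_submultisets in auto)
qed

text \<open>
  A central polynomial commutes in particular with the constants, which forces its coefficients to
  be central.
\<close>
lemma carrier_center_poly_ext:
  "carrier (poisson_center (poly_ext A n)) = carrier (poly_ext (poisson_center A) n)"
proof -
  let ?P = "poly_ext A n"
  interpret P: poisson_algebra K ?P by (rule poly_ext_poisson)
  interpret Z: poisson_algebra K "poisson_center A" by (rule poisson_center_poisson)
  have carrZ: "f \<in> carrier (poly_ext (poisson_center A) n) \<longleftrightarrow>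
      f \<in> carrier ?P \<and> (\<forall>m. f m \<in> carrier (poisson_center A))" for f
    unfolding Z.carrier_poly_ext carrier_poly_ext using center_sub by auto
  have "f \<in> carrier (poisson_center ?P) \<longleftrightarrow> (\<forall>m. f m \<in> carrier (poisson_center A))"
    if f: "f \<in> carrier ?P" for f
  proof
    assume fZ: "f \<in> carrier (poisson_center ?P)"
    show "\<forall>m. f m \<in> carrier (poisson_center A)"
    proof
      fix m
      have "\<lbrace>f m, a\<rbrace>\<^bsub>A\<^esub> = \<zero>\<^bsub>A\<^esub>" if a: "a \<in> carrier A" for a
      proof -
        have "\<lbrace>f, pmonom A a {#}\<rbrace>\<^bsub>?P\<^esub> = \<zero>\<^bsub>?P\<^esub>"
          using P.center_bracket(1)[OF fZ, of "pmonom A a {#}"] pmonom_in_poly[OF a, of "{#}" n] by simp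
        then have "pconv A (pbracket A) f (pmonom A a {#}) m = \<zero>\<^bsub>A\<^esub>" by (simp add: fun_eq_iff)
        then show ?thesis
          using pconv_const_right[OF brk.biadditive_axioms a, of f m] poly_coeff_closed[OF f] by simp
      qed
      then show "f m \<in> carrier (poisson_center A)" using poly_coeff_closed[OF f] by (simp add: center_carrier)
    qed
  next
    assume fZ: "\<forall>m. f m \<in> carrier (poisson_center A)"
    have "pconv A (pbracket A) f g = (\<lambda>_. \<zero>\<^bsub>A\<^esub>)" if g: "g \<in> carrier ?P" for g
      unfolding pconv_def
      by (rule ext, rule add.finprod_one_eqI) (use fZ center_bracket(1) poly_coeff_closed[OF g] in auto)
    then show "f \<in> carrier (poisson_center ?P)" using f by (simp add: P.center_carrier)
  qed
  then show ?thesis using carrZ P.center_sub by blast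
qed

lemma poly_ext_center_ops:
  assumes "f \<in> carrier (poly_ext (poisson_center A) n)" "g \<in> carrier (poly_ext (poisson_center A) n)"
  shows "f \<otimes>\<^bsub>poly_ext (poisson_center A) n\<^esub> g = f \<otimes>\<^bsub>poly_ext A n\<^esub> g"
    and "\<lbrace>f, g\<rbrace>\<^bsub>poly_ext (poisson_center A) n\<^esub> = \<lbrace>f, g\<rbrace>\<^bsub>poly_ext A n\<^esub>"
    and "f \<oplus>\<^bsub>poly_ext (poisson_center A) n\<^esub> g = f \<oplus>\<^bsub>poly_ext A n\<^esub> g"
    and "k \<odot>\<^bsub>poly_ext (poisson_center A) n\<^esub> f = k \<odot>\<^bsub>poly_ext A n\<^esub> f"
    and "\<one>\<^bsub>poly_ext (poisson_center A) n\<^esub> = \<one>\<^bsub>poly_ext A n\<^esub>"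
proof -
  interpret Z: poisson_algebra K "poisson_center A" by (rule poisson_center_poisson)
  note coeff = Z.poly_coeff_closed[OF assms(1)] Z.poly_coeff_closed[OF assms(2)]
  have eq: "monoid.mult (poisson_center A) = monoid.mult A" "pbracket (poisson_center A) = pbracket A"
    by (simp_all add: poisson_center_def)
  show "f \<otimes>\<^bsub>poly_ext (poisson_center A) n\<^esub> g = f \<otimes>\<^bsub>poly_ext A n\<^esub> g"
    using pconv_center[OF Z.mul.biadditive_axioms coeff] by (simp add: eq)
  show "\<lbrace>f, g\<rbrace>\<^bsub>poly_ext (poisson_center A) n\<^esub> = \<lbrace>f, g\<rbrace>\<^bsub>poly_ext A n\<^esub>"
    using pconv_center[OF Z.brk.biadditive_axioms coeff] by (simp add: eq)
  show "f \<oplus>\<^bsub>poly_ext (poisson_center A) n\<^esub> g = f \<oplus>\<^bsub>poly_ext A n\<^esub> g"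
    "k \<odot>\<^bsub>poly_ext (poisson_center A) n\<^esub> f = k \<odot>\<^bsub>poly_ext A n\<^esub> f"
    "\<one>\<^bsub>poly_ext (poisson_center A) n\<^esub> = \<one>\<^bsub>poly_ext A n\<^esub>"
    by (simp_all add: pmonom_center)
qed

end

lemma poisson_iso_poly_center:
  assumes A: "poisson_algebra K A" and B: "poisson_algebra K B"
    and \<phi>: "\<phi> \<in> poisson_iso K (poly_ext A n) (poly_ext B n)"
  shows "\<phi> \<in> poisson_iso K (poly_ext (poisson_center A) n) (poly_ext (poisson_center B) n)"
proof -
  interpret A: poisson_algebra K A by (rule A)
  interpret B: poisson_algebra K B by (rule B)
  let ?ZA = "poly_ext (poisson_center A) n" and ?ZB = "poly_ext (poisson_center B) n"
  have "\<phi> \<in> poisson_iso K (poisson_center (poly_ext A n)) (poisson_center (poly_ext B n))"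
    by (rule poisson_iso_center[OF A.poly_ext_poisson B.poly_ext_poisson \<phi>])
  then have bij: "bij_betw \<phi> (carrier ?ZA) (carrier ?ZB)"
    using poisson_isoD(3) A.carrier_center_poly_ext B.carrier_center_poly_ext by metis
  have sub: "f \<in> carrier (poly_ext A n)" if "f \<in> carrier ?ZA" for f
    using that A.carrier_center_poly_ext[of n] poisson_algebra.center_sub[OF A.poly_ext_poisson] by blast
  have im: "\<phi> f \<in> carrier ?ZB" if "f \<in> carrier ?ZA" for f using bij that by (rule bij_betwE[rule_format])
  interpret ZA: poisson_algebra K ?ZA
    by (rule poisson_algebra.poly_ext_poisson[OF A.poisson_center_poisson])
  show ?thesis
  proof (rule poisson_isoI[OF bij])
    fix f g assume fg: "f \<in> carrier ?ZA" "g \<in> carrier ?ZA"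
    note opsA = A.poly_ext_center_ops[OF fg] and opsB = B.poly_ext_center_ops[OF fg[THEN im]]
    show "\<phi> (f \<oplus>\<^bsub>?ZA\<^esub> g) = \<phi> f \<oplus>\<^bsub>?ZB\<^esub> \<phi> g"
      unfolding opsA opsB by (rule poisson_isoD(5)[OF \<phi> fg[THEN sub]])
    show "\<phi> (f \<otimes>\<^bsub>?ZA\<^esub> g) = \<phi> f \<otimes>\<^bsub>?ZB\<^esub> \<phi> g"
      unfolding opsA opsB by (rule poisson_isoD(6)[OF \<phi> fg[THEN sub]])
    show "\<phi> \<lbrace>f, g\<rbrace>\<^bsub>?ZA\<^esub> = \<lbrace>\<phi> f, \<phi> g\<rbrace>\<^bsub>?ZB\<^esub>"
      unfolding opsA opsB by (rule poisson_isoD(9)[OF \<phi> fg[THEN sub]])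
  next
    fix k f assume k: "k \<in> carrier K" and f: "f \<in> carrier ?ZA"
    show "\<phi> (k \<odot>\<^bsub>?ZA\<^esub> f) = k \<odot>\<^bsub>?ZB\<^esub> \<phi> f"
      unfolding A.poly_ext_center_ops(4)[OF f f] B.poly_ext_center_ops(4)[OF im[OF f] im[OF f]]
      by (rule poisson_isoD(8)[OF \<phi> k sub[OF f]])
  next
    have "\<one>\<^bsub>?ZA\<^esub> \<in> carrier ?ZA" by (rule ZA.one_closed)
    then show "\<phi> \<one>\<^bsub>?ZA\<^esub> = \<one>\<^bsub>?ZB\<^esub>"
      using A.poly_ext_center_ops(5) B.poly_ext_center_ops(5) im poisson_isoD(7)[OF \<phi>] by metis
  qed
qed

section \<open>The discriminant is carried to a constant\<close>

lemma disc_ideal_closed: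
  assumes "poisson_algebra K A"
  shows "disc_ideal K P A \<subseteq> carrier A" "\<zero>\<^bsub>A\<^esub> \<in> disc_ideal K P A"
    "\<And>a b. a \<in> disc_ideal K P A \<Longrightarrow> b \<in> disc_ideal K P A \<Longrightarrow> a \<oplus>\<^bsub>A\<^esub> b \<in> disc_ideal K P A"
proof -
  interpret A: poisson_algebra K A by fact
  interpret Z: poisson_algebra K "poisson_center A" by (rule A.poisson_center_poisson)
  have add: "additive_subgroup m (poisson_center A)" if "m \<in> D_locus K P A" for m
    using that by (auto simp: D_locus_def max_spec_def dest!: maximalideal.axioms(1) ideal.axioms(1))
  show "disc_ideal K P A \<subseteq> carrier A" using A.center_sub by (auto simp: disc_ideal_def)
  show "\<zero>\<^bsub>A\<^esub> \<in> disc_ideal K P A"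
    using Z.M.zero_closed additive_subgroup.zero_closed[OF add] by (simp add: disc_ideal_def)
  show "a \<oplus>\<^bsub>A\<^esub> b \<in> disc_ideal K P A" if "a \<in> disc_ideal K P A" "b \<in> disc_ideal K P A" for a b
    using that Z.M.a_closed[of a b] additive_subgroup.a_closed[OF add, of _ a b] by (simp add: disc_ideal_def)
qed

text \<open>
  A nonzero coefficient \<open>e\<close> of the image of \<open>d\<close> lies in the discriminant ideal of \<open>B\<close>. As a constant
  it is then a multiple of the image of \<open>d\<close> in the polynomials over the center of \<open>B\<close>. Stability
  is applied to \<open>B\<close> too; its center is affine because it is a quotient of a polynomial
  extension of the center of \<open>A\<close>.
\<close>
theorem discriminant_constant:
  fixes A B :: "('k, 'a) palg" and P :: "('k, 'a) palg \<Rightarrow> bool"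
  assumes A: "poisson_algebra K A" and B: "poisson_algebra K B"
    and \<phi>: "\<phi> \<in> poisson_iso K (poly_ext A n) (poly_ext B n)" and n: "1 \<le> n"
    and aff: "affine_algebra K (poisson_center A)" and dom: "domain (poisson_center A)"
    and stable: "stable_property K P" and d: "is_discriminant K P A d" and nz: "d \<noteq> \<zero>\<^bsub>A\<^esub>"
  shows "\<exists>b. \<phi> (pmonom A d {#}) = pmonom B b {#}"
proof -
  interpret A: poisson_algebra K A by (rule A)
  interpret B: poisson_algebra K B by (rule B)
  let ?RA = "poly_ext A n" and ?RB = "poly_ext B n"
  let ?ZA = "poly_ext (poisson_center A) n" and ?ZB = "poly_ext (poisson_center B) n"
  interpret RA: poisson_algebra K ?RA by (rule A.poly_ext_poisson)
  interpret RB: poisson_algebra K ?RB by (rule B.poly_ext_poisson)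
  interpret cA: poisson_algebra K "poisson_center A" by (rule A.poisson_center_poisson)
  interpret cB: poisson_algebra K "poisson_center B" by (rule B.poisson_center_poisson)
  interpret ZA: poisson_algebra K ?ZA by (rule cA.poly_ext_poisson)
  interpret ZB: poisson_algebra K ?ZB by (rule cB.poly_ext_poisson)
  have \<phi>Z: "\<phi> \<in> poisson_iso K ?ZA ?ZB" by (rule poisson_iso_poly_center[OF A B \<phi>])
  have domB: "domain (poisson_center B)"
    by (rule domain_coefficients[OF cA.poisson_algebra_axioms cB.poisson_algebra_axioms dom \<phi>Z])
  have affB: "affine_algebra K (poisson_center B)"
  proof (rule affine_algebra_image[OF ZA.algebra_axioms cB.algebra_axioms])
    show "(\<lambda>f. f {#}) \<circ> \<phi> \<in> ring_hom ?ZA (poisson_center B)"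
      by (rule ring_hom_trans[OF poisson_isoD(2)[OF \<phi>Z] cB.const_term_ring_hom])
    show "((\<lambda>f. f {#}) \<circ> \<phi>) (k \<odot>\<^bsub>?ZA\<^esub> f) = k \<odot>\<^bsub>poisson_center B\<^esub> ((\<lambda>f. f {#}) \<circ> \<phi>) f"
      if "k \<in> carrier K" "f \<in> carrier ?ZA" for k f
      unfolding o_def poisson_isoD(8)[OF \<phi>Z that] by simp
    show "carrier (poisson_center B) \<subseteq> ((\<lambda>f. f {#}) \<circ> \<phi>) ` carrier ?ZA"
    proof
      fix z assume "z \<in> carrier (poisson_center B)"
      then have "pmonom (poisson_center B) z {#} \<in> carrier ?ZB" by (intro cB.pmonom_in_poly) auto
      then have "pmonom (poisson_center B) z {#} \<in> \<phi> ` carrier ?ZA"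
        unfolding bij_betw_imp_surj_on[OF poisson_isoD(3)[OF \<phi>Z]] .
      then obtain f where f: "f \<in> carrier ?ZA" "pmonom (poisson_center B) z {#} = \<phi> f" by (elim imageE) blast
      then have "z = ((\<lambda>f. f {#}) \<circ> \<phi>) f" unfolding o_def f(2)[symmetric] pmonom_def by (simp only: if_True refl)
      then show "z \<in> ((\<lambda>f. f {#}) \<circ> \<phi>) ` carrier ?ZA" using f(1) by (rule image_eqI)
    qed
    show "affine_algebra K ?ZA" by (rule cA.affine_poly_ext[OF aff])
  qed
  define I where "I = disc_ideal K P A"
  define I' where "I' = disc_ideal K P B"
  note I = disc_ideal_closed[OF A, where P = P, folded I_def] and I' = disc_ideal_closed[OF B, where P = P, folded I'_def]
  have discA: "disc_ideal K P ?RA = A.indexed_pset {..<n} I"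
    using stable A aff n unfolding stable_property_def I_def by blast
  have discB: "disc_ideal K P ?RB = B.indexed_pset {..<n} I'"
    using stable B affB n unfolding stable_property_def I'_def by blast
  have image: "B.indexed_pset {..<n} I' = \<phi> ` A.indexed_pset {..<n} I"
    using disc_ideal_iso[OF RA.poisson_algebra_axioms RB.poisson_algebra_axioms \<phi>, of P] discA discB by simp
  have dZ: "d \<in> carrier (poisson_center A)" and Id: "I = PIdl\<^bsub>poisson_center A\<^esub> d"
    using d by (auto simp: is_discriminant_def I_def)
  have dI: "d \<in> I" unfolding Id by (rule cA.cgenideal_self[OF dZ])
  have monoI: "pmonom A d {#} \<in> A.indexed_pset {..<n} I"
    using A.indexed_pset.indexed_const[OF dI] by (simp add: A.indexed_const_def pmonom_def)
  have dA: "d \<in> carrier A" using A.center_sub[OF dZ] .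
  have constd: "pmonom A d {#} \<in> carrier ?RA" by (rule A.pmonom_in_poly[OF dA]) simp
  have constdZ: "pmonom A d {#} \<in> carrier ?ZA"
    using cA.pmonom_in_poly[OF dZ, of "{#}" n] by (simp add: A.pmonom_center)
  have "\<phi> (pmonom A d {#}) \<noteq> \<phi> \<zero>\<^bsub>?RA\<^esub>"
  proof
    assume "\<phi> (pmonom A d {#}) = \<phi> \<zero>\<^bsub>?RA\<^esub>"
    then have "pmonom A d {#} = \<zero>\<^bsub>?RA\<^esub>"
      using poisson_isoD(3)[OF \<phi>] constd RA.zero_closed by (metis bij_betw_def inj_onD)
    then have "pmonom A d {#} ({#} :: nat multiset) = \<zero>\<^bsub>?RA\<^esub> {#}" by (rule fun_cong)
    then show False using nz by (simp add: pmonom_def)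
  qed
  then have "\<phi> (pmonom A d {#}) \<noteq> \<zero>\<^bsub>?RB\<^esub>"
    using poisson_iso_zero[OF RA.poisson_algebra_axioms RB.poisson_algebra_axioms \<phi>] by simp
  then obtain m where m: "\<phi> (pmonom A d {#}) m \<noteq> \<zero>\<^bsub>B\<^esub>" by (auto simp: fun_eq_iff)
  define e where "e = \<phi> (pmonom A d {#}) m"
  have "\<phi> (pmonom A d {#}) \<in> B.indexed_pset {..<n} I'" using monoI image by blast
  then have eI: "e \<in> I'" by (simp add: e_def B.indexed_pset_eq[OF I'])
  then have "pmonom B e {#} \<in> B.indexed_pset {..<n} I'"
    using B.indexed_pset.indexed_const[OF eI] by (simp add: B.indexed_const_def pmonom_def)
  then obtain g where g: "g \<in> A.indexed_pset {..<n} I" "\<phi> g = pmonom B e {#}" using image by auto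
  have gI: "g m \<in> I" and g_fin: "finite {m. g m \<noteq> \<zero>\<^bsub>A\<^esub>}"
    and g_supp: "g m \<noteq> \<zero>\<^bsub>A\<^esub> \<Longrightarrow> set_mset m \<subseteq> {..<n}" for m
    using g(1) by (auto simp: A.indexed_pset_eq[OF I])
  have "\<exists>z\<in>carrier (poisson_center A). g m = d \<otimes>\<^bsub>A\<^esub> z \<and> (g m = \<zero>\<^bsub>A\<^esub> \<longrightarrow> z = \<zero>\<^bsub>A\<^esub>)" for m
  proof (cases "g m = \<zero>\<^bsub>A\<^esub>")
    case True
    then show ?thesis using dA cA.zero_closed by (intro bexI[of _ "\<zero>\<^bsub>A\<^esub>"]) auto
  next
    case False
    obtain z where z: "z \<in> carrier (poisson_center A)" "g m = z \<otimes>\<^bsub>A\<^esub> d"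
      using gI[of m] unfolding Id cgenideal_def by auto
    then show ?thesis using False A.m_comm[of z d] A.center_sub[OF z(1)] dA by auto
  qed
  then obtain g' where g': "\<And>m. g' m \<in> carrier (poisson_center A)" "\<And>m. g m = d \<otimes>\<^bsub>A\<^esub> g' m"
    "\<And>m. g m = \<zero>\<^bsub>A\<^esub> \<Longrightarrow> g' m = \<zero>\<^bsub>A\<^esub>" by metis
  have g'Z: "g' \<in> carrier ?ZA"
  proof -
    have "finite {m. g' m \<noteq> \<zero>\<^bsub>A\<^esub>}" by (rule finite_subset[OF _ g_fin]) (use g'(3) in auto)
    then show ?thesis using g'(1,3) g_supp by (auto simp: cA.carrier_poly_ext)
  qed
  have g'A: "g' m \<in> carrier A" for m using A.center_sub[OF g'(1)] .
  have "pconv A (monoid.mult A) (pmonom A d {#}) g' m = d \<otimes>\<^bsub>A\<^esub> g' m" for m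
    by (rule A.pconv_const_left[OF A.mul.biadditive_axioms dA]) (rule g'A)
  then have "g = pmonom A d {#} \<otimes>\<^bsub>?ZA\<^esub> g'"
    unfolding A.poly_ext_center_ops(1)[OF constdZ g'Z] A.poly_ext_simps(4)
    by (intro ext) (simp only: g'(2))
  then have "\<phi> (pmonom A d {#}) \<otimes>\<^bsub>?ZB\<^esub> \<phi> g' = pmonom (poisson_center B) e {#}"
    using poisson_isoD(6)[OF \<phi>Z constdZ g'Z] g(2) by (simp add: B.pmonom_center)
  moreover have "e \<in> carrier (poisson_center B)" using eI by (simp add: I'_def disc_ideal_def)
  moreover have "e \<noteq> \<zero>\<^bsub>B\<^esub>" using m by (simp add: e_def)
  ultimately have "\<phi> (pmonom A d {#}) = pmonom (poisson_center B) (\<phi> (pmonom A d {#}) {#}) {#}"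
    by (intro cB.factor_of_const[OF domB poisson_isoD(4)[OF \<phi>Z constdZ] poisson_isoD(4)[OF \<phi>Z g'Z]]) simp_all
  then show ?thesis by (metis B.pmonom_center)
qed

section \<open>Recovering the algebra\<close>

lemma poisson_iso_of_constants:
  assumes A: "poisson_algebra K A" and B: "poisson_algebra K B"
    and \<phi>: "\<phi> \<in> poisson_iso K (poly_ext A n) (poly_ext B n)"
    and bij: "bij_betw (\<lambda>a. \<phi> (pmonom A a {#}) {#}) (carrier A) (carrier B)"
  shows "(\<lambda>a. \<phi> (pmonom A a {#}) {#}) \<in> poisson_iso K A B"
proof -
  interpret A: poisson_algebra K A by (rule A)
  interpret B: poisson_algebra K B by (rule B)
  let ?h = "\<lambda>a. \<phi> (pmonom A a {#}) {#}"
  have h: "?h \<in> ring_hom A B"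
    using ring_hom_trans[OF ring_hom_trans[OF A.const_ring_hom poisson_isoD(2)[OF \<phi>]] B.const_term_ring_hom]
    by (simp add: o_def)
  have const: "pmonom A a {#} \<in> carrier (poly_ext A n)" if "a \<in> carrier A" for a
    using that by (rule A.pmonom_in_poly) simp
  show ?thesis
  proof (rule poisson_isoI[OF bij])
    fix k a assume k: "k \<in> carrier K" and a: "a \<in> carrier A"
    show "?h (k \<odot>\<^bsub>A\<^esub> a) = k \<odot>\<^bsub>B\<^esub> ?h a"
      unfolding A.const_smult[OF k, where n = n] poisson_isoD(8)[OF \<phi> k const[OF a]] by simp
  next
    fix a b assume ab: "a \<in> carrier A" "b \<in> carrier A"
    have "pmonom A \<lbrace>a, b\<rbrace>\<^bsub>A\<^esub> {#} = \<lbrace>pmonom A a {#}, pmonom A b {#}\<rbrace>\<^bsub>poly_ext A n\<^esub>"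
      using A.brk.pconv_monom[OF ab, of "{#} :: nat multiset" "{#}"] by simp
    then have "\<phi> (pmonom A \<lbrace>a, b\<rbrace>\<^bsub>A\<^esub> {#}) = \<lbrace>\<phi> (pmonom A a {#}), \<phi> (pmonom A b {#})\<rbrace>\<^bsub>poly_ext B n\<^esub>"
      using poisson_isoD(9)[OF \<phi> ab[THEN const]] by simp
    then show "?h \<lbrace>a, b\<rbrace>\<^bsub>A\<^esub> = \<lbrace>?h a, ?h b\<rbrace>\<^bsub>B\<^esub>"
      using B.pconv_at_empty[OF B.brk.biadditive_axioms, of "\<phi> (pmonom A a {#})" "\<phi> (pmonom A b {#})"]
        ring_hom_memE(1)[OF h ab(1)] ring_hom_memE(1)[OF h ab(2)] by simp
  qed (use ring_hom_memE[OF h] in simp_all)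
qed

text \<open>
  The variables of \<open>A[t\<^sub>1, \<dots>, t\<^sub>n]\<close> are Poisson central, so the constant terms of their images are
  central elements of \<open>B\<close>, and these are images of constants by assumption. Hence constants alone
  already reach everything that polynomials reach.
\<close>
lemma constant_terms_surjective:
  assumes A: "poisson_algebra K A" and B: "poisson_algebra K B"
    and \<phi>: "\<phi> \<in> poisson_iso K (poly_ext A n) (poly_ext B n)"
    and center: "\<And>z. z \<in> carrier (poisson_center B) \<Longrightarrow> \<exists>a\<in>carrier A. \<phi> (pmonom A a {#}) = pmonom B z {#}"
  shows "(\<lambda>a. \<phi> (pmonom A a {#}) {#}) ` carrier A = carrier B"
proof -
  interpret A: poisson_algebra K A by (rule A)
  interpret B: poisson_algebra K B by (rule B)
  let ?RA = "poly_ext A n" and ?RB = "poly_ext B n"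
  let ?h = "\<lambda>a. \<phi> (pmonom A a {#}) {#}"
  have h: "?h \<in> ring_hom A B"
    using ring_hom_trans[OF ring_hom_trans[OF A.const_ring_hom poisson_isoD(2)[OF \<phi>]] B.const_term_ring_hom]
    by (simp add: o_def)
  have \<sigma>: "(\<lambda>f. \<phi> f {#}) \<in> ring_hom ?RA B"
    using ring_hom_trans[OF poisson_isoD(2)[OF \<phi>] B.const_term_ring_hom] by (simp add: o_def)
  interpret RA: poisson_algebra K ?RA by (rule A.poly_ext_poisson)
  note h' = ring_hom_memE[OF h] and \<sigma>' = ring_hom_memE[OF \<sigma>]
  have centerh: "z \<in> ?h ` carrier A" if z: "z \<in> carrier (poisson_center B)" for z
  proof -
    obtain a where "a \<in> carrier A" "\<phi> (pmonom A a {#}) = pmonom B z {#}" using center[OF z] by blast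
    then show ?thesis by (intro image_eqI[of _ _ a]) (auto simp: pmonom_def)
  qed
  have var: "\<phi> (pmonom A \<one>\<^bsub>A\<^esub> e) {#} \<in> ?h ` carrier A" if e: "set_mset e \<subseteq> {..<n}" for e
  proof (rule centerh)
    interpret cA: poisson_algebra K "poisson_center A" by (rule A.poisson_center_poisson)
    interpret cB: poisson_algebra K "poisson_center B" by (rule B.poisson_center_poisson)
    have "pmonom A \<one>\<^bsub>A\<^esub> e \<in> carrier (poly_ext (poisson_center A) n)"
      using cA.pmonom_in_poly[OF cA.one_closed e] by (simp add: A.pmonom_center)
    then show "\<phi> (pmonom A \<one>\<^bsub>A\<^esub> e) {#} \<in> carrier (poisson_center B)"
      using poisson_isoD(4)[OF poisson_iso_poly_center[OF A B \<phi>]] cB.poly_coeff_closed by blast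
  qed
  have "\<phi> f {#} \<in> ?h ` carrier A" if "f \<in> carrier ?RA" for f
    using that
  proof (induction rule: A.poly_induct)
    case zero
    have "?h \<zero>\<^bsub>A\<^esub> = \<phi> (\<lambda>_. \<zero>\<^bsub>A\<^esub>) {#}" by (simp add: pmonom_def)
    then show ?case by (intro image_eqI[of _ _ "\<zero>\<^bsub>A\<^esub>"]) auto
  next
    case (monom a e)
    obtain c where c: "c \<in> carrier A" "\<phi> (pmonom A \<one>\<^bsub>A\<^esub> e) {#} = ?h c" using var[OF monom(2)] by blast
    have "pmonom A a e = pmonom A a {#} \<otimes>\<^bsub>?RA\<^esub> pmonom A \<one>\<^bsub>A\<^esub> e"
      using A.mul.pconv_monom[OF monom(1) A.one_closed, of "{#}" e] monom(1) by simp
    then have "\<phi> (pmonom A a e) {#} = ?h a \<otimes>\<^bsub>B\<^esub> ?h c"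
      using \<sigma>'(2)[of "pmonom A a {#}" "pmonom A \<one>\<^bsub>A\<^esub> e"] monom c(2) by simp
    also have "\<dots> = ?h (a \<otimes>\<^bsub>A\<^esub> c)" using h'(2)[OF monom(1) c(1)] by simp
    finally show ?case using monom(1) c(1) by blast
  next
    case (add f g)
    obtain a b where ab: "a \<in> carrier A" "b \<in> carrier A" "\<phi> f {#} = ?h a" "\<phi> g {#} = ?h b"
      using add.IH by blast
    have "\<phi> (\<lambda>m. f m \<oplus>\<^bsub>A\<^esub> g m) {#} = ?h (a \<oplus>\<^bsub>A\<^esub> b)"
      using \<sigma>'(3)[OF add.hyps(1,2)] h'(3)[OF ab(1,2)] ab(3,4) by simp
    then show ?case using ab(1,2) by blast
  qed
  moreover have "\<exists>f\<in>carrier ?RA. b = \<phi> f {#}" if b: "b \<in> carrier B" for b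
  proof -
    have "pmonom B b {#} \<in> carrier ?RB" using b by (intro B.pmonom_in_poly) auto
    then obtain f where f: "f \<in> carrier ?RA" "pmonom B b {#} = \<phi> f"
      using poisson_isoD(3)[OF \<phi>] unfolding bij_betw_def by blast
    have "b = \<phi> f {#}" unfolding f(2)[symmetric] pmonom_def by (simp only: if_True refl)
    then show ?thesis using f(1) by blast
  qed
  ultimately show ?thesis using h'(1) by blast
qed

text \<open>
  The kernels of the iterates of \<open>h\<close> form an ascending chain, which becomes stationary. An element of
  the kernel of \<open>h\<close> is the image of some \<open>c\<close> under an iterate from the stationary range; then
  \<open>c\<close> is killed by the next iterate, hence by this one.
\<close>
lemma (in noetherian_ring) surjective_endomorphism_injective:
  assumes h: "h \<in> ring_hom R R" and surj: "h ` carrier R = carrier R"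
  shows "inj_on h (carrier R)"
proof -
  define g where "g = (\<lambda>i :: nat. h ^^ i)"
  have g_hom: "g i \<in> ring_hom R R" for i
  proof (induction i)
    case 0
    then show ?case by (simp add: g_def ring_hom_memI)
  next
    case (Suc i)
    then show ?case using ring_hom_trans[OF Suc h] by (simp add: g_def o_def)
  qed
  have g_surj: "g i ` carrier R = carrier R" for i
  proof (induction i)
    case (Suc i)
    have "g (Suc i) ` carrier R = h ` (g i ` carrier R)" unfolding g_def funpow.simps(2) image_comp ..
    then show ?case using Suc surj by simp
  qed (simp add: g_def)
  define N where "N = (\<lambda>i. a_kernel R R (g i))"
  have ideal: "ideal (N i) R" for i
    unfolding N_def by (rule ring_hom_ring.kernel_is_ideal[OF ring_hom_ringI2[OF ring_axioms ring_axioms g_hom]])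
  have N_iff: "a \<in> N i \<longleftrightarrow> a \<in> carrier R \<and> g i a = \<zero>" for a i
    by (simp add: N_def a_kernel_def')
  have h0: "h \<zero> = \<zero>" by (rule ring_hom_zero[OF h ring_axioms ring_axioms])
  have step: "N i \<subseteq> N (Suc i)" for i
    using h0 by (auto simp: N_iff g_def)
  have mono: "N i \<subseteq> N j" if "i \<le> j" for i j
    by (rule lift_Suc_mono_le[of N, OF step that])
  have "\<Union>(range N) \<in> range N"
  proof (rule ideal_chain_is_trivial)
    show "subset.chain {I. ideal I R} (range N)"
      unfolding subset_chain_def
    proof (intro conjI ballI)
      show "range N \<subseteq> {I. ideal I R}" using ideal by blast
      fix x y assume "x \<in> range N" "y \<in> range N"
      then obtain i j where "x = N i" "y = N j" by blast
      then show "x \<subseteq> y \<or> y \<subseteq> x" using mono[of i j] mono[of j i] by (cases "i \<le> j") auto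
    qed
  qed simp
  then obtain k where k: "\<And>i. N i \<subseteq> N k" by blast
  have ker: "a = \<zero>" if a: "a \<in> carrier R" "h a = \<zero>" for a
  proof -
    obtain c where c: "c \<in> carrier R" "a = g k c" using a(1) g_surj[of k] by blast
    then have "c \<in> N (Suc k)" using a(2) by (simp add: N_iff g_def)
    then have "c \<in> N k" using k by blast
    then show ?thesis using c(2) by (simp add: N_iff)
  qed
  interpret h: ring_hom_ring R R h by (rule ring_hom_ringI2[OF ring_axioms ring_axioms h])
  show ?thesis
  proof (rule inj_onI)
    fix a b assume ab: "a \<in> carrier R" "b \<in> carrier R" "h a = h b"
    then have "h (a \<ominus> b) = \<zero>" by (simp add: a_minus_def r_neg)
    then have "a \<ominus> b = \<zero>" using ker[of "a \<ominus> b"] ab by simp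
    then show "a = b" using ab(1,2) by (simp only: r_right_minus_eq)
  qed
qed

theorem theorem7p16:
  fixes K :: "'k ring" and A :: "('k, 'a) palg" and P :: "('k, 'a) palg \<Rightarrow> bool" and d :: 'a
  assumes "infinite (UNIV :: 'a set)"
    and "field K"
    and "poisson_algebra K A"
    and "affine_algebra K (poisson_center A)"
    and "poisson_property K P"
    and "stable_property K P"
    and "is_discriminant K P A d"
  shows "(affine_algebra K A \<and> domain A \<and> (effective K A d \<or> poisson_effective K A d)
        \<longrightarrow> strongly_poisson_cancellative K A) \<and>
      (noetherian_ring A \<and> domain (poisson_center A) \<and> effective K (poisson_center A) d
        \<longrightarrow> strongly_poisson_cancellative K A)"
proof (intro conjI impI)
  interpret A: poisson_algebra K A by (rule assms(3))
  interpret cA: poisson_algebra K "poisson_center A" by (rule A.poisson_center_poisson)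
  {
    assume "affine_algebra K A \<and> domain A \<and> (effective K A d \<or> poisson_effective K A d)"
    then have dom: "domain A" and eff: "effective K A d \<or> poisson_effective K A d" by auto
    interpret D: "domain" A by (rule dom)
    have domZ: "domain (poisson_center A)"
      by (rule domainI[OF cA.M_cring]) (use D.integral A.center_sub in auto)
    have nz: "d \<noteq> \<zero>\<^bsub>A\<^esub>" using eff by (auto simp: effective_def poisson_effective_def)
    show "strongly_poisson_cancellative K A"
      unfolding strongly_poisson_cancellative_def
    proof (intro allI impI)
      fix B :: "('k, 'a) palg" and n :: nat
      assume B: "poisson_algebra K B" and n: "1 \<le> n"
        and "poisson_isomorphic K (poly_ext A n) (poly_ext B n)"
      then obtain \<phi> where \<phi>: "\<phi> \<in> poisson_iso K (poly_ext A n) (poly_ext B n)"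
        by (auto simp: poisson_isomorphic_def)
      interpret B: poisson_algebra K B by (rule B)
      obtain b where "\<phi> (pmonom A d {#}) = pmonom B b {#}"
        using discriminant_constant[OF assms(3) B \<phi> n assms(4) domZ assms(6,7) nz] by blast
      then have const: "\<exists>b\<in>carrier B. \<phi> (pmonom A a {#}) = pmonom B b {#}" if "a \<in> carrier A" for a
        by (rule effective_image_of_constants[OF assms(1,3) B \<phi> eff _ that])
      have surj: "\<exists>a\<in>carrier A. \<phi> (pmonom A a {#}) = pmonom B b {#}" if "b \<in> carrier B" for b
        by (rule constants_surjective[OF assms(3) B dom \<phi> const that])
      let ?h = "\<lambda>a. \<phi> (pmonom A a {#}) {#}"
      have h: "\<phi> (pmonom A a {#}) = pmonom B (?h a) {#}" if "a \<in> carrier A" for a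
        using const[OF that] by (auto simp: pmonom_def)
      have "inj_on ?h (carrier A)"
      proof (rule inj_onI)
        fix a a' assume a: "a \<in> carrier A" "a' \<in> carrier A" "?h a = ?h a'"
        then have "\<phi> (pmonom A a {#}) = \<phi> (pmonom A a' {#})" using h by metis
        moreover have "pmonom A a {#} \<in> carrier (poly_ext A n)" "pmonom A a' {#} \<in> carrier (poly_ext A n)"
          using a by (auto intro: A.pmonom_in_poly)
        ultimately have "pmonom A a {#} = (pmonom A a' {#} :: nat multiset \<Rightarrow> 'a)"
          using poisson_isoD(3)[OF \<phi>] by (metis bij_betw_def inj_onD)
        then show "a = a'" by (simp add: A.const_inj)
      qed
      moreover have "?h ` carrier A = carrier B"
        by (rule constant_terms_surjective[OF assms(3) B \<phi> surj[OF B.center_sub]])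
      ultimately have "?h \<in> poisson_iso K A B"
        by (intro poisson_iso_of_constants[OF assms(3) B \<phi>]) (simp add: bij_betw_def)
      then show "poisson_isomorphic K A B" by (auto simp: poisson_isomorphic_def)
    qed
  next
    assume "noetherian_ring A \<and> domain (poisson_center A) \<and> effective K (poisson_center A) d"
    then have noeth: "noetherian_ring A" and domZ: "domain (poisson_center A)"
      and eff: "effective K (poisson_center A) d" by auto
    have nz: "d \<noteq> \<zero>\<^bsub>A\<^esub>" using eff by (auto simp: effective_def)
    show "strongly_poisson_cancellative K A"
      unfolding strongly_poisson_cancellative_def
    proof (intro allI impI)
      fix B :: "('k, 'a) palg" and n :: nat
      assume B: "poisson_algebra K B" and n: "1 \<le> n"
        and "poisson_isomorphic K (poly_ext A n) (poly_ext B n)"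
      then obtain \<phi> where \<phi>: "\<phi> \<in> poisson_iso K (poly_ext A n) (poly_ext B n)"
        by (auto simp: poisson_isomorphic_def)
      interpret B: poisson_algebra K B by (rule B)
      interpret cB: poisson_algebra K "poisson_center B" by (rule B.poisson_center_poisson)
      let ?\<psi> = "inv_into (carrier (poly_ext A n)) \<phi>"
      have \<psi>: "?\<psi> \<in> poisson_iso K (poly_ext B n) (poly_ext A n)"
        by (rule poisson_iso_inverse[OF A.poly_ext_poisson \<phi>])
      have \<phi>Z: "\<phi> \<in> poisson_iso K (poly_ext (poisson_center A) n) (poly_ext (poisson_center B) n)"
        by (rule poisson_iso_poly_center[OF assms(3) B \<phi>])
      obtain b where "\<phi> (pmonom A d {#}) = pmonom B b {#}"
        using discriminant_constant[OF assms(3) B \<phi> n assms(4) domZ assms(6,7) nz] by blast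
      then have "\<phi> (pmonom (poisson_center A) d {#}) = pmonom (poisson_center B) b {#}"
        by (simp only: A.pmonom_center B.pmonom_center)
      then have constZ: "\<exists>z'\<in>carrier (poisson_center B).
          \<phi> (pmonom (poisson_center A) z {#}) = pmonom (poisson_center B) z' {#}"
        if "z \<in> carrier (poisson_center A)" for z
        by (rule effective_image_of_constants[OF assms(1) cA.poisson_algebra_axioms
              cB.poisson_algebra_axioms \<phi>Z disjI1[OF eff] _ that])
      have "\<exists>z\<in>carrier (poisson_center A).
          \<phi> (pmonom (poisson_center A) z {#}) = pmonom (poisson_center B) z' {#}"
        if "z' \<in> carrier (poisson_center B)" for z'
        by (rule constants_surjective[OF cA.poisson_algebra_axioms cB.poisson_algebra_axioms
              domZ \<phi>Z constZ that])
      then have toB: "\<exists>a\<in>carrier A. \<phi> (pmonom A a {#}) = pmonom B z {#}"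
        if "z \<in> carrier (poisson_center B)" for z
        using that A.center_sub unfolding A.pmonom_center B.pmonom_center by blast
      have toA: "\<exists>b\<in>carrier B. ?\<psi> (pmonom B b {#}) = pmonom A z {#}"
        if z: "z \<in> carrier (poisson_center A)" for z
      proof -
        obtain b where b: "b \<in> carrier B" "\<phi> (pmonom A z {#}) = pmonom B b {#}"
          using constZ[OF z] B.center_sub unfolding A.pmonom_center B.pmonom_center by blast
        have "pmonom A z {#} \<in> carrier (poly_ext A n)"
          using A.center_sub[OF z] by (intro A.pmonom_in_poly) auto
        then have "?\<psi> (pmonom B b {#}) = pmonom A z {#}"
          using bij_betw_inv_into_left[OF poisson_isoD(3)[OF \<phi>]] b(2) by metis
        then show ?thesis using b(1) by blast
      qed
      let ?h = "\<lambda>a. \<phi> (pmonom A a {#}) {#}" and ?h' = "\<lambda>b. ?\<psi> (pmonom B b {#}) {#}"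
      have h: "?h ` carrier A = carrier B" by (rule constant_terms_surjective[OF assms(3) B \<phi> toB])
      have h': "?h' ` carrier B = carrier A" by (rule constant_terms_surjective[OF B assms(3) \<psi> toA])
      have "(\<lambda>f. f {#}) \<circ> (\<phi> \<circ> (\<lambda>a. pmonom A a {#})) \<in> ring_hom A B"
        by (intro ring_hom_trans[OF ring_hom_trans[OF A.const_ring_hom poisson_isoD(2)[OF \<phi>]] B.const_term_ring_hom])
      moreover have "(\<lambda>f. f {#}) \<circ> (?\<psi> \<circ> (\<lambda>b. pmonom B b {#})) \<in> ring_hom B A"
        by (intro ring_hom_trans[OF ring_hom_trans[OF B.const_ring_hom poisson_isoD(2)[OF \<psi>]] A.const_term_ring_hom])
      ultimately have "?h' \<circ> ?h \<in> ring_hom A A" using ring_hom_trans by (fastforce simp: o_def)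
      moreover have "(?h' \<circ> ?h) ` carrier A = carrier A" by (simp only: image_comp[symmetric] h h')
      ultimately have "inj_on (?h' \<circ> ?h) (carrier A)"
        by (rule noetherian_ring.surjective_endomorphism_injective[OF noeth])
      then have "inj_on ?h (carrier A)" by (rule inj_on_imageI2)
      then have "?h \<in> poisson_iso K A B"
        using h by (intro poisson_iso_of_constants[OF assms(3) B \<phi>]) (simp add: bij_betw_def)
      then show "poisson_isomorphic K A B" by (auto simp: poisson_isomorphic_def)
    qed
  }
qed

end
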